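(* Let $\mathfrak G$ be an ind-group. (a) $L_{\mathfrak G}\subseteq\operatorname{Lie}\mathfrak G$ is stable under the adjoint action of $\mathfrak G$, and $L_{\mathfrak G}$ is an ideal in $\operatorname{Lie}\mathfrak G$. (b) For every algebraic subgroup $G\subseteq\mathfrak G$ we have $\operatorname{Lie}G\subseteq L_{\mathfrak G}$. (c) $L_{\mathfrak G^\circ}=L_{\mathfrak G}$. (d) $L_{\mathfrak G}$ is finite dimensional if and only if $\mathfrak G^\circ$ is an algebraic group, and in this case $L_{\mathfrak G}=\operatorname{Lie}\mathfrak G$.
   Context: $\Bbbk$ is an algebraically closed field of characteristic zero; all varieties are over $\Bbbk$ and algebraic groups are affine. An (affine) ind-variety is a set $\mathfrak V$ with a filtration $\mathfrak V_1\subseteq\mathfrak V_2\subseteq\cdots$, $\mathfrak V=\bigcup_k\mathfrak V_k$, where each $\mathfrak V_k$ is an affine variety and is a closed subvariety of $\mathfrak V_{k+1}$. A subset is closed if its intersection with every $\mathfrak V_k$ is closed. A morphism $\mathfrak V\to\mathfrak W$ is a map which for each $k$ sends $\mathfrak V_k$ into some $\mathfrak W_l$ by a morphism of varieties. $T_x\mathfrak V=\varinjlim T_x\mathfrak V_k$. An ind-group is a group which is an ind-variety such that multiplication and inversion are morphisms; $\operatorname{Lie}\mathfrak G:=T_e\mathfrak G$ with its natural Lie algebra structure, on which $\mathfrak G$ acts by the adjoint action $\operatorname{Ad}(g)=d(\operatorname{Int}g)_e$. $\mathfrak G^\circ$ is the connected component of $e$. A subset is bounded if it is contained in some $\mathfrak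 V_k$, and algebraic if it is bounded and locally closed; an algebraic subgroup is a subgroup which is an algebraic subset (it is closed and a linear algebraic group). $X_{\mathrm{reg}}$ is the set of smooth points of $X$. Define $L_{\mathfrak G}:=\operatorname{span}(T_eX\mid X\subseteq\mathfrak G\text{ algebraic and }e\in X_{\mathrm{reg}})\subseteq\operatorname{Lie}\mathfrak G$. *)

theory Defs
  imports
    "HOL-Analysis.Abstract_Topology_2"
    "HOL-Library.Function_Algebras"
    "HOL-Library.Extended_Nat"
    "HOL-Computational_Algebra.Polynomial"
    "HOL-Algebra.Group"
begin

text \<open>Polynomial functions on affine $n$-space.  The space itself consists of the functions
  from the natural numbers to the field that vanish from $n$ on.  Over an infinite field,
  such as the algebraically closed field of an ind-group below, a polynomial is determined by its
  polynomial function.\<close>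

definition affine_space :: "nat \<Rightarrow> (nat \<Rightarrow> 'k::zero) set" where
  "affine_space n = {v. \<forall>i\<ge>n. v i = 0}"

inductive_set poly_fun :: "nat \<Rightarrow> ((nat \<Rightarrow> 'k::comm_ring_1) \<Rightarrow> 'k) set" for n :: nat where
  const: "(\<lambda>v. c) \<in> poly_fun n"
| coord: "i < n \<Longrightarrow> (\<lambda>v. v i) \<in> poly_fun n"
| add: "p \<in> poly_fun n \<Longrightarrow> q \<in> poly_fun n \<Longrightarrow> (\<lambda>v. p v + q v) \<in> poly_fun n"
| mult: "p \<in> poly_fun n \<Longrightarrow> q \<in> poly_fun n \<Longrightarrow> (\<lambda>v. p v * q v) \<in> poly_fun n"

definition zero_locus :: "nat \<Rightarrow> ((nat \<Rightarrow> 'k::comm_ring_1) \<Rightarrow> 'k) set \<Rightarrow> (nat \<Rightarrow> 'k) set" where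
  "zero_locus n S = {v \<in> affine_space n. \<forall>p\<in>S. p v = 0}"

text \<open>A variety is a set of points together with its regular functions.  A regular function is
  represented by an arbitrary total function on the ambient type whose restriction to the points is
  regular: the set \<open>reg X\<close> is saturated under equality on \<open>pts X\<close>, and the
  coordinate ring is the ring of restrictions of its members to \<open>pts X\<close>.  Hence pullback
  along a map is plain composition, and a closed subvariety has more representatives than the variety
  containing it.\<close>

record ('a, 'k) variety =
  pts :: "'a set"
  reg :: "('a \<Rightarrow> 'k) set"

text \<open>An affine variety is a set with functions that is isomorphic to a Zariski closed subset of
  some affine space.  Varieties need not be irreducible.\<close>

definition affine_variety :: "('a, 'k::field) variety \<Rightarrow> bool" where
  "affine_variety X \<longleftrightarrow>
     (\<exists>n S \<phi>. S \<subseteq> poly_fun n \<and> bij_betw \<phi> (pts X) (zero_locus n S) \<and>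
        reg X = {f. \<exists>p\<in>poly_fun n. \<forall>x\<in>pts X. f x = p (\<phi> x)})"

definition zariski_closed_in :: "('a, 'k::field) variety \<Rightarrow> 'a set \<Rightarrow> bool" where
  "zariski_closed_in X Z \<longleftrightarrow> (\<exists>F\<subseteq>reg X. Z = {x \<in> pts X. \<forall>f\<in>F. f x = 0})"

text \<open>Meaningful as a variety only for Zariski closed \<open>Z\<close>.\<close>

definition subvariety :: "('a, 'k::field) variety \<Rightarrow> 'a set \<Rightarrow> ('a, 'k) variety" where
  "subvariety X Z = \<lparr>pts = Z, reg = {f. \<exists>g\<in>reg X. \<forall>x\<in>Z. f x = g x}\<rparr>"

definition is_closed_subvariety :: "('a, 'k::field) variety \<Rightarrow> ('a, 'k) variety \<Rightarrow> bool" where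
  "is_closed_subvariety Y X \<longleftrightarrow> zariski_closed_in X (pts Y) \<and> Y = subvariety X (pts Y)"

definition variety_morphism ::
  "('a, 'k) variety \<Rightarrow> ('b, 'k::field) variety \<Rightarrow> ('a \<Rightarrow> 'b) \<Rightarrow> bool" where
  "variety_morphism X Y \<phi> \<longleftrightarrow> \<phi> ` pts X \<subseteq> pts Y \<and> (\<forall>f\<in>reg Y. f \<circ> \<phi> \<in> reg X)"

text \<open>The product of affine varieties: its coordinate ring is the tensor product of the two
  coordinate rings.\<close>

definition prod_variety ::
  "('a, 'k) variety \<Rightarrow> ('b, 'k::field) variety \<Rightarrow> ('a \<times> 'b, 'k) variety" where
  "prod_variety X Y =
     \<lparr>pts = pts X \<times> pts Y,
      reg = {h. \<exists>(n::nat) f g. (\<forall>i<n. f i \<in> reg X \<and> g i \<in> reg Y) \<and>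
              (\<forall>x\<in>pts X. \<forall>y\<in>pts Y. h (x, y) = (\<Sum>i<n. f i x * g i y))}\<rparr>"

type_synonym ('a, 'k) ind_var = "nat \<Rightarrow> ('a, 'k) variety"

definition ind_variety :: "('a, 'k::field) ind_var \<Rightarrow> bool" where
  "ind_variety V \<longleftrightarrow> (\<forall>k. affine_variety (V k) \<and> is_closed_subvariety (V k) (V (Suc k)))"

definition ind_pts :: "('a, 'k) ind_var \<Rightarrow> 'a set" where
  "ind_pts V = (\<Union>k. pts (V k))"

definition ind_reg :: "('a, 'k) ind_var \<Rightarrow> ('a \<Rightarrow> 'k) set" where
  "ind_reg V = (\<Inter>k. reg (V k))"

definition ind_morphism ::
  "('a, 'k) ind_var \<Rightarrow> ('b, 'k::field) ind_var \<Rightarrow> ('a \<Rightarrow> 'b) \<Rightarrow> bool" where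
  "ind_morphism V W \<phi> \<longleftrightarrow> (\<forall>k. \<exists>l. variety_morphism (V k) (W l) \<phi>)"

definition ind_prod ::
  "('a, 'k) ind_var \<Rightarrow> ('b, 'k::field) ind_var \<Rightarrow> ('a \<times> 'b, 'k) ind_var" where
  "ind_prod V W = (\<lambda>k. prod_variety (V k) (W k))"

definition ind_sub :: "('a, 'k::field) ind_var \<Rightarrow> 'a set \<Rightarrow> ('a, 'k) ind_var" where
  "ind_sub V Z = (\<lambda>k. subvariety (V k) (pts (V k) \<inter> Z))"

definition ind_zariski :: "('a, 'k::field) ind_var \<Rightarrow> 'a topology" where
  "ind_zariski V = topology (\<lambda>U. U \<subseteq> ind_pts V \<and>
     (\<forall>k. zariski_closed_in (V k) (pts (V k) - U)))"

lemma affine_variety_reg: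
  assumes "affine_variety X"
  shows affine_variety_reg_const: "(\<lambda>x. c) \<in> reg X"
    and affine_variety_reg_mult: "f \<in> reg X \<Longrightarrow> g \<in> reg X \<Longrightarrow> (\<lambda>x. f x * g x) \<in> reg X"
    and affine_variety_reg_add: "f \<in> reg X \<Longrightarrow> g \<in> reg X \<Longrightarrow> (\<lambda>x. f x + g x) \<in> reg X"
    and affine_variety_reg_cong: "f \<in> reg X \<Longrightarrow> (\<And>x. x \<in> pts X \<Longrightarrow> f x = g x) \<Longrightarrow> g \<in> reg X"
proof -
  obtain n \<phi> where R: "reg X = {f. \<exists>p\<in>poly_fun n. \<forall>x\<in>pts X. f x = p (\<phi> x)}"
    using assms unfolding affine_variety_def by blast
  show "(\<lambda>x. c) \<in> reg X"
    unfolding R using poly_fun.const[of c n] by (auto intro!: bexI[of _ "\<lambda>v. c"])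
  show "(\<lambda>x. f x * g x) \<in> reg X" if fg: "f \<in> reg X" "g \<in> reg X"
  proof -
    obtain p q where "p \<in> poly_fun n" "\<forall>x\<in>pts X. f x = p (\<phi> x)"
      "q \<in> poly_fun n" "\<forall>x\<in>pts X. g x = q (\<phi> x)"
      using fg unfolding R by blast
    then show ?thesis
      unfolding R by (auto intro!: bexI[of _ "\<lambda>v. p v * q v"] poly_fun.mult)
  qed
  show "(\<lambda>x. f x + g x) \<in> reg X" if fg: "f \<in> reg X" "g \<in> reg X"
  proof -
    obtain p q where "p \<in> poly_fun n" "\<forall>x\<in>pts X. f x = p (\<phi> x)"
      "q \<in> poly_fun n" "\<forall>x\<in>pts X. g x = q (\<phi> x)"
      using fg unfolding R by blast
    then show ?thesis
      unfolding R by (auto intro!: bexI[of _ "\<lambda>v. p v + q v"] poly_fun.add)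
  qed
  show "g \<in> reg X" if "f \<in> reg X" "\<And>x. x \<in> pts X \<Longrightarrow> f x = g x"
    using that unfolding R by auto
qed

lemma zariski_closed_in_Un:
  assumes "affine_variety X" "zariski_closed_in X A" "zariski_closed_in X B"
  shows "zariski_closed_in X (A \<union> B)"
proof -
  obtain F G where F: "F \<subseteq> reg X" "A = {x \<in> pts X. \<forall>f\<in>F. f x = 0}"
    and G: "G \<subseteq> reg X" "B = {x \<in> pts X. \<forall>f\<in>G. f x = 0}"
    using assms(2,3) unfolding zariski_closed_in_def by blast
  let ?H = "{\<lambda>x. f x * g x | f g. f \<in> F \<and> g \<in> G}"
  have "?H \<subseteq> reg X"
    using affine_variety_reg_mult[OF assms(1)] subsetD[OF F(1)] subsetD[OF G(1)] by auto
  moreover have "A \<union> B = {x \<in> pts X. \<forall>h\<in>?H. h x = 0}"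
  proof (intro equalityI subsetI)
    fix x assume "x \<in> A \<union> B"
    then show "x \<in> {x \<in> pts X. \<forall>h\<in>?H. h x = 0}" unfolding F(2) G(2) by auto
  next
    fix x assume x: "x \<in> {x \<in> pts X. \<forall>h\<in>?H. h x = 0}"
    show "x \<in> A \<union> B"
    proof (rule ccontr)
      assume "x \<notin> A \<union> B"
      then obtain f g where fg: "f \<in> F" "f x \<noteq> 0" "g \<in> G" "g x \<noteq> 0"
        using x unfolding F(2) G(2) by auto
      then have "(\<lambda>x. f x * g x) \<in> ?H" by auto
      then have "f x * g x = 0" using x by fast
      then show False using fg by simp
    qed
  qed
  ultimately show ?thesis unfolding zariski_closed_in_def by (intro exI[of _ ?H] conjI)
qed

lemma zariski_closed_in_pts: "zariski_closed_in X (pts X)"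
  unfolding zariski_closed_in_def by (rule exI[of _ "{}"]) auto

lemma zariski_closed_in_Inter:
  assumes "\<And>Z. Z \<in> \<Z> \<Longrightarrow> zariski_closed_in X Z"
  shows "zariski_closed_in X (pts X \<inter> \<Inter>\<Z>)"
proof -
  define F where "F Z = {f \<in> reg X. \<forall>x\<in>Z. f x = 0}" for Z
  have F: "Z = {x \<in> pts X. \<forall>f\<in>F Z. f x = 0}" if "Z \<in> \<Z>" for Z
  proof -
    obtain G where G: "G \<subseteq> reg X" "Z = {x \<in> pts X. \<forall>f\<in>G. f x = 0}"
      using assms[OF \<open>Z \<in> \<Z>\<close>] unfolding zariski_closed_in_def by (elim exE conjE)
    have "G \<subseteq> F Z" using G unfolding F_def by auto
    then show ?thesis using G(2) unfolding F_def by auto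
  qed
  have "\<Union>(F ` \<Z>) \<subseteq> reg X" unfolding F_def by auto
  moreover have "pts X \<inter> \<Inter>\<Z> = {x \<in> pts X. \<forall>f\<in>\<Union>(F ` \<Z>). f x = 0}" (is "?l = ?r")
  proof (intro equalityI subsetI)
    fix x assume x: "x \<in> ?l"
    show "x \<in> ?r"
    proof (intro CollectI conjI ballI)
      show "x \<in> pts X" using x by blast
      fix f assume "f \<in> \<Union>(F ` \<Z>)"
      then obtain Z where Z: "Z \<in> \<Z>" "f \<in> F Z" by blast
      then have "x \<in> {x \<in> pts X. \<forall>f\<in>F Z. f x = 0}" using x F[of Z] by auto
      then show "f x = 0" using Z by blast
    qed
  next
    fix x assume x: "x \<in> ?r"
    have "x \<in> Z" if Z: "Z \<in> \<Z>" for Z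
    proof -
      have "x \<in> {x \<in> pts X. \<forall>f\<in>F Z. f x = 0}" using x Z by blast
      then show ?thesis using F[OF Z] by simp
    qed
    then show "x \<in> ?l" using x by blast
  qed
  ultimately show ?thesis
    unfolding zariski_closed_in_def by (intro exI[of _ "\<Union>(F ` \<Z>)"] conjI)
qed

lemma istopology_ind_zariski:
  assumes "ind_variety V"
  shows "istopology (\<lambda>U. U \<subseteq> ind_pts V \<and>
     (\<forall>k. zariski_closed_in (V k) (pts (V k) - U)))"
  unfolding istopology_def
proof (intro conjI allI impI)
  fix S T k
  assume S: "S \<subseteq> ind_pts V \<and> (\<forall>k. zariski_closed_in (V k) (pts (V k) - S))"
    and T: "T \<subseteq> ind_pts V \<and> (\<forall>k. zariski_closed_in (V k) (pts (V k) - T))"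
  show "S \<inter> T \<subseteq> ind_pts V"
    using conjunct1[OF S] by (rule le_infI1)
  have "affine_variety (V k)"
    using assms unfolding ind_variety_def by simp
  then show "zariski_closed_in (V k) (pts (V k) - S \<inter> T)"
    unfolding Diff_Int
    using conjunct2[OF S, THEN spec] conjunct2[OF T, THEN spec] by (rule zariski_closed_in_Un)
next
  fix \<K> k
  assume K: "\<forall>U\<in>\<K>. U \<subseteq> ind_pts V \<and> (\<forall>k. zariski_closed_in (V k) (pts (V k) - U))"
  show "\<Union>\<K> \<subseteq> ind_pts V"
    by (rule Union_least) (rule conjunct1[OF bspec[OF K]])
  have eq: "pts (V k) - \<Union>\<K> = pts (V k) \<inter> \<Inter>((\<lambda>U. pts (V k) - U) ` \<K>)"
    by fast
  show "zariski_closed_in (V k) (pts (V k) - \<Union>\<K>)"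
    unfolding eq
  proof (rule zariski_closed_in_Inter, erule imageE)
    fix Z U assume "Z = pts (V k) - U" "U \<in> \<K>"
    then show "zariski_closed_in (V k) Z"
      using conjunct2[OF bspec[OF K]] by simp
  qed
qed

lemma openin_ind_zariski:
  assumes "ind_variety V"
  shows "openin (ind_zariski V) U \<longleftrightarrow>
    U \<subseteq> ind_pts V \<and> (\<forall>k. zariski_closed_in (V k) (pts (V k) - U))"
  unfolding ind_zariski_def topology_inverse'[OF istopology_ind_zariski[OF assms]] ..

lemma topspace_ind_zariski:
  fixes V :: "('a, 'k::field) ind_var"
  assumes "ind_variety V"
  shows "topspace (ind_zariski V) = ind_pts V"
proof (rule subset_antisym)
  show "topspace (ind_zariski V) \<subseteq> ind_pts V"
    using openin_topspace[of "ind_zariski V"] unfolding openin_ind_zariski[OF assms] by (rule conjunct1)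
  have "openin (ind_zariski V) (ind_pts V)"
    unfolding openin_ind_zariski[OF assms]
  proof (intro conjI allI subset_refl)
    fix k
    let ?F = "{(\<lambda>x. 1) :: 'a \<Rightarrow> 'k}"
    have "pts (V k) - ind_pts V = {x \<in> pts (V k). \<forall>f\<in>?F. f x = 0}"
      unfolding ind_pts_def by auto
    moreover have "?F \<subseteq> reg (V k)"
      using assms affine_variety_reg_const[of "V k" 1] unfolding ind_variety_def by simp
    ultimately show "zariski_closed_in (V k) (pts (V k) - ind_pts V)"
      unfolding zariski_closed_in_def by (intro exI[of _ ?F] conjI)
  qed
  then show "ind_pts V \<subseteq> topspace (ind_zariski V)"
    by (rule openin_subset)
qed

lemma closedin_ind_zariski:
  assumes "ind_variety V"
  shows "closedin (ind_zariski V) Z \<longleftrightarrow>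
    Z \<subseteq> ind_pts V \<and> (\<forall>k. zariski_closed_in (V k) (pts (V k) \<inter> Z))"
proof -
  have eq: "pts (V k) - (ind_pts V - Z) = pts (V k) \<inter> Z" for k
    unfolding ind_pts_def by fast
  have "ind_pts V - Z \<subseteq> ind_pts V" by (rule Diff_subset)
  then show ?thesis
    unfolding closedin_def topspace_ind_zariski[OF assms] openin_ind_zariski[OF assms] eq
    by (simp only: simp_thms)
qed

definition bounded_subset :: "('a, 'k) ind_var \<Rightarrow> 'a set \<Rightarrow> bool" where
  "bounded_subset V X \<longleftrightarrow> (\<exists>k. X \<subseteq> pts (V k))"

definition locally_closed_in :: "'a topology \<Rightarrow> 'a set \<Rightarrow> bool" where
  "locally_closed_in T X \<longleftrightarrow> (\<exists>U C. openin T U \<and> closedin T C \<and> X = U \<inter> C)"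

definition algebraic_subset :: "('a, 'k::field) ind_var \<Rightarrow> 'a set \<Rightarrow> bool" where
  "algebraic_subset V X \<longleftrightarrow> bounded_subset V X \<and> locally_closed_in (ind_zariski V) X"

definition scale_functional ::
  "'k \<Rightarrow> (('a \<Rightarrow> 'k) \<Rightarrow> 'k) \<Rightarrow> (('a \<Rightarrow> 'k::field) \<Rightarrow> 'k)" where
  "scale_functional c A = (\<lambda>f. c * A f)"

global_interpretation functional: vector_space scale_functional
  by unfold_locales
    (auto simp: scale_functional_def fun_eq_iff algebra_simps)

definition finite_dimensional :: "(('a \<Rightarrow> 'k::field) \<Rightarrow> 'k) set \<Rightarrow> bool" where
  "finite_dimensional L \<longleftrightarrow> (\<exists>B. finite B \<and> functional.span B = L)"

text \<open>The tangent space at \<open>x\<close>: the point derivations of the coordinate ring at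
  \<open>x\<close>.  By \<open>tangent_space_cong\<close> below such a functional depends only on the values
  on \<open>pts X\<close>, that is, it is a functional on the coordinate ring.  Outside
  \<open>reg X\<close> it is set to zero, so that equal derivations are equal functionals.\<close>

definition tangent_space ::
  "('a, 'k::field) variety \<Rightarrow> 'a \<Rightarrow> (('a \<Rightarrow> 'k) \<Rightarrow> 'k) set" where
  "tangent_space X x = {A.
     (\<forall>f. f \<notin> reg X \<longrightarrow> A f = 0) \<and>
     (\<forall>f\<in>reg X. \<forall>g\<in>reg X. A (\<lambda>y. f y + g y) = A f + A g) \<and>
     (\<forall>c. \<forall>f\<in>reg X. A (\<lambda>y. c * f y) = c * A f) \<and>
     (\<forall>f\<in>reg X. \<forall>g\<in>reg X. A (\<lambda>y. f y * g y) = f x * A g + g x * A f)}"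

lemma tangent_space_cong:
  assumes "affine_variety X" "x \<in> pts X" "A \<in> tangent_space X x" "f \<in> reg X"
    and eq: "\<And>y. y \<in> pts X \<Longrightarrow> f y = g y"
  shows "A f = A g"
proof -
  have A_add: "A (\<lambda>y. u y + v y) = A u + A v"
    and A_mult: "A (\<lambda>y. u y * v y) = u x * A v + v x * A u"
    if "u \<in> reg X" "v \<in> reg X" for u v
    using assms(3) that unfolding tangent_space_def by auto
  define h where "h = (\<lambda>y. g y - f y)"
  define e where "e = (\<lambda>y. if y \<in> pts X then 0 else (1::'b))"
  have zero: "(\<lambda>y. 0) \<in> reg X" by (rule affine_variety_reg_const[OF assms(1)])
  have h: "h \<in> reg X" "h x = 0" and e: "e \<in> reg X" "e x = 0"
    using affine_variety_reg_cong[OF assms(1) zero] eq assms(2) by (auto simp: h_def e_def)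
  have "h = (\<lambda>y. h y * e y)"
    by (auto simp: h_def e_def eq)
  then have "A h = 0"
    using A_mult[OF h(1) e(1)] h(2) e(2) by simp
  moreover have "g = (\<lambda>y. f y + h y)" by (simp add: h_def)
  ultimately show ?thesis using A_add[OF assms(4) h(1)] by simp
qed

text \<open>The differential of \<open>\<phi>\<close>, where \<open>R\<close> is the set of regular functions on
  the target.\<close>

definition differential ::
  "('b \<Rightarrow> 'k) set \<Rightarrow> ('a \<Rightarrow> 'b) \<Rightarrow> (('a \<Rightarrow> 'k) \<Rightarrow> 'k) \<Rightarrow> (('b \<Rightarrow> 'k::field) \<Rightarrow> 'k)" where
  "differential R \<phi> A = (\<lambda>f. if f \<in> R then A (f \<circ> \<phi>) else 0)"

text \<open>The tangent space of an ind-variety is the direct limit of the tangent spaces of the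
  members of the filtration.  Here it is realized as the union of their images in the functionals on the
  regular functions of the ind-variety.  The images are increasing, and the maps onto them
  are injective by \<open>inj_on_differential_filtration\<close> below, so that this union is
  the direct limit.\<close>

definition ind_tangent_space ::
  "('a, 'k::field) ind_var \<Rightarrow> 'a \<Rightarrow> (('a \<Rightarrow> 'k) \<Rightarrow> 'k) set" where
  "ind_tangent_space V x =
     (\<Union>k\<in>{k. x \<in> pts (V k)}. differential (ind_reg V) id ` tangent_space (V k) x)"

lemma ind_variety_step:
  assumes "ind_variety V"
  shows "pts (V j) \<subseteq> pts (V (Suc j))"
    and "reg (V j) = {f. \<exists>g\<in>reg (V (Suc j)). \<forall>x\<in>pts (V j). f x = g x}"
proof -
  have c: "is_closed_subvariety (V j) (V (Suc j))"
    using assms unfolding ind_variety_def by simp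
  then show "pts (V j) \<subseteq> pts (V (Suc j))"
    unfolding is_closed_subvariety_def zariski_closed_in_def by auto
  have "V j = subvariety (V (Suc j)) (pts (V j))"
    using c unfolding is_closed_subvariety_def by (rule conjunct2)
  from arg_cong[OF this, of reg]
  show "reg (V j) = {f. \<exists>g\<in>reg (V (Suc j)). \<forall>x\<in>pts (V j). f x = g x}"
    by (simp only: subvariety_def variety.select_convs)
qed

lemma ind_variety_mono:
  assumes "ind_variety V" "k \<le> l"
  shows "pts (V k) \<subseteq> pts (V l)" "reg (V l) \<subseteq> reg (V k)"
proof -
  have p: "pts (V j) \<subseteq> pts (V (Suc j))" for j by (rule ind_variety_step(1)[OF assms(1)])
  have r: "reg (V (Suc j)) \<subseteq> reg (V j)" for j
    using ind_variety_step(2)[OF assms(1), of j] by auto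
  show "pts (V k) \<subseteq> pts (V l)"
    by (rule lift_Suc_mono_le[of "\<lambda>k. pts (V k)", OF p assms(2)])
  show "reg (V l) \<subseteq> reg (V k)"
    by (rule lift_Suc_antimono_le[of "\<lambda>k. reg (V k)", OF r assms(2)])
qed

lemma ind_reg_extend:
  assumes V: "ind_variety V" and f: "f \<in> reg (V k)"
  obtains F where "F \<in> ind_reg V" "\<And>x. x \<in> pts (V k) \<Longrightarrow> F x = f x"
proof -
  have step: "\<exists>h. h \<in> reg (V (Suc j)) \<and> (\<forall>x\<in>pts (V j). h x = g x)" if "g \<in> reg (V j)" for g j
    using that unfolding ind_variety_step(2)[OF V, of j] by force
  have "\<exists>g. \<forall>j. (g j \<in> reg (V (k + j)) \<and> (j = 0 \<longrightarrow> g j = f)) \<and>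
      (\<forall>x\<in>pts (V (k + j)). g (Suc j) x = g j x)"
    by (rule dependent_nat_choice) (use f step in auto)
  then obtain g where g: "\<And>j. g j \<in> reg (V (k + j))" "g 0 = f"
    and gS: "\<And>j x. x \<in> pts (V (k + j)) \<Longrightarrow> g (Suc j) x = g j x"
    by blast
  have g_eq: "g (i + d) x = g i x" if "x \<in> pts (V (k + i))" for i d x
  proof (induction d)
    case (Suc d)
    have "x \<in> pts (V (k + (i + d)))"
      using ind_variety_mono(1)[OF V, of "k + i" "k + (i + d)"] that by auto
    with Suc show ?case using gS by simp
  qed simp
  define F where "F = (\<lambda>x. g (LEAST j. x \<in> pts (V (k + j))) x)"
  have F_eq: "F x = g j x" if "x \<in> pts (V (k + j))" for j x
  proof -
    let ?i = "LEAST j. x \<in> pts (V (k + j))"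
    have "x \<in> pts (V (k + ?i))" "?i \<le> j"
      using that by (rule LeastI, rule Least_le)
    then show ?thesis using g_eq[of x ?i "j - ?i"] by (simp add: F_def)
  qed
  have Fk: "F \<in> reg (V (k + j))" for j
    by (rule affine_variety_reg_cong[OF _ g(1)[of j]])
      (use V F_eq in \<open>auto simp: ind_variety_def\<close>)
  have "F \<in> reg (V m)" for m
    using Fk[of m] ind_variety_mono(2)[OF V, of m "k + m"] by auto
  then have "F \<in> ind_reg V" unfolding ind_reg_def by blast
  moreover have "F x = f x" if "x \<in> pts (V k)" for x
    using F_eq[of x 0] g(2) that by simp
  ultimately show thesis by (rule that)
qed

lemma inj_on_differential_filtration:
  assumes V: "ind_variety V" and x: "x \<in> pts (V k)"
  shows "inj_on (differential (ind_reg V) id) (tangent_space (V k) x)"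
proof (rule inj_onI)
  fix A B
  assume A: "A \<in> tangent_space (V k) x" and B: "B \<in> tangent_space (V k) x"
    and eq: "differential (ind_reg V) id A = differential (ind_reg V) id B"
  have aff: "affine_variety (V k)" using V unfolding ind_variety_def by blast
  show "A = B"
  proof
    fix f show "A f = B f"
    proof (cases "f \<in> reg (V k)")
      case True
      then obtain F where F: "F \<in> ind_reg V" "\<And>y. y \<in> pts (V k) \<Longrightarrow> F y = f y"
        using ind_reg_extend[OF V] by blast
      have "A F = B F"
        using fun_cong[OF eq, of F] F(1) by (simp add: differential_def)
      then show ?thesis
        using tangent_space_cong[OF aff x A True, of F] tangent_space_cong[OF aff x B True, of F] F(2)
        by simp
    next
      case False
      then show ?thesis using A B unfolding tangent_space_def by simp
    qed
  qed
qed

text \<open>The tangent space of an algebraic subset \<open>X\<close>, inside the tangent space of the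
  ind-variety.  The set \<open>X\<close> is open in its closure, which is a closed subvariety of some
  \<open>V k\<close>, and so both have the same tangent space at the points of \<open>X\<close>.  The
  image does not depend on the choice of \<open>k\<close>.\<close>

definition subset_tangent_space ::
  "('a, 'k::field) ind_var \<Rightarrow> 'a set \<Rightarrow> 'a \<Rightarrow> (('a \<Rightarrow> 'k) \<Rightarrow> 'k) set" where
  "subset_tangent_space V X x =
     (\<Union>k\<in>{k. X \<subseteq> pts (V k)}. differential (ind_reg V) id `
        tangent_space (subvariety (V k) (ind_zariski V closure_of X)) x)"

definition irreducible_in :: "'a topology \<Rightarrow> 'a set \<Rightarrow> bool" where
  "irreducible_in T Z \<longleftrightarrow> Z \<subseteq> topspace T \<and> Z \<noteq> {} \<and>
     (\<forall>C D. closedin T C \<and> closedin T D \<and> Z \<subseteq> C \<union> D \<longrightarrow> Z \<subseteq> C \<or> Z \<subseteq> D)"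

definition irreducible_component :: "'a topology \<Rightarrow> 'a set \<Rightarrow> bool" where
  "irreducible_component T Z \<longleftrightarrow>
     irreducible_in T Z \<and> (\<forall>Z'. irreducible_in T Z' \<and> Z \<subseteq> Z' \<longrightarrow> Z' = Z)"

definition krull_dim :: "'a topology \<Rightarrow> enat" where
  "krull_dim T = Sup {enat n | n. \<exists>Z. (\<forall>i\<le>n. closedin T (Z i) \<and> irreducible_in T (Z i)) \<and>
     (\<forall>i<n. Z i \<subset> Z (Suc i))}"

definition local_dim :: "'a topology \<Rightarrow> 'a \<Rightarrow> enat" where
  "local_dim T x =
     Sup {krull_dim (subtopology T Z) | Z. irreducible_component T Z \<and> x \<in> Z}"

text \<open>The tangent spaces of an algebraic subset are finite dimensional, so \<open>functional.dim\<close>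
  (which is 0 in infinite dimension) is the true dimension here.\<close>

definition smooth_points :: "('a, 'k::field) ind_var \<Rightarrow> 'a set \<Rightarrow> 'a set" where
  "smooth_points V X = {x \<in> X.
     enat (functional.dim (subset_tangent_space V X x)) =
       local_dim (subtopology (ind_zariski V) X) x}"

locale ind_group = group G for G (structure) +
  fixes V :: "('a, 'k::{alg_closed_field,field_char_0}) ind_var"
  assumes ind_variety: "ind_variety V"
    and carrier_eq: "carrier G = ind_pts V"
    and mult_morphism: "ind_morphism (ind_prod V V) V (\<lambda>(x, y). x \<otimes> y)"
    and inv_morphism: "ind_morphism V V (\<lambda>x. inv x)"

definition Lie :: "('a, 'm) monoid_scheme \<Rightarrow> ('a, 'k::field) ind_var \<Rightarrow> (('a \<Rightarrow> 'k) \<Rightarrow> 'k) set" where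
  "Lie G V = ind_tangent_space V \<one>\<^bsub>G\<^esub>"

text \<open>The left invariant vector field with value \<open>A\<close> at the identity, as an operator
  on regular functions: at \<open>g\<close> it is the image of \<open>A\<close> under the differential of left
  translation by \<open>g\<close>.  The bracket on \<open>Lie G V\<close> is the commutator of these vector fields.\<close>

definition left_invariant_field ::
  "('a, 'm) monoid_scheme \<Rightarrow> ('a, 'k::field) ind_var \<Rightarrow>
     (('a \<Rightarrow> 'k) \<Rightarrow> 'k) \<Rightarrow> ('a \<Rightarrow> 'k) \<Rightarrow> ('a \<Rightarrow> 'k)" where
  "left_invariant_field G V A f = (\<lambda>g. differential (ind_reg V) (\<lambda>x. g \<otimes>\<^bsub>G\<^esub> x) A f)"

definition Lie_bracket ::
  "('a, 'm) monoid_scheme \<Rightarrow> ('a, 'k::field) ind_var \<Rightarrow>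
     (('a \<Rightarrow> 'k) \<Rightarrow> 'k) \<Rightarrow> (('a \<Rightarrow> 'k) \<Rightarrow> 'k) \<Rightarrow> (('a \<Rightarrow> 'k) \<Rightarrow> 'k)" where
  "Lie_bracket G V A B = (\<lambda>f. if f \<in> ind_reg V
     then A (left_invariant_field G V B f) - B (left_invariant_field G V A f) else 0)"

definition Lie_ideal ::
  "('a, 'm) monoid_scheme \<Rightarrow> ('a, 'k::field) ind_var \<Rightarrow> (('a \<Rightarrow> 'k) \<Rightarrow> 'k) set \<Rightarrow> bool" where
  "Lie_ideal G V I \<longleftrightarrow> I \<subseteq> Lie G V \<and> functional.subspace I \<and>
     (\<forall>A\<in>Lie G V. \<forall>B\<in>I. Lie_bracket G V A B \<in> I)"

definition Ad ::
  "('a, 'm) monoid_scheme \<Rightarrow> ('a, 'k::field) ind_var \<Rightarrow> 'a \<Rightarrow>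
     (('a \<Rightarrow> 'k) \<Rightarrow> 'k) \<Rightarrow> (('a \<Rightarrow> 'k) \<Rightarrow> 'k)" where
  "Ad G V g = differential (ind_reg V) (\<lambda>x. g \<otimes>\<^bsub>G\<^esub> x \<otimes>\<^bsub>G\<^esub> inv\<^bsub>G\<^esub> g)"

definition identity_component ::
  "('a, 'm) monoid_scheme \<Rightarrow> ('a, 'k::field) ind_var \<Rightarrow> 'a set" where
  "identity_component G V = connected_component_of_set (ind_zariski V) \<one>\<^bsub>G\<^esub>"

definition algebraic_subgroup ::
  "('a, 'm) monoid_scheme \<Rightarrow> ('a, 'k::field) ind_var \<Rightarrow> 'a set \<Rightarrow> bool" where
  "algebraic_subgroup G V H \<longleftrightarrow> subgroup H G \<and> algebraic_subset V H"

definition L_space ::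
  "('a, 'm) monoid_scheme \<Rightarrow> ('a, 'k::field) ind_var \<Rightarrow> (('a \<Rightarrow> 'k) \<Rightarrow> 'k) set" where
  "L_space G V = functional.span
     (\<Union>X\<in>{X. algebraic_subset V X \<and> \<one>\<^bsub>G\<^esub> \<in> smooth_points V X}.
        subset_tangent_space V X \<one>\<^bsub>G\<^esub>)"

end

theory Submission
  imports Defs
begin

text \<open>
  Everything is expressed through the ring \<open>R\<close> of regular functions on the ind-variety.  On a
  bounded set \<open>X\<close> the topology is given by zero sets of functions in \<open>R\<close>, irreducible
  means that the functions vanishing on \<open>X\<close> form a prime ideal, and the tangent space at
  \<open>x\<close> is the space \<open>point_derivs R X x\<close> of derivations of \<open>R\<close> at
  \<open>x\<close> that kill the functions vanishing on \<open>X\<close>.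

  The geometric input is that an irreducible closed bounded set has Krull dimension equal to the dimension
  of its tangent space at a general point (\<open>krull_dim_eq_generic_dim\<close>).  By elimination of one
  coordinate at a time, in characteristic zero the differentials of a transcendence basis of coordinates are
  a basis of the cotangent space at a general point.  So all transcendence bases have the same size, whatever
  the generators of the coordinate ring, and it follows that every function is algebraic over a
  transcendence basis (\<open>algebraic_constant_term\<close>).  Therefore the dimension drops strictly on
  proper irreducible closed subsets, and hyperplane sections lower it by at most one.  As a consequence,
  every nonempty closed bounded set has smooth points (\<open>smooth_point_exists\<close>).

  Conjugations are automorphisms that fix the identity, so they preserve \<open>L\<close>.  For \<open>B\<close> in
  \<open>L\<close> and \<open>g\<close> in a bounded set, the vectors \<open>Ad g B\<close> span a finite
  dimensional subspace of \<open>L\<close>.  It contains all derivatives of the map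
  \<open>g \<mapsto> Ad g B\<close> at the identity, and these are the brackets \<open>[A, B]\<close>; so
  \<open>L\<close> is an ideal (\<open>Lie_ideal_L\<close>).  An algebraic subgroup is closed and has a smooth
  point, hence is smooth at the identity by homogeneity (\<open>algebraic_subgroup_smooth\<close>).  The irreducible
  pieces through the identity of a bounded set are connected, so every set that contributes to \<open>L\<close>
  can be replaced by a part of it in the identity component (\<open>smooth_part_in_identity_component\<close>).

  If \<open>L\<close> has finite dimension, this bounds the dimension of irreducible bounded sets, because they
  have smooth points and can be translated.  An irreducible closed bounded set through the identity of maximal
  dimension absorbs products with all others, and so it is an open and closed subgroup, the identity component
  (\<open>algebraic_if_finite_dimensional\<close>).  Conversely, near the identity every bounded set lies in the
  identity component; if the latter is algebraic, then its tangent space contains \<open>Lie G V\<close>, and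
  it is contained in \<open>L\<close> and finite dimensional.\<close>

section \<open>Polynomial functions in a set of coordinates\<close>

inductive_set polys_on :: "nat set \<Rightarrow> ((nat \<Rightarrow> 'k::comm_ring_1) \<Rightarrow> 'k) set" for J :: "nat set" where
  const: "(\<lambda>v. c) \<in> polys_on J"
| coord: "i \<in> J \<Longrightarrow> (\<lambda>v. v i) \<in> polys_on J"
| add: "p \<in> polys_on J \<Longrightarrow> q \<in> polys_on J \<Longrightarrow> (\<lambda>v. p v + q v) \<in> polys_on J"
| mult: "p \<in> polys_on J \<Longrightarrow> q \<in> polys_on J \<Longrightarrow> (\<lambda>v. p v * q v) \<in> polys_on J"

lemma poly_fun_eq_polys_on: "poly_fun n = polys_on {..<n}"
proof (intro equalityI subsetI)
  fix p :: "(nat \<Rightarrow> 'a) \<Rightarrow> 'a" assume "p \<in> poly_fun n" then show "p \<in> polys_on {..<n}"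
    by induction (auto intro: polys_on.intros)
next
  fix p :: "(nat \<Rightarrow> 'a) \<Rightarrow> 'a" assume "p \<in> polys_on {..<n}" then show "p \<in> poly_fun n"
    by induction (auto intro: poly_fun.intros)
qed

lemma polys_on_mono: "f \<in> polys_on I \<Longrightarrow> I \<subseteq> J \<Longrightarrow> f \<in> polys_on J"
  by (induction rule: polys_on.induct) (auto intro: polys_on.intros)

lemma polys_on_add: "f \<in> polys_on J \<Longrightarrow> g \<in> polys_on J \<Longrightarrow> f + g \<in> polys_on J"
  unfolding plus_fun_def by (rule polys_on.add)

lemma polys_on_mult: "f \<in> polys_on J \<Longrightarrow> g \<in> polys_on J \<Longrightarrow> f * g \<in> polys_on J"
  unfolding times_fun_def by (rule polys_on.mult)

lemma polys_on_0: "0 \<in> polys_on J" and polys_on_1: "1 \<in> polys_on J"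
  unfolding zero_fun_def one_fun_def by (rule polys_on.const)+

lemma polys_on_uminus: "f \<in> polys_on J \<Longrightarrow> - f \<in> polys_on J"
proof -
  assume "f \<in> polys_on J"
  then have "(\<lambda>v. - 1) * f \<in> polys_on J" by (intro polys_on_mult polys_on.const)
  moreover have "(\<lambda>v. - 1) * f = - f" by (auto simp: fun_eq_iff)
  ultimately show ?thesis by simp
qed

lemma polys_on_diff: "f \<in> polys_on J \<Longrightarrow> g \<in> polys_on J \<Longrightarrow> f - g \<in> polys_on J"
  using polys_on_add[of f J "- g"] polys_on_uminus[of g J] by simp

lemma polys_on_sum: "(\<And>i. i \<in> A \<Longrightarrow> f i \<in> polys_on J) \<Longrightarrow> sum f A \<in> polys_on J"
  by (induction A rule: infinite_finite_induct) (auto intro: polys_on_add polys_on_0)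

lemma polys_on_prod: "(\<And>i. i \<in> A \<Longrightarrow> f i \<in> polys_on J) \<Longrightarrow> prod f A \<in> polys_on J"
  by (induction A rule: infinite_finite_induct) (auto intro: polys_on_mult polys_on_1)

lemma polys_on_cong: "f \<in> polys_on J \<Longrightarrow> (\<And>i. i \<in> J \<Longrightarrow> z i = w i) \<Longrightarrow> f z = f w"
  by (induction rule: polys_on.induct) auto

text \<open>Functions form a commutative ring, so polynomials in one variable with coefficients in
  \<^term>\<open>polys_on J\<close> are ordinary polynomials over this ring.\<close>

definition polys_over :: "nat set \<Rightarrow> ((nat \<Rightarrow> 'k::comm_ring_1) \<Rightarrow> 'k) poly set" where
  "polys_over J = {P. \<forall>i. coeff P i \<in> polys_on J}"

abbreviation (input) coord :: "nat \<Rightarrow> (nat \<Rightarrow> 'k) \<Rightarrow> 'k" where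
  "coord j \<equiv> (\<lambda>z. z j)"

lemma polys_over_coeff: "P \<in> polys_over J \<Longrightarrow> coeff P i \<in> polys_on J"
  by (simp add: polys_over_def)

lemma polys_over_pCons: "pCons a P \<in> polys_over J \<longleftrightarrow> a \<in> polys_on J \<and> P \<in> polys_over J"
proof
  assume h: "pCons a P \<in> polys_over J"
  have "coeff (pCons a P) 0 \<in> polys_on J" "coeff (pCons a P) (Suc i) \<in> polys_on J" for i
    using h unfolding polys_over_def by blast+
  then show "a \<in> polys_on J \<and> P \<in> polys_over J"
    by (simp add: polys_over_def)
qed (auto simp: polys_over_def coeff_pCons split: nat.splits)

lemma polys_over_add: "P \<in> polys_over J \<Longrightarrow> Q \<in> polys_over J \<Longrightarrow> P + Q \<in> polys_over J"
  by (auto simp: polys_over_def polys_on_add)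

lemma polys_over_diff: "P \<in> polys_over J \<Longrightarrow> Q \<in> polys_over J \<Longrightarrow> P - Q \<in> polys_over J"
  by (auto simp: polys_over_def polys_on_diff)

lemma polys_over_mult: "P \<in> polys_over J \<Longrightarrow> Q \<in> polys_over J \<Longrightarrow> P * Q \<in> polys_over J"
  by (auto simp: polys_over_def coeff_mult intro!: polys_on_sum polys_on_mult)

lemma polys_over_0: "0 \<in> polys_over J"
  by (auto simp: polys_over_def polys_on_0)

lemma polys_over_monom: "a \<in> polys_on J \<Longrightarrow> monom a n \<in> polys_over J"
  by (auto simp: polys_over_def polys_on_0)

lemma polys_over_mono: "P \<in> polys_over I \<Longrightarrow> I \<subseteq> J \<Longrightarrow> P \<in> polys_over J"
  by (auto simp: polys_over_def intro: polys_on_mono)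

text \<open>A derivative for coefficient rings with zero divisors, such as rings of functions.\<close>

definition formal_deriv :: "'r::comm_ring_1 poly \<Rightarrow> 'r poly" where
  "formal_deriv P = (\<Sum>i<degree P. monom (of_nat (Suc i) * coeff P (Suc i)) i)"

lemma coeff_formal_deriv: "coeff (formal_deriv P) i = of_nat (Suc i) * coeff P (Suc i)"
proof -
  have "coeff (formal_deriv P) i =
      (\<Sum>j<degree P. if j = i then of_nat (Suc j) * coeff P (Suc j) else 0)"
    by (simp add: formal_deriv_def coeff_sum)
  also have "\<dots> = (if i < degree P then of_nat (Suc i) * coeff P (Suc i) else 0)"
    by (subst sum.delta) auto
  also have "\<dots> = of_nat (Suc i) * coeff P (Suc i)"
    by (simp add: coeff_eq_0)
  finally show ?thesis .
qed

lemma formal_deriv_0: "formal_deriv 0 = 0"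
  by (rule poly_eqI) (simp add: coeff_formal_deriv)

lemma formal_deriv_pCons: "formal_deriv (pCons a P) = P + pCons 0 (formal_deriv P)"
  by (rule poly_eqI) (simp add: coeff_formal_deriv coeff_pCons algebra_simps split: nat.splits)

lemma polys_over_formal_deriv: "P \<in> polys_over J \<Longrightarrow> formal_deriv P \<in> polys_over J"
proof -
  assume P: "P \<in> polys_over J"
  have "of_nat n \<in> polys_on J" for n :: nat
    unfolding of_nat_fun by (rule polys_on.const)
  then have "of_nat (Suc i) * coeff P (Suc i) \<in> polys_on J" for i
    by (rule polys_on_mult) (rule polys_over_coeff[OF P])
  then show ?thesis
    unfolding polys_over_def by (simp only: coeff_formal_deriv mem_Collect_eq simp_thms)
qed

lemma poly_apply: "poly P x z = poly (map_poly (\<lambda>q. q z) P) (x z)"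
  for P :: "('a \<Rightarrow> 'k::comm_ring_1) poly"
  by (induction P) (simp_all add: map_poly_pCons)

lemma poly_coord_in_polys_on:
  assumes "P \<in> polys_over J" shows "poly P (coord j) \<in> polys_on (insert j J)"
  using assms
proof (induction P)
  case (pCons a P)
  then have "a \<in> polys_on (insert j J)" "P \<in> polys_over J"
    by (auto simp: polys_over_pCons intro: polys_on_mono)
  with pCons show ?case
    unfolding poly_pCons by (intro polys_on_add polys_on_mult polys_on.coord) auto
qed (simp add: polys_on_0)

lemma polys_on_expand:
  assumes "f \<in> polys_on (insert j J)"
  obtains P where "P \<in> polys_over J" "f = poly P (coord j)"
proof -
  from assms have "\<exists>P\<in>polys_over J. f = poly P (coord j)"
  proof induction
    case (const c)
    show ?case by (rule bexI[of _ "[:\<lambda>v. c:]"])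
      (auto simp: polys_over_pCons polys_over_0 polys_on.const)
  next
    case (coord i)
    show ?case
    proof (cases "i = j")
      case True
      then show ?thesis
        by (intro bexI[of _ "[:0, 1:]"])
          (auto simp: polys_over_pCons polys_over_0 polys_on_0 polys_on_1 fun_eq_iff)
    next
      case False
      then show ?thesis using coord
        by (intro bexI[of _ "[:\<lambda>v. v i:]"]) (auto simp: polys_over_pCons polys_over_0 polys_on.coord)
    qed
  next
    case (add p q)
    then obtain P Q where "P \<in> polys_over J" "Q \<in> polys_over J" "p = poly P (coord j)" "q = poly Q (coord j)"
      by blast
    then show ?case by (intro bexI[of _ "P + Q"]) (auto simp: polys_over_add)
  next
    case (mult p q)
    then obtain P Q where "P \<in> polys_over J" "Q \<in> polys_over J" "p = poly P (coord j)" "q = poly Q (coord j)"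
      by blast
    then show ?case by (intro bexI[of _ "P * Q"]) (auto simp: polys_over_mult)
  qed
  then show thesis using that by blast
qed

lemma poly_coord_upd:
  assumes "P \<in> polys_over J" "j \<notin> J"
  shows "poly P (coord j) (z(j := t)) = poly (map_poly (\<lambda>q. q z) P) t"
proof -
  have "coeff P i (z(j := t)) = coeff P i z" for i
    using assms by (intro polys_on_cong[OF polys_over_coeff[OF assms(1)]]) auto
  then have "map_poly (\<lambda>q. q (z(j := t))) P = map_poly (\<lambda>q. q z) P"
    by (intro poly_eqI) (simp add: coeff_map_poly)
  then show ?thesis by (simp add: poly_apply)
qed

text \<open>With the other coordinates fixed, this is the identity principle for polynomials in one variable
  over an infinite field.\<close>

lemma poly_coord_eq_0:
  fixes P :: "((nat \<Rightarrow> 'k::field_char_0) \<Rightarrow> 'k) poly"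
  assumes "P \<in> polys_over J" "j \<notin> J" "poly P (coord j) = 0"
  shows "P = 0"
proof (rule poly_eqI, rule ext)
  fix i and z :: "nat \<Rightarrow> 'k"
  have "\<forall>t. poly (map_poly (\<lambda>q. q z) P) t = 0"
    using poly_coord_upd[OF assms(1,2), of z] assms(3) by simp
  then have "map_poly (\<lambda>q. q z) P = 0"
    by (simp add: poly_all_0_iff_0)
  then have "coeff (map_poly (\<lambda>q. q z) P) i = 0" by simp
  then show "coeff P i z = coeff 0 i z" by (simp add: coeff_map_poly)
qed

text \<open>By induction on the coordinates: the leading coefficients with respect to one coordinate
  multiply.\<close>

lemma polys_on_domain:
  fixes f g :: "(nat \<Rightarrow> 'k::field_char_0) \<Rightarrow> 'k"
  assumes "finite J" "f \<in> polys_on J" "g \<in> polys_on J" "f * g = 0"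
  shows "f = 0 \<or> g = 0"
  using assms
proof (induction J arbitrary: f g rule: finite_induct)
  case empty
  have "f z = f w" "g z = g w" for z w
    using polys_on_cong[OF empty(1)] polys_on_cong[OF empty(2)] by auto
  moreover have "f z * g z = 0" for z using fun_cong[OF empty(3), of z] by simp
  ultimately show ?case by (metis ext mult_eq_0_iff zero_fun_apply)
next
  case (insert j J)
  obtain P where P: "P \<in> polys_over J" "f = poly P (coord j)" using polys_on_expand[OF insert(4)] .
  obtain Q where Q: "Q \<in> polys_over J" "g = poly Q (coord j)" using polys_on_expand[OF insert(5)] .
  have "poly (P * Q) (coord j) = 0"
    using insert.prems(3) unfolding P(2) Q(2) poly_mult .
  then have "P * Q = 0" using P Q insert.hyps(2) by (intro poly_coord_eq_0[OF polys_over_mult])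
  then have "lead_coeff P * lead_coeff Q = 0"
    using coeff_mult_degree_sum[of P Q] by simp
  then have "lead_coeff P = 0 \<or> lead_coeff Q = 0"
    by (intro insert.IH polys_over_coeff P(1) Q(1))
  then have "P = 0 \<or> Q = 0" by (simp only: leading_coeff_0_iff)
  then show ?case unfolding P(2) Q(2) by (auto simp only: poly_0)
qed

lemma polys_on_prod_nonzero:
  fixes f :: "'b \<Rightarrow> (nat \<Rightarrow> 'k::field_char_0) \<Rightarrow> 'k"
  assumes "finite J" "finite A" "\<And>i. i \<in> A \<Longrightarrow> f i \<in> polys_on J" "\<And>i. i \<in> A \<Longrightarrow> f i \<noteq> 0"
  shows "prod f A \<noteq> 0"
  using assms(2-4)
proof (induction A rule: finite_induct)
  case (insert x A)
  then have "f x \<in> polys_on J" "prod f A \<in> polys_on J" by (auto intro: polys_on_prod)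
  moreover have "f x \<noteq> 0" "prod f A \<noteq> 0"
    using insert.prems insert.IH by blast+
  ultimately show ?case using polys_on_domain[OF assms(1)] insert.hyps by (metis prod.insert)
qed (simp add: fun_eq_iff)

section \<open>Directional derivatives\<close>

text \<open>The restriction of a polynomial function to the line through \<open>z\<close> in
  direction \<open>v\<close> is a polynomial in the parameter, and its linear coefficient is the derivative.
  This avoids partial derivatives of formal polynomials in several variables.\<close>

definition dirderiv :: "(nat \<Rightarrow> 'k::field_char_0) \<Rightarrow> (nat \<Rightarrow> 'k) \<Rightarrow> ((nat \<Rightarrow> 'k) \<Rightarrow> 'k) \<Rightarrow> 'k" where
  "dirderiv z v f = (THE c. \<exists>p. (\<forall>s. f (\<lambda>i. z i + s * v i) = poly p s) \<and> c = coeff p 1)"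

lemma dirderiv_eqI:
  assumes "\<And>s. f (\<lambda>i. z i + s * v i) = poly p s"
  shows "dirderiv z v f = coeff p 1"
  unfolding dirderiv_def
proof (rule the_equality)
  show "\<exists>p'. (\<forall>s. f (\<lambda>i. z i + s * v i) = poly p' s) \<and> coeff p 1 = coeff p' 1"
    using assms by blast
next
  fix c assume "\<exists>p'. (\<forall>s. f (\<lambda>i. z i + s * v i) = poly p' s) \<and> c = coeff p' 1"
  then obtain p' where p': "\<forall>s. f (\<lambda>i. z i + s * v i) = poly p' s" "c = coeff p' 1" by blast
  then have "poly p = poly p'" using assms by (auto simp: fun_eq_iff)
  then show "c = coeff p 1" using p' by (simp add: poly_eq_poly_eq_iff)
qed

lemma polys_on_line:
  fixes f :: "(nat \<Rightarrow> 'k::field_char_0) \<Rightarrow> 'k"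
  assumes "f \<in> polys_on J"
  obtains p where "\<And>s. f (\<lambda>i. z i + s * v i) = poly p s" "coeff p 0 = f z"
proof -
  from assms have "\<exists>p. \<forall>s. f (\<lambda>i. z i + s * v i) = poly p s"
  proof induction
    case (const c)
    show ?case by (rule exI[of _ "[:c:]"]) simp
  next
    case (coord i)
    show ?case by (rule exI[of _ "[:z i, v i:]"]) simp
  next
    case (add p q)
    then show ?case by (metis poly_add)
  next
    case (mult p q)
    then show ?case by (metis poly_mult)
  qed
  then obtain p where p: "\<And>s. f (\<lambda>i. z i + s * v i) = poly p s" by blast
  have "coeff p 0 = f z" using p[of 0] by (simp add: poly_0_coeff_0)
  with p show thesis by (rule that)
qed

lemma dirderiv_const: "dirderiv z v (\<lambda>_. c) = 0"
  by (subst dirderiv_eqI[where p = "[:c:]"]) auto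

lemma dirderiv_0: "dirderiv z v 0 = 0"
  unfolding zero_fun_def by (rule dirderiv_const)

lemma dirderiv_coord: "dirderiv z v (coord i) = v i"
  by (subst dirderiv_eqI[where p = "[:z i, v i:]"]) auto

lemma dirderiv_add:
  assumes "f \<in> polys_on J" "g \<in> polys_on J'"
  shows "dirderiv z v (f + g) = dirderiv z v f + dirderiv z v g"
proof -
  obtain p where p: "\<And>s. f (\<lambda>i. z i + s * v i) = poly p s" using polys_on_line[OF assms(1)] by metis
  obtain q where q: "\<And>s. g (\<lambda>i. z i + s * v i) = poly q s" using polys_on_line[OF assms(2)] by metis
  have "dirderiv z v (f + g) = coeff (p + q) 1" by (rule dirderiv_eqI) (simp add: p q)
  then show ?thesis using dirderiv_eqI[OF p] dirderiv_eqI[OF q] by simp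
qed

lemma dirderiv_mult:
  assumes "f \<in> polys_on J" "g \<in> polys_on J'"
  shows "dirderiv z v (f * g) = f z * dirderiv z v g + g z * dirderiv z v f"
proof -
  obtain p where p: "\<And>s. f (\<lambda>i. z i + s * v i) = poly p s" "coeff p 0 = f z"
    using polys_on_line[OF assms(1)] by metis
  obtain q where q: "\<And>s. g (\<lambda>i. z i + s * v i) = poly q s" "coeff q 0 = g z"
    using polys_on_line[OF assms(2)] by metis
  have "dirderiv z v (f * g) = coeff (p * q) 1" by (rule dirderiv_eqI) (simp add: p q)
  also have "\<dots> = coeff p 0 * coeff q 1 + coeff p 1 * coeff q 0"
    by (simp add: coeff_mult)
  finally show ?thesis using dirderiv_eqI[OF p(1)] dirderiv_eqI[OF q(1)] p q by simp
qed

lemma dirderiv_diff: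
  assumes "f \<in> polys_on J" "g \<in> polys_on J'"
  shows "dirderiv z v (f - g) = dirderiv z v f - dirderiv z v g"
proof -
  have "f - g \<in> polys_on (J \<union> J')"
    using assms by (intro polys_on_diff) (auto intro: polys_on_mono)
  from dirderiv_add[OF this assms(2), of z v] show ?thesis by simp
qed

lemma dirderiv_cong:
  assumes "f \<in> polys_on J" "\<And>i. i \<in> J \<Longrightarrow> z i = z' i" "\<And>i. i \<in> J \<Longrightarrow> v i = v' i"
  shows "dirderiv z v f = dirderiv z' v' f"
proof -
  obtain p where p: "\<And>s. f (\<lambda>i. z i + s * v i) = poly p s" using polys_on_line[OF assms(1)] by metis
  have "f (\<lambda>i. z' i + s * v' i) = poly p s" for s
    using polys_on_cong[OF assms(1), of "\<lambda>i. z' i + s * v' i" "\<lambda>i. z i + s * v i"] assms(2,3) p by simp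
  from dirderiv_eqI[OF this] dirderiv_eqI[OF p] show ?thesis by simp
qed

text \<open>The chain rule, split into the contribution of the coefficients and that of the distinguished
  coordinate.\<close>

lemma dirderiv_poly_coord:
  fixes P :: "((nat \<Rightarrow> 'k::field_char_0) \<Rightarrow> 'k) poly"
  assumes "P \<in> polys_over J"
  shows "dirderiv z v (poly P (coord j)) =
    poly (map_poly (dirderiv z v) P) (z j) + v j * poly (formal_deriv P) (coord j) z"
  using assms
proof (induction P)
  case (pCons a P)
  then have a: "a \<in> polys_on J" and P: "P \<in> polys_over J" by (auto simp: polys_over_pCons)
  have "dirderiv z v (poly (pCons a P) (coord j)) = dirderiv z v a + dirderiv z v (coord j * poly P (coord j))"
    using a by (simp, intro dirderiv_add[where J' = "insert j J"] polys_on_mult polys_on.coord poly_coord_in_polys_on[OF P]) auto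
  also have "dirderiv z v (coord j * poly P (coord j)) =
      z j * dirderiv z v (poly P (coord j)) + poly P (coord j) z * v j"
    by (subst dirderiv_mult[OF polys_on.coord[of j "{j}"] poly_coord_in_polys_on[OF P]])
      (auto simp: dirderiv_coord)
  finally show ?case
    using pCons.IH[OF P] by (simp add: map_poly_pCons dirderiv_0 formal_deriv_pCons formal_deriv_0 algebra_simps)
qed (simp add: dirderiv_0 formal_deriv_0)

section \<open>Elimination of one variable\<close>

definition vanishes_on :: "'a set \<Rightarrow> ('a \<Rightarrow> 'k::zero) \<Rightarrow> bool" where
  "vanishes_on X f \<longleftrightarrow> (\<forall>x\<in>X. f x = 0)"

lemma vanishes_on_subset: "vanishes_on X f \<Longrightarrow> Y \<subseteq> X \<Longrightarrow> vanishes_on Y f"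
  by (auto simp: vanishes_on_def)

text \<open>The relations \<open>P\<close> satisfied by one further coordinate, as polynomials over the
  functions in the coordinates \<open>J\<close>.  Coefficients only matter up to functions that vanish on
  the set \<open>Z\<close>.\<close>

definition relation_ideal ::
  "nat set \<Rightarrow> (nat \<Rightarrow> 'k) set \<Rightarrow> ((nat \<Rightarrow> 'k::comm_ring_1) \<Rightarrow> 'k) poly set \<Rightarrow> bool" where
  "relation_ideal J Z K \<longleftrightarrow> K \<subseteq> polys_over J \<and>
     (\<forall>P\<in>K. \<forall>Q\<in>K. P - Q \<in> K) \<and>
     (\<forall>P\<in>K. \<forall>M\<in>polys_over J. M * P \<in> K) \<and>
     (\<forall>P\<in>polys_over J. (\<forall>i. vanishes_on Z (coeff P i)) \<longrightarrow> P \<in> K)"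

text \<open>A leading term whose coefficient vanishes on \<open>Z\<close> is itself a relation, so it can be
  subtracted.\<close>

lemma relation_ideal_strip:
  assumes K: "relation_ideal J Z K" and "Q \<in> K" "\<not> (\<forall>i. vanishes_on Z (coeff Q i))"
  obtains P where "P \<in> K" "degree P \<le> degree Q" "\<not> vanishes_on Z (lead_coeff P)"
proof -
  have "\<exists>P\<in>K. degree P \<le> degree Q \<and> \<not> vanishes_on Z (lead_coeff P)"
    using assms(2,3)
  proof (induction "degree Q" arbitrary: Q rule: less_induct)
    case less
    show ?case
    proof (cases "vanishes_on Z (lead_coeff Q)")
      case True
      define N where "N = monom (lead_coeff Q) (degree Q)"
      have Q: "Q \<in> polys_over J" using K less.prems unfolding relation_ideal_def by blast
      have van: "vanishes_on Z (coeff N i)" for i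
        using True by (auto simp: N_def vanishes_on_def)
      have "N \<in> polys_over J"
        unfolding N_def by (rule polys_over_monom[OF polys_over_coeff[OF Q]])
      then have "N \<in> K" using K van unfolding relation_ideal_def by blast
      then have QN: "Q - N \<in> K" using K less.prems unfolding relation_ideal_def by blast
      have nonvan: "\<not> (\<forall>i. vanishes_on Z (coeff (Q - N) i))"
        using less.prems van by (auto simp: vanishes_on_def)
      have "degree Q \<noteq> 0"
      proof
        assume "degree Q = 0"
        then have "Q - N = 0" by (intro poly_eqI) (auto simp: N_def coeff_eq_0)
        then show False using nonvan by (simp add: vanishes_on_def)
      qed
      moreover have "degree (Q - N) \<le> degree Q - 1"
        by (rule degree_le) (auto simp: N_def coeff_eq_0)
      ultimately have "degree (Q - N) < degree Q" by linarith
      from less.hyps[OF this QN nonvan] obtain P where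
        "P \<in> K" "degree P \<le> degree (Q - N)" "\<not> vanishes_on Z (lead_coeff P)" by blast
      then show ?thesis using \<open>degree (Q - N) < degree Q\<close> by (intro bexI[of _ P]) auto
    qed (use less in blast)
  qed
  then show thesis using that by blast
qed

lemma relation_ideal_min_degree:
  assumes K: "relation_ideal J Z K" and "Q \<in> K" "\<not> (\<forall>i. vanishes_on Z (coeff Q i))"
  obtains P where "P \<in> K" "\<not> vanishes_on Z (lead_coeff P)"
    "\<And>Q i. Q \<in> K \<Longrightarrow> degree Q < degree P \<Longrightarrow> vanishes_on Z (coeff Q i)"
proof -
  let ?A = "\<lambda>P. P \<in> K \<and> \<not> vanishes_on Z (lead_coeff P)"
  obtain P0 where "?A P0" using relation_ideal_strip[OF assms] by blast
  then obtain P where P: "?A P" "\<And>P'. ?A P' \<Longrightarrow> degree P \<le> degree P'"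
    using ex_has_least_nat[of ?A P0 degree] by blast
  have "vanishes_on Z (coeff Q i)" if Q: "Q \<in> K" "degree Q < degree P" for Q i
  proof (rule ccontr)
    assume "\<not> vanishes_on Z (coeff Q i)"
    then obtain P' where "P' \<in> K" "degree P' \<le> degree Q" "\<not> vanishes_on Z (lead_coeff P')"
      using relation_ideal_strip[OF K Q(1)] by blast
    then show False using P(2)[of P'] Q(2) by linarith
  qed
  with P show thesis using that by blast
qed

text \<open>Division with remainder by a relation of minimal degree, in the form of an induction rule:
  a property of relations that is inherited from \<open>u Q - M P\<close> by \<open>Q\<close>, where
  \<open>u\<close> is the leading coefficient of \<open>P\<close>, holds as soon as it holds for the remainders,
  whose coefficients vanish on \<open>Z\<close> by minimality.\<close>

lemma pseudo_division_induct:
  assumes K: "relation_ideal J Z K" and P: "P \<in> K"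
    and min: "\<And>Q i. Q \<in> K \<Longrightarrow> degree Q < degree P \<Longrightarrow> vanishes_on Z (coeff Q i)"
    and remainder: "\<And>Q. Q \<in> K \<Longrightarrow> (\<And>i. vanishes_on Z (coeff Q i)) \<Longrightarrow> G Q"
    and step: "\<And>Q M. Q \<in> K \<Longrightarrow> M \<in> polys_over J \<Longrightarrow> G (smult (lead_coeff P) Q - M * P) \<Longrightarrow> G Q"
    and Q: "Q \<in> K"
  shows "G Q"
  using Q
proof (induction "degree Q" arbitrary: Q rule: less_induct)
  case less
  show ?case
  proof (cases "degree Q < degree P")
    case True
    then show ?thesis using remainder[OF less.prems] min[OF less.prems] by blast
  next
    case False
    define M where "M = monom (lead_coeff Q) (degree Q - degree P)"
    define Q' where "Q' = smult (lead_coeff P) Q - M * P"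
    have Pc: "P \<in> polys_over J" and Qc: "Q \<in> polys_over J"
      using K P less.prems unfolding relation_ideal_def by blast+
    have M: "M \<in> polys_over J"
      unfolding M_def by (rule polys_over_monom[OF polys_over_coeff[OF Qc]])
    have "[:lead_coeff P:] * Q \<in> K"
      using K less.prems polys_over_coeff[OF Pc] unfolding relation_ideal_def
      by (simp add: polys_over_pCons polys_over_0 del: mult_pCons_left)
    moreover have "M * P \<in> K" using K P M unfolding relation_ideal_def by blast
    ultimately have "[:lead_coeff P:] * Q - M * P \<in> K"
      using K unfolding relation_ideal_def by blast
    then have Q': "Q' \<in> K" by (simp add: Q'_def)
    have coeff0: "coeff Q' i = 0" if "i \<ge> degree Q" for i
    proof (cases "i = degree Q")
      case True
      have "coeff (M * P) i = coeff M (degree Q - degree P) * coeff P (i - (degree Q - degree P))"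
        using False True by (simp add: M_def coeff_monom_mult)
      then show ?thesis using False True by (simp add: Q'_def M_def mult.commute)
    next
      case False': False
      then have "coeff (M * P) i = 0"
        using that False by (simp add: M_def coeff_monom_mult coeff_eq_0)
      then show ?thesis using that False' by (simp add: Q'_def coeff_eq_0)
    qed
    have "G Q'"
    proof (cases "degree Q = 0")
      case True
      then have "Q' = 0" using coeff0 by (intro poly_eqI) simp
      then show ?thesis using remainder[OF Q'] by (simp add: vanishes_on_def)
    next
      case False
      have "degree Q' \<le> degree Q - 1"
        by (rule degree_le) (use coeff0 in auto)
      then have "degree Q' < degree Q" using False by linarith
      then show ?thesis using less.hyps Q' by blast
    qed
    then show ?thesis using step[OF less.prems M] by (simp add: Q'_def)
  qed
qed

section \<open>Zero sets of polynomial functions are Noetherian\<close>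

definition zero_set :: "('a \<Rightarrow> 'k::zero) set \<Rightarrow> 'a set" where
  "zero_set F = {z. \<forall>f\<in>F. f z = 0}"

definition stabilizes :: "(nat \<Rightarrow> 'b) \<Rightarrow> bool" where
  "stabilizes C \<longleftrightarrow> (\<exists>N. \<forall>i\<ge>N. C i = C N)"

lemma decseq_stabilizes_wf:
  assumes "\<And>C. (\<And>i. \<A> (C i)) \<Longrightarrow> (\<And>i. C (Suc i) \<subseteq> C i) \<Longrightarrow> stabilizes C"
  shows "wf {(C, D). \<A> C \<and> \<A> D \<and> C \<subset> D}"
  unfolding wf_iff_no_infinite_down_chain
proof
  assume "\<exists>C. \<forall>i. (C (Suc i), C i) \<in> {(C, D). \<A> C \<and> \<A> D \<and> C \<subset> D}"
  then obtain C where "\<forall>i. (C (Suc i), C i) \<in> {(C, D). \<A> C \<and> \<A> D \<and> C \<subset> D}" ..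
  then have C: "\<A> (C i)" "C (Suc i) \<subset> C i" for i by simp_all
  then have "stabilizes C" by (intro assms) auto
  then obtain N where N: "\<And>i. i \<ge> N \<Longrightarrow> C i = C N" unfolding stabilizes_def by blast
  have "C (Suc N) = C N" by (rule N) simp
  then show False using C(2)[of N] by simp
qed

text \<open>A geometric form of the Hilbert basis theorem.  Over the locus where the leading
  coefficient of a relation of minimal degree does not vanish, the members of the chain are cut out
  by this relation alone, and the rest lies over a smaller closed set.\<close>

lemma zero_sets_stabilize:
  fixes C :: "nat \<Rightarrow> (nat \<Rightarrow> 'k::field_char_0) set"
  assumes "finite J" "\<And>i. \<exists>F\<subseteq>polys_on J. C i = zero_set F" "\<And>i. C (Suc i) \<subseteq> C i"
  shows "stabilizes C"
  using assms
proof (induction J arbitrary: C rule: finite_induct)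
  case empty
  have "C i = {} \<or> C i = UNIV" for i
  proof -
    obtain F where F: "F \<subseteq> polys_on {}" "C i = zero_set F" using empty(1) by blast
    have "f z = f w" if "f \<in> F" for f z w using polys_on_cong[of f "{}"] F that by blast
    then have "z \<in> C i" if "w \<in> C i" for z w
      using that unfolding F(2) zero_set_def by (simp, metis)
    then show ?thesis by blast
  qed
  then consider N where "C N = {}" | "\<forall>i. C i = UNIV" by blast
  then show ?case
  proof cases
    case 1
    have "C i \<subseteq> C N" if "i \<ge> N" for i using lift_Suc_antimono_le[of C, OF empty(2) that] .
    then show ?thesis using 1 unfolding stabilizes_def by (intro exI[of _ N]) blast
  qed (auto simp: stabilizes_def)
next
  case (insert j J)
  let ?A = "\<lambda>Z::(nat \<Rightarrow> 'k) set. \<exists>F\<subseteq>polys_on J. Z = zero_set F"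
  have wf: "wf {(C, D). ?A C \<and> ?A D \<and> C \<subset> D}"
  proof (rule decseq_stabilizes_wf)
    fix C :: "nat \<Rightarrow> (nat \<Rightarrow> 'k) set"
    assume "\<And>i. ?A (C i)" "\<And>i. C (Suc i) \<subseteq> C i"
    then show "stabilizes C" by (rule insert.IH)
  qed
  have main: "stabilizes C"
    if "?A Z" "\<And>i. \<exists>F\<subseteq>polys_on (insert j J). C i = zero_set F" "\<And>i. C (Suc i) \<subseteq> C i" "\<And>i. C i \<subseteq> Z"
    for Z C
    using that
  proof (induction Z arbitrary: C rule: wf_induct_rule[OF wf])
    case (1 Z)
    have dec: "C i \<subseteq> C k" if "k \<le> i" for i k
      using lift_Suc_antimono_le[of C, OF 1(4) that] .
    define K where "K = {Q \<in> polys_over J. \<exists>i. vanishes_on (C i) (poly Q (coord j))}"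
    have diff: "P - Q \<in> K" if PQ: "P \<in> K" "Q \<in> K" for P Q
    proof -
      obtain i k where ik: "vanishes_on (C i) (poly P (coord j))" "vanishes_on (C k) (poly Q (coord j))"
        using PQ unfolding K_def by blast
      have "vanishes_on (C (max i k)) (poly (P - Q) (coord j))"
        using vanishes_on_subset[OF ik(1) dec, of "max i k"] vanishes_on_subset[OF ik(2) dec, of "max i k"]
        by (simp add: vanishes_on_def)
      then show ?thesis using PQ unfolding K_def by (auto intro: polys_over_diff)
    qed
    have times: "M * P \<in> K" if "P \<in> K" "M \<in> polys_over J" for P M
      using that unfolding K_def vanishes_on_def by (auto intro: polys_over_mult)
    have triv: "P \<in> K" if P: "P \<in> polys_over J" "\<And>i. vanishes_on Z (coeff P i)" for P
    proof -
      have "poly P (coord j) z = 0" if "z \<in> C 0" for z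
      proof -
        have "map_poly (\<lambda>q. q z) P = 0"
          using P(2) that 1(5)[of 0] by (intro poly_eqI) (auto simp: coeff_map_poly vanishes_on_def)
        then show ?thesis by (simp add: poly_apply)
      qed
      then show ?thesis using P(1) unfolding K_def vanishes_on_def by blast
    qed
    have K: "relation_ideal J Z K"
      unfolding relation_ideal_def using diff times triv by (auto simp: K_def)
    show ?case
    proof (cases "\<forall>Q\<in>K. \<forall>i. vanishes_on Z (coeff Q i)")
      case True
      have "C i = Z" for i
      proof
        obtain F where F: "F \<subseteq> polys_on (insert j J)" "C i = zero_set F" using 1(3) by blast
        show "Z \<subseteq> C i" unfolding F(2) zero_set_def
        proof clarify
          fix z f assume z: "z \<in> Z" and f: "f \<in> F"
          then obtain Q where Q: "Q \<in> polys_over J" "f = poly Q (coord j)"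
            using F(1) polys_on_expand by blast
          have "vanishes_on (C i) f" using f unfolding F(2) zero_set_def vanishes_on_def by blast
          then have "Q \<in> K" using Q unfolding K_def by blast
          then have "map_poly (\<lambda>q. q z) Q = 0"
            using True z by (intro poly_eqI) (auto simp: coeff_map_poly vanishes_on_def)
          then show "f z = 0" by (simp add: Q(2) poly_apply)
        qed
      qed (rule 1(5))
      then show ?thesis by (simp add: stabilizes_def)
    next
      case False
      then obtain P where P: "P \<in> K" "\<not> vanishes_on Z (lead_coeff P)"
        and min: "\<And>Q i. Q \<in> K \<Longrightarrow> degree Q < degree P \<Longrightarrow> vanishes_on Z (coeff Q i)"
        using relation_ideal_min_degree[OF K] by metis
      define u where "u = lead_coeff P"
      obtain i0 where i0: "vanishes_on (C i0) (poly P (coord j))" using P(1) unfolding K_def by blast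
      have uJ: "u \<in> polys_on J" using P(1) unfolding K_def u_def by (auto intro: polys_over_coeff)
      define Z' where "Z' = Z \<inter> zero_set {u}"
      obtain F where F: "F \<subseteq> polys_on J" "Z = zero_set F" using 1(2) by blast
      have Z': "Z' = zero_set (insert u F)" unfolding Z'_def F(2) zero_set_def by blast
      have AZ': "?A Z'" using F(1) uJ unfolding Z' by blast
      have "Z' \<subset> Z" using P(2) unfolding Z'_def u_def zero_set_def vanishes_on_def by auto
      then have lt: "(Z', Z) \<in> {(C, D). ?A C \<and> ?A D \<and> C \<subset> D}"
        using AZ' 1(2) by blast
      have closed: "\<exists>F\<subseteq>polys_on (insert j J). C i \<inter> Z' = zero_set F" for i
      proof -
        obtain F1 where F1: "F1 \<subseteq> polys_on (insert j J)" "C i = zero_set F1" using 1(3) by blast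
        have "C i \<inter> Z' = zero_set (F1 \<union> insert u F)" unfolding F1(2) Z' zero_set_def by blast
        moreover have "insert u F \<subseteq> polys_on (insert j J)"
          using F(1) uJ by (auto intro: polys_on_mono)
        ultimately show ?thesis using F1(1) by (intro exI[of _ "F1 \<union> insert u F"]) simp
      qed
      have "stabilizes (\<lambda>i. C i \<inter> Z')"
      proof (rule 1(1)[OF lt AZ' closed])
        show "C (Suc i) \<inter> Z' \<subseteq> C i \<inter> Z'" for i using 1(4)[of i] by blast
        show "C i \<inter> Z' \<subseteq> Z'" for i by blast
      qed
      then obtain N1 where N1: "\<And>i. i \<ge> N1 \<Longrightarrow> C i \<inter> Z' = C N1 \<inter> Z'"
        unfolding stabilizes_def by blast
      define N where "N = max N1 i0"
      have "C i = C N" if i: "i \<ge> N" for i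
      proof
        show "C N \<subseteq> C i"
        proof
          fix z assume z: "z \<in> C N"
          then have zZ: "z \<in> Z" using 1(5) by blast
          show "z \<in> C i"
          proof (cases "u z = 0")
            case True
            then have "z \<in> C N \<inter> Z'" using z zZ by (simp add: Z'_def zero_set_def)
            moreover have "C N \<inter> Z' = C i \<inter> Z'" using N1[of i] N1[of N] i by (simp add: N_def)
            ultimately show ?thesis by blast
          next
            case False
            have Pz: "poly P (coord j) z = 0"
              using i0 dec[of i0 N] z by (auto simp: vanishes_on_def N_def)
            have van: "poly Q (coord j) z = 0" if "Q \<in> K" for Q
            proof (rule pseudo_division_induct[where G = "\<lambda>Q. poly Q (coord j) z = 0"])
              fix Q assume "Q \<in> K" "\<And>i. vanishes_on Z (coeff Q i)"
              then have "map_poly (\<lambda>q. q z) Q = 0"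
                using zZ by (intro poly_eqI) (auto simp: coeff_map_poly vanishes_on_def)
              then show "poly Q (coord j) z = 0" by (simp add: poly_apply)
            next
              fix Q M assume "poly (smult (lead_coeff P) Q - M * P) (coord j) z = 0"
              then show "poly Q (coord j) z = 0" using Pz False by (simp add: u_def)
            qed (use K P(1) min that in blast)+
            obtain F1 where F1: "F1 \<subseteq> polys_on (insert j J)" "C i = zero_set F1" using 1(3) by blast
            show ?thesis unfolding F1(2) zero_set_def
            proof clarify
              fix f assume f: "f \<in> F1"
              then obtain Q where Q: "Q \<in> polys_over J" "f = poly Q (coord j)"
                using F1(1) polys_on_expand by blast
              have "vanishes_on (C i) f" using f unfolding F1(2) zero_set_def vanishes_on_def by blast
              then have "Q \<in> K" using Q unfolding K_def by blast
              then show "f z = 0" using van Q(2) by simp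
            qed
          qed
        qed
      qed (rule dec[OF i])
      then show ?thesis unfolding stabilizes_def by blast
    qed
  qed
  show ?case
  proof (rule main[where Z = UNIV and C = C])
    show "\<exists>F\<subseteq>polys_on (insert j J). C i = zero_set F" for i by (rule insert.prems(1))
    show "C (Suc i) \<subseteq> C i" for i by (rule insert.prems(2))
    have "UNIV = zero_set ({} :: ((nat \<Rightarrow> 'k) \<Rightarrow> 'k) set)" by (simp add: zero_set_def)
    then show "?A UNIV" by (intro exI[of _ "{}"]) simp
  qed (rule subset_UNIV)
qed

section \<open>Algebraic extensions of coordinates\<close>

text \<open>Here \<open>Z\<close> is a set of points, regarded only through the polynomial functions in the
  coordinates \<open>J\<close> that vanish on it.  The first set below is the closure of the
  projection of \<open>Z\<close> to these coordinates, and the second is the tangent space of this closure,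
  both as cylinders over the remaining coordinates.\<close>

definition coord_hull :: "nat set \<Rightarrow> (nat \<Rightarrow> 'k::comm_ring_1) set \<Rightarrow> (nat \<Rightarrow> 'k) set" where
  "coord_hull J Z = zero_set {f \<in> polys_on J. vanishes_on Z f}"

definition tangent_dirs ::
  "nat set \<Rightarrow> (nat \<Rightarrow> 'k::field_char_0) set \<Rightarrow> (nat \<Rightarrow> 'k) \<Rightarrow> (nat \<Rightarrow> 'k) set" where
  "tangent_dirs J Z z = {v. \<forall>f\<in>polys_on J. vanishes_on Z f \<longrightarrow> dirderiv z v f = 0}"

text \<open>Irreducibility of \<open>X\<close> in terms of the ring \<open>R\<close>: the functions vanishing on
  \<open>X\<close> form a prime ideal.\<close>

definition prime_on :: "('a \<Rightarrow> 'k::mult_zero) set \<Rightarrow> 'a set \<Rightarrow> bool" where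
  "prime_on R X \<longleftrightarrow> X \<noteq> {} \<and>
     (\<forall>f\<in>R. \<forall>g\<in>R. vanishes_on X (f * g) \<longrightarrow> vanishes_on X f \<or> vanishes_on X g)"

definition alg_independent :: "(nat \<Rightarrow> 'k::comm_ring_1) set \<Rightarrow> nat set \<Rightarrow> bool" where
  "alg_independent Z I \<longleftrightarrow> (\<forall>f\<in>polys_on I. vanishes_on Z f \<longrightarrow> f = 0)"

definition algebraic_over :: "nat set \<Rightarrow> (nat \<Rightarrow> 'k::comm_ring_1) set \<Rightarrow> nat \<Rightarrow> bool" where
  "algebraic_over I Z j \<longleftrightarrow>
     (\<exists>P\<in>polys_over I. vanishes_on Z (poly P (coord j)) \<and> \<not> (\<forall>i. vanishes_on Z (coeff P i)))"

lemma algebraic_over_mono: "algebraic_over I Z j \<Longrightarrow> I \<subseteq> J \<Longrightarrow> algebraic_over J Z j"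
  unfolding algebraic_over_def using polys_over_mono by blast

lemma prime_on_subring: "prime_on R X \<Longrightarrow> S \<subseteq> R \<Longrightarrow> prime_on S X"
  unfolding prime_on_def by blast

lemma prime_on_prod:
  assumes "prime_on R X" "\<not> vanishes_on X f" "\<not> vanishes_on X g" "f \<in> R" "g \<in> R"
  shows "\<not> vanishes_on X (f * g)"
  using assms unfolding prime_on_def by blast

lemma relations_form_ideal:
  fixes Z :: "(nat \<Rightarrow> 'k::field_char_0) set"
  shows "relation_ideal J Z {Q \<in> polys_over J. vanishes_on Z (poly Q (coord j))}" (is "relation_ideal J Z ?K")
proof -
  have "P - Q \<in> ?K" if "P \<in> ?K" "Q \<in> ?K" for P Q
    using that by (auto simp: vanishes_on_def intro: polys_over_diff)
  moreover have "M * P \<in> ?K" if "P \<in> ?K" "M \<in> polys_over J" for P M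
    using that by (auto simp: vanishes_on_def intro: polys_over_mult)
  moreover have "P \<in> ?K" if P: "P \<in> polys_over J" "\<And>i. vanishes_on Z (coeff P i)" for P
  proof -
    have "poly P (coord j) z = 0" if "z \<in> Z" for z
    proof -
      have "map_poly (\<lambda>q. q z) P = 0"
        using P(2) that by (intro poly_eqI) (auto simp: coeff_map_poly vanishes_on_def)
      then show ?thesis by (simp add: poly_apply)
    qed
    then show ?thesis using P(1) by (simp add: vanishes_on_def)
  qed
  ultimately show ?thesis unfolding relation_ideal_def by blast
qed

text \<open>One algebraic coordinate over the coordinates \<open>J\<close>.  All relations satisfied by it
  follow, up to powers of the leading coefficient \<open>u\<close>, from one relation of minimal degree; the
  derivative \<open>s\<close> of this relation does not vanish on \<open>Z\<close> since the characteristic is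
  zero.  So points and tangent vectors with coordinates in \<open>J\<close> can be extended by solving
  this one relation.\<close>

lemma algebraic_step:
  fixes Z :: "(nat \<Rightarrow> 'k::{alg_closed_field,field_char_0}) set"
  assumes j: "j \<notin> J" and alg: "algebraic_over J Z j"
  obtains u s where "u \<in> polys_on J" "s \<in> polys_on (insert j J)"
    "\<not> vanishes_on Z u" "\<not> vanishes_on Z s"
    "\<And>z. z \<in> coord_hull J Z \<Longrightarrow> u z \<noteq> 0 \<Longrightarrow> \<exists>t. z(j := t) \<in> coord_hull (insert j J) Z"
    "\<And>z v. z \<in> Z \<Longrightarrow> u z \<noteq> 0 \<Longrightarrow> s z \<noteq> 0 \<Longrightarrow> v \<in> tangent_dirs J Z z \<Longrightarrow>
       \<exists>t. v(j := t) \<in> tangent_dirs (insert j J) Z z"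
    "\<And>z v v'. z \<in> Z \<Longrightarrow> s z \<noteq> 0 \<Longrightarrow> v \<in> tangent_dirs (insert j J) Z z \<Longrightarrow>
       v' \<in> tangent_dirs (insert j J) Z z \<Longrightarrow> (\<And>i. i \<in> J \<Longrightarrow> v i = v' i) \<Longrightarrow> v j = v' j"
proof -
  define K where "K = {Q \<in> polys_over J. vanishes_on Z (poly Q (coord j))}"
  have K: "relation_ideal J Z K" unfolding K_def by (rule relations_form_ideal)
  obtain Q0 where "Q0 \<in> K" "\<not> (\<forall>i. vanishes_on Z (coeff Q0 i))"
    using alg unfolding algebraic_over_def K_def by blast
  then obtain P where P: "P \<in> K" "\<not> vanishes_on Z (lead_coeff P)"
    and min: "\<And>Q i. Q \<in> K \<Longrightarrow> degree Q < degree P \<Longrightarrow> vanishes_on Z (coeff Q i)"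
    using relation_ideal_min_degree[OF K] by metis
  define u where "u = lead_coeff P"
  define s where "s = poly (formal_deriv P) (coord j)"
  have Pc: "P \<in> polys_over J" and Pv: "vanishes_on Z (poly P (coord j))"
    using P(1) by (simp_all add: K_def)
  have u: "u \<in> polys_on J" unfolding u_def by (rule polys_over_coeff[OF Pc])
  have s: "s \<in> polys_on (insert j J)"
    unfolding s_def by (rule poly_coord_in_polys_on[OF polys_over_formal_deriv[OF Pc]])
  have deg: "degree P > 0"
  proof (rule ccontr)
    assume "\<not> degree P > 0"
    then obtain a where a: "P = [:a:]" using degree_eq_zeroE by blast
    then show False using P(2) Pv by (simp add: vanishes_on_def)
  qed
  have sv: "\<not> vanishes_on Z s"
  proof
    assume "vanishes_on Z s"
    then have "formal_deriv P \<in> K"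
      unfolding K_def s_def using polys_over_formal_deriv[OF Pc] by blast
    moreover have "degree (formal_deriv P) \<le> degree P - 1"
      by (rule degree_le) (auto simp: coeff_formal_deriv coeff_eq_0)
    ultimately have "vanishes_on Z (coeff (formal_deriv P) (degree P - 1))"
      using deg by (intro min) auto
    then have "of_nat (degree P) * u z = 0" if "z \<in> Z" for z
      using that deg by (simp add: coeff_formal_deriv vanishes_on_def u_def del: of_nat_Suc)
    then show False using P(2) deg unfolding u_def[symmetric] vanishes_on_def by auto
  qed
  have lift: "\<exists>t. z(j := t) \<in> coord_hull (insert j J) Z"
    if z: "z \<in> coord_hull J Z" and uz: "u z \<noteq> 0" for z
  proof -
    have "coeff (map_poly (\<lambda>q. q z) P) (degree P) \<noteq> 0"
      using uz by (simp add: coeff_map_poly u_def)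
    then have "degree (map_poly (\<lambda>q. q z) P) > 0"
      using deg le_degree[of "map_poly (\<lambda>q. q z) P" "degree P"] by linarith
    then obtain t where t: "poly (map_poly (\<lambda>q. q z) P) t = 0"
      using alg_closed_imp_poly_has_root by blast
    define w where "w = z(j := t)"
    have upd: "poly Q (coord j) w = poly (map_poly (\<lambda>q. q z) Q) t" if "Q \<in> polys_over J" for Q
      unfolding w_def by (rule poly_coord_upd[OF that j])
    have "u z = u w" by (rule polys_on_cong[OF u]) (use j in \<open>auto simp: w_def\<close>)
    with uz have uw: "u w \<noteq> 0" by simp
    have van: "poly Q (coord j) w = 0" if "Q \<in> K" for Q
    proof (rule pseudo_division_induct[where G = "\<lambda>Q. poly Q (coord j) w = 0"])
      fix Q assume Q: "Q \<in> K" "\<And>i. vanishes_on Z (coeff Q i)"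
      then have Qc: "Q \<in> polys_over J" by (simp add: K_def)
      have "coeff Q i z = 0" for i
        using z Q(2)[of i] polys_over_coeff[OF Qc, of i] unfolding coord_hull_def zero_set_def by blast
      then have "map_poly (\<lambda>q. q z) Q = 0"
        by (intro poly_eqI) (auto simp: coeff_map_poly)
      then show "poly Q (coord j) w = 0" by (simp add: upd[OF Qc])
    next
      fix Q M assume "poly (smult (lead_coeff P) Q - M * P) (coord j) w = 0"
      then show "poly Q (coord j) w = 0" using upd[OF Pc] t uw by (simp add: u_def)
    qed (use K P(1) min that in blast)+
    have "w \<in> coord_hull (insert j J) Z"
      unfolding coord_hull_def zero_set_def
    proof clarify
      fix f assume f: "f \<in> polys_on (insert j J)" "vanishes_on Z f"
      then obtain Q where Q: "Q \<in> polys_over J" "f = poly Q (coord j)" using polys_on_expand by blast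
      then show "f w = 0" using van[of Q] f(2) by (simp add: K_def)
    qed
    then show ?thesis unfolding w_def ..
  qed
  have ext: "\<exists>t. v(j := t) \<in> tangent_dirs (insert j J) Z z"
    if z: "z \<in> Z" and uz: "u z \<noteq> 0" and sz: "s z \<noteq> 0" and v: "v \<in> tangent_dirs J Z z" for z v
  proof -
    define t where "t = - poly (map_poly (dirderiv z v) P) (z j) / s z"
    define w where "w = v(j := t)"
    have wv: "dirderiv z w f = dirderiv z v f" if "f \<in> polys_on J" for f
      by (rule dirderiv_cong[OF that]) (use j in \<open>auto simp: w_def\<close>)
    have map_w: "map_poly (dirderiv z w) Q = map_poly (dirderiv z v) Q" if "Q \<in> polys_over J" for Q
      by (rule poly_eqI) (simp add: coeff_map_poly dirderiv_0 wv[OF polys_over_coeff[OF that]])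
    have DP: "dirderiv z w (poly P (coord j)) = 0"
      unfolding dirderiv_poly_coord[OF Pc] map_w[OF Pc] s_def[symmetric]
      using sz by (simp add: w_def t_def)
    have van: "dirderiv z w (poly Q (coord j)) = 0" if "Q \<in> K" for Q
    proof (rule pseudo_division_induct[where G = "\<lambda>Q. dirderiv z w (poly Q (coord j)) = 0"])
      fix Q assume Q: "Q \<in> K" "\<And>i. vanishes_on Z (coeff Q i)"
      then have Qc: "Q \<in> polys_over J" by (simp add: K_def)
      have "dirderiv z v (coeff Q i) = 0" for i
        using v Q(2)[of i] polys_over_coeff[OF Qc, of i] unfolding tangent_dirs_def by blast
      then have "map_poly (dirderiv z v) Q = 0"
        by (intro poly_eqI) (auto simp: coeff_map_poly dirderiv_0)
      moreover have "map_poly (\<lambda>q. q z) (formal_deriv Q) = 0"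
        using Q(2) z by (intro poly_eqI) (auto simp: coeff_map_poly coeff_formal_deriv vanishes_on_def)
      then have "poly (formal_deriv Q) (coord j) z = 0" by (simp add: poly_apply)
      ultimately show "dirderiv z w (poly Q (coord j)) = 0"
        by (simp add: dirderiv_poly_coord[OF Qc] map_w[OF Qc])
    next
      fix Q M assume Q: "Q \<in> K" and M: "M \<in> polys_over J"
        and 0: "dirderiv z w (poly (smult (lead_coeff P) Q - M * P) (coord j)) = 0"
      have Qc: "Q \<in> polys_over J" and Qz: "poly Q (coord j) z = 0"
        using Q z by (auto simp: K_def vanishes_on_def)
      have Pz: "poly P (coord j) z = 0" using Pv z by (simp add: vanishes_on_def)
      have eq: "poly (smult (lead_coeff P) Q - M * P) (coord j) =
          u * poly Q (coord j) - poly M (coord j) * poly P (coord j)"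
        by (simp only: poly_diff poly_smult poly_mult u_def)
      note in_polys = poly_coord_in_polys_on[OF Qc, of j] poly_coord_in_polys_on[OF Pc, of j]
        poly_coord_in_polys_on[OF M, of j] polys_on_mono[OF u subset_insertI, of j]
      have "dirderiv z w (u * poly Q (coord j) - poly M (coord j) * poly P (coord j)) =
          u z * dirderiv z w (poly Q (coord j)) + poly Q (coord j) z * dirderiv z w u
          - (poly M (coord j) z * dirderiv z w (poly P (coord j))
             + poly P (coord j) z * dirderiv z w (poly M (coord j)))"
        by (simp only: dirderiv_diff[OF polys_on_mult[OF in_polys(4,1)] polys_on_mult[OF in_polys(3,2)]]
            dirderiv_mult[OF in_polys(4,1)] dirderiv_mult[OF in_polys(3,2)])
      then have "u z * dirderiv z w (poly Q (coord j)) = 0"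
        using 0 eq DP Qz Pz by simp
      then show "dirderiv z w (poly Q (coord j)) = 0" using uz by simp
    qed (use K P(1) min that in blast)+
    have "w \<in> tangent_dirs (insert j J) Z z"
      unfolding tangent_dirs_def
    proof clarify
      fix f assume f: "f \<in> polys_on (insert j J)" "vanishes_on Z f"
      then obtain Q where Q: "Q \<in> polys_over J" "f = poly Q (coord j)" using polys_on_expand by blast
      then show "dirderiv z w f = 0" using van[of Q] f(2) by (simp add: K_def)
    qed
    then show ?thesis unfolding w_def ..
  qed
  have uniq: "v j = v' j"
    if sz: "s z \<noteq> 0" and v: "v \<in> tangent_dirs (insert j J) Z z" and v': "v' \<in> tangent_dirs (insert j J) Z z"
      and eq: "\<And>i. i \<in> J \<Longrightarrow> v i = v' i" for z v v'
  proof -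
    have "dirderiv z v (poly P (coord j)) = 0" "dirderiv z v' (poly P (coord j)) = 0"
      using v v' Pv poly_coord_in_polys_on[OF Pc, of j] unfolding tangent_dirs_def by blast+
    moreover have "dirderiv z v (coeff P i) = dirderiv z v' (coeff P i)" for i
      by (rule dirderiv_cong[OF polys_over_coeff[OF Pc]]) (use eq in auto)
    then have "map_poly (dirderiv z v) P = map_poly (dirderiv z v') P"
      by (intro poly_eqI) (simp add: coeff_map_poly dirderiv_0)
    ultimately have "v j * s z = v' j * s z"
      unfolding dirderiv_poly_coord[OF Pc] s_def[symmetric] by (metis add_left_cancel)
    then show ?thesis using sz by simp
  qed
  show thesis
  proof (rule that[of u s])
    show "\<not> vanishes_on Z u" using P(2) by (simp only: u_def not_False_eq_True)
  qed (rule u s sv | (rule lift ext, assumption+) | (rule uniq, assumption+))+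
qed

text \<open>The coordinates in \<open>B\<close> are adjoined one at a time.  At each step a tangent vector extends
  uniquely away from the zeros of two functions, and \<open>w\<close> is the product of all of these.\<close>

lemma algebraic_tower_tangent:
  fixes Z :: "(nat \<Rightarrow> 'k::{alg_closed_field,field_char_0}) set"
  assumes "finite B" "I \<inter> B = {}" "prime_on (polys_on (I \<union> B)) Z" "\<And>j. j \<in> B \<Longrightarrow> algebraic_over I Z j"
  shows "\<exists>w\<in>polys_on (I \<union> B). \<not> vanishes_on Z w \<and> (\<forall>z\<in>Z. w z \<noteq> 0 \<longrightarrow>
      (\<forall>v\<in>tangent_dirs I Z z. \<exists>v'\<in>tangent_dirs (I \<union> B) Z z. \<forall>i\<in>I. v' i = v i) \<and>
      (\<forall>v\<in>tangent_dirs (I \<union> B) Z z. \<forall>v'\<in>tangent_dirs (I \<union> B) Z z.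
         (\<forall>i\<in>I. v i = v' i) \<longrightarrow> (\<forall>i\<in>I \<union> B. v i = v' i)))"
  using assms
proof (induction B rule: finite_induct)
  case empty
  then have "\<not> vanishes_on Z (\<lambda>_. 1 :: 'k)" by (auto simp: prime_on_def vanishes_on_def)
  then show ?case by (intro bexI[of _ "\<lambda>_. 1"]) (auto simp: polys_on.const)
next
  case (insert j B)
  let ?J = "I \<union> B"
  have J: "I \<union> insert j B = insert j ?J" by blast
  have mono: "f \<in> polys_on (insert j ?J)" if "f \<in> polys_on ?J" for f :: "(nat \<Rightarrow> 'k) \<Rightarrow> 'k"
    using that by (rule polys_on_mono) blast
  have prime: "prime_on (polys_on (insert j ?J)) Z" using insert.prems(2) by (simp only: J)
  have "prime_on (polys_on ?J) Z"
    by (rule prime_on_subring[OF prime]) (use mono in blast)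
  moreover have "I \<inter> B = {}" using insert.prems(1) by blast
  moreover have "algebraic_over I Z i" if "i \<in> B" for i using insert.prems(3) that by blast
  ultimately have "\<exists>w\<in>polys_on ?J. \<not> vanishes_on Z w \<and> (\<forall>z\<in>Z. w z \<noteq> 0 \<longrightarrow>
      (\<forall>v\<in>tangent_dirs I Z z. \<exists>v'\<in>tangent_dirs ?J Z z. \<forall>i\<in>I. v' i = v i) \<and>
      (\<forall>v\<in>tangent_dirs ?J Z z. \<forall>v'\<in>tangent_dirs ?J Z z.
         (\<forall>i\<in>I. v i = v' i) \<longrightarrow> (\<forall>i\<in>?J. v i = v' i)))"
    by (intro insert.IH)
  then obtain w where w: "w \<in> polys_on ?J" "\<not> vanishes_on Z w"
    and all: "\<forall>z\<in>Z. w z \<noteq> 0 \<longrightarrow>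
      (\<forall>v\<in>tangent_dirs I Z z. \<exists>v'\<in>tangent_dirs ?J Z z. \<forall>i\<in>I. v' i = v i) \<and>
      (\<forall>v\<in>tangent_dirs ?J Z z. \<forall>v'\<in>tangent_dirs ?J Z z.
         (\<forall>i\<in>I. v i = v' i) \<longrightarrow> (\<forall>i\<in>?J. v i = v' i))"
    by (elim bexE conjE)
  have w_ext: "\<exists>v'\<in>tangent_dirs ?J Z z. \<forall>i\<in>I. v' i = v i"
    if "z \<in> Z" "w z \<noteq> 0" "v \<in> tangent_dirs I Z z" for z v
    using all that by blast
  have w_uniq: "\<forall>i\<in>?J. v i = v' i"
    if "z \<in> Z" "w z \<noteq> 0" "v \<in> tangent_dirs ?J Z z" "v' \<in> tangent_dirs ?J Z z" "\<forall>i\<in>I. v i = v' i" for z v v'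
    using all that by blast
  have j: "j \<notin> ?J" using insert by auto
  have "algebraic_over ?J Z j"
    by (rule algebraic_over_mono[of I]) (use insert.prems(3) in auto)
  then obtain u s where us: "u \<in> polys_on ?J" "s \<in> polys_on (insert j ?J)"
      "\<not> vanishes_on Z u" "\<not> vanishes_on Z s"
    and ext: "\<And>z v. z \<in> Z \<Longrightarrow> u z \<noteq> 0 \<Longrightarrow> s z \<noteq> 0 \<Longrightarrow> v \<in> tangent_dirs ?J Z z \<Longrightarrow>
       \<exists>t. v(j := t) \<in> tangent_dirs (insert j ?J) Z z"
    and uniq: "\<And>z v v'. z \<in> Z \<Longrightarrow> s z \<noteq> 0 \<Longrightarrow> v \<in> tangent_dirs (insert j ?J) Z z \<Longrightarrow>
       v' \<in> tangent_dirs (insert j ?J) Z z \<Longrightarrow> (\<And>i. i \<in> ?J \<Longrightarrow> v i = v' i) \<Longrightarrow> v j = v' j"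
    using algebraic_step[OF j] by metis
  have restr: "v \<in> tangent_dirs ?J Z z" if "v \<in> tangent_dirs (insert j ?J) Z z" for v z
    using that mono unfolding tangent_dirs_def by blast
  let ?w = "w * (u * s)"
  have us': "u * s \<in> polys_on (insert j ?J)" "\<not> vanishes_on Z (u * s)"
    using us mono polys_on_mult[OF mono[OF us(1)] us(2)]
      prime_on_prod[OF prime us(3,4) mono[OF us(1)] us(2)] by blast+
  have "?w \<in> polys_on (insert j ?J)" "\<not> vanishes_on Z ?w"
    using polys_on_mult[OF mono[OF w(1)] us'(1)] prime_on_prod[OF prime w(2) us'(2) mono[OF w(1)] us'(1)]
    by blast+
  moreover have "\<exists>v'\<in>tangent_dirs (insert j ?J) Z z. \<forall>i\<in>I. v' i = v i"
    if z: "z \<in> Z" "?w z \<noteq> 0" and v: "v \<in> tangent_dirs I Z z" for z v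
  proof -
    have nz: "w z \<noteq> 0" "u z \<noteq> 0" "s z \<noteq> 0" using z by auto
    obtain v' where v': "v' \<in> tangent_dirs ?J Z z" "\<forall>i\<in>I. v' i = v i"
      using w_ext[OF z(1) nz(1) v] by blast
    obtain t where "v'(j := t) \<in> tangent_dirs (insert j ?J) Z z"
      using ext[OF z(1) nz(2,3) v'(1)] by blast
    then show ?thesis using v'(2) j by (intro bexI[of _ "v'(j := t)"]) auto
  qed
  moreover have "\<forall>i\<in>insert j ?J. v i = v' i"
    if z: "z \<in> Z" "?w z \<noteq> 0" and v: "v \<in> tangent_dirs (insert j ?J) Z z"
      and v': "v' \<in> tangent_dirs (insert j ?J) Z z" and eq: "\<forall>i\<in>I. v i = v' i" for z v v'
  proof -
    have nz: "w z \<noteq> 0" "s z \<noteq> 0" using z by auto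
    have J: "\<forall>i\<in>?J. v i = v' i"
      by (rule w_uniq[OF z(1) nz(1) restr[OF v] restr[OF v'] eq])
    then have "v j = v' j" using uniq[OF z(1) nz(2) v v'] by blast
    then show ?thesis using J by blast
  qed
  ultimately show ?case unfolding J by (intro bexI[of _ ?w] conjI) blast+
qed

text \<open>Points are lifted one coordinate at a time.  The function \<open>u\<close> that must not vanish for a
  lift involves coordinates that were adjoined before; the last assumption provides a multiple of
  \<open>u\<close> in the coordinates \<open>I\<close>, and \<open>h\<close> is the product of these multiples.\<close>

lemma algebraic_tower_lift:
  fixes Z :: "(nat \<Rightarrow> 'k::{alg_closed_field,field_char_0}) set"
  assumes "finite B" "I \<inter> B = {}" "prime_on (polys_on (I \<union> B)) Z" "\<And>j. j \<in> B \<Longrightarrow> algebraic_over I Z j"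
    and "\<And>J f. I \<subseteq> J \<Longrightarrow> J \<subseteq> I \<union> B \<Longrightarrow> f \<in> polys_on J \<Longrightarrow> \<not> vanishes_on Z f \<Longrightarrow>
      \<exists>p\<in>polys_on I. \<exists>s\<in>polys_on J. \<not> vanishes_on Z p \<and> vanishes_on Z (p - f * s)"
  shows "\<exists>h\<in>polys_on I. \<not> vanishes_on Z h \<and>
    (\<forall>z\<in>coord_hull I Z. h z \<noteq> 0 \<longrightarrow> (\<exists>z'\<in>coord_hull (I \<union> B) Z. \<forall>i\<in>I. z' i = z i))"
  using assms
proof (induction B rule: finite_induct)
  case empty
  then have "\<not> vanishes_on Z (\<lambda>_. 1 :: 'k)" by (auto simp: prime_on_def vanishes_on_def)
  then show ?case by (intro bexI[of _ "\<lambda>_. 1"]) (auto simp: polys_on.const)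
next
  case (insert j B)
  let ?J = "I \<union> B"
  have J: "I \<union> insert j B = insert j ?J" by blast
  have mono: "f \<in> polys_on (insert j ?J)" if "f \<in> polys_on ?J" for f :: "(nat \<Rightarrow> 'k) \<Rightarrow> 'k"
    using that by (rule polys_on_mono) blast
  have monoI: "f \<in> polys_on ?J" if "f \<in> polys_on I" for f :: "(nat \<Rightarrow> 'k) \<Rightarrow> 'k"
    using that by (rule polys_on_mono) blast
  have prime: "prime_on (polys_on (insert j ?J)) Z" using insert.prems(2) by (simp only: J)
  have primeJ: "prime_on (polys_on ?J) Z"
    by (rule prime_on_subring[OF prime]) (use mono in blast)
  have dep: "\<exists>p\<in>polys_on I. \<exists>s\<in>polys_on J. \<not> vanishes_on Z p \<and> vanishes_on Z (p - f * s)"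
    if "I \<subseteq> J" "J \<subseteq> ?J" "f \<in> polys_on J" "\<not> vanishes_on Z f" for f J
    by (rule insert.prems(4)) (use that in auto)
  obtain h where h: "h \<in> polys_on I" "\<not> vanishes_on Z h"
    and h_lift: "\<And>z. z \<in> coord_hull I Z \<Longrightarrow> h z \<noteq> 0 \<Longrightarrow> \<exists>z'\<in>coord_hull ?J Z. \<forall>i\<in>I. z' i = z i"
    using insert.IH[OF _ primeJ _ dep] insert.prems(1,3) by auto
  have j: "j \<notin> ?J" using insert by auto
  have "algebraic_over ?J Z j"
    by (rule algebraic_over_mono[of I]) (use insert.prems(3) in auto)
  then obtain u where u: "u \<in> polys_on ?J" "\<not> vanishes_on Z u"
    and lift: "\<And>z. z \<in> coord_hull ?J Z \<Longrightarrow> u z \<noteq> 0 \<Longrightarrow> \<exists>t. z(j := t) \<in> coord_hull (insert j ?J) Z"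
    using algebraic_step[OF j] by metis
  obtain p s where p: "p \<in> polys_on I" "\<not> vanishes_on Z p"
    and s: "s \<in> polys_on ?J" "vanishes_on Z (p - u * s)"
    using dep[OF _ _ u] by auto
  have "h * p \<in> polys_on I" "\<not> vanishes_on Z (h * p)"
    using polys_on_mult[OF h(1) p(1)] prime_on_prod[OF primeJ h(2) p(2) monoI[OF h(1)] monoI[OF p(1)]]
    by blast+
  moreover have "\<exists>z'\<in>coord_hull (insert j ?J) Z. \<forall>i\<in>I. z' i = z i"
    if z: "z \<in> coord_hull I Z" "(h * p) z \<noteq> 0" for z
  proof -
    have nz: "h z \<noteq> 0" "p z \<noteq> 0" using z(2) by auto
    obtain z' where z': "z' \<in> coord_hull ?J Z" "\<forall>i\<in>I. z' i = z i" using h_lift[OF z(1) nz(1)] by blast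
    have "p - u * s \<in> polys_on ?J" by (intro polys_on_diff polys_on_mult monoI p u s)
    then have "(p - u * s) z' = 0" using z'(1) s(2) unfolding coord_hull_def zero_set_def by blast
    moreover have "p z' = p z" by (rule polys_on_cong[OF p(1)]) (use z'(2) in auto)
    ultimately have "u z' \<noteq> 0" using nz(2) by auto
    then obtain t where "z'(j := t) \<in> coord_hull (insert j ?J) Z" using lift[OF z'(1)] by blast
    then show ?thesis using z'(2) j by (intro bexI[of _ "z'(j := t)"]) auto
  qed
  ultimately show ?case unfolding J by (intro bexI[of _ "h * p"] conjI ballI impI)
qed

section \<open>Point derivations\<close>

definition function_ring :: "('a \<Rightarrow> 'k::comm_ring_1) set \<Rightarrow> bool" where
  "function_ring R \<longleftrightarrow> (\<forall>c. (\<lambda>_. c) \<in> R) \<and> (\<forall>f\<in>R. \<forall>g\<in>R. f + g \<in> R \<and> f * g \<in> R)"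

lemma function_ringD:
  assumes "function_ring R"
  shows function_ring_const: "(\<lambda>_. c) \<in> R"
    and function_ring_add: "f \<in> R \<Longrightarrow> g \<in> R \<Longrightarrow> f + g \<in> R"
    and function_ring_mult: "f \<in> R \<Longrightarrow> g \<in> R \<Longrightarrow> f * g \<in> R"
  using assms unfolding function_ring_def by blast+

lemma function_ring_scale: "function_ring R \<Longrightarrow> f \<in> R \<Longrightarrow> (\<lambda>x. c * f x) \<in> R"
  using function_ring_mult[OF _ function_ring_const[of R c]] by (auto simp: times_fun_def)

lemma function_ring_diff: "function_ring R \<Longrightarrow> f \<in> R \<Longrightarrow> g \<in> R \<Longrightarrow> f - g \<in> R"
proof -
  assume R: "function_ring R" "f \<in> R" "g \<in> R"
  have "f - g = f + (\<lambda>x. (- 1) * g x)" by (auto simp: fun_eq_iff)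
  then show ?thesis using function_ring_add[OF R(1,2) function_ring_scale[OF R(1,3), of "- 1"]] by metis
qed

lemma function_ring_sum: "function_ring R \<Longrightarrow> (\<And>i. i \<in> A \<Longrightarrow> f i \<in> R) \<Longrightarrow> sum f A \<in> R"
  by (induction A rule: infinite_finite_induct)
    (auto intro: function_ring_add function_ring_const simp: zero_fun_def)

text \<open>The tangent space at \<open>x\<close> of the closure of a set \<open>X\<close>, in terms of a ring
  \<open>R\<close> of functions on the ambient space.\<close>

definition point_derivs ::
  "('a \<Rightarrow> 'k::field) set \<Rightarrow> 'a set \<Rightarrow> 'a \<Rightarrow> (('a \<Rightarrow> 'k) \<Rightarrow> 'k) set" where
  "point_derivs R X x = {A. (\<forall>f. f \<notin> R \<longrightarrow> A f = 0) \<and>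
     (\<forall>f\<in>R. \<forall>g\<in>R. A (f + g) = A f + A g) \<and>
     (\<forall>c. \<forall>f\<in>R. A (\<lambda>y. c * f y) = c * A f) \<and>
     (\<forall>f\<in>R. \<forall>g\<in>R. A (f * g) = f x * A g + g x * A f) \<and>
     (\<forall>f\<in>R. vanishes_on X f \<longrightarrow> A f = 0)}"

lemma point_derivsD:
  assumes "A \<in> point_derivs R X x"
  shows point_derivs_outside: "f \<notin> R \<Longrightarrow> A f = 0"
    and point_derivs_add: "f \<in> R \<Longrightarrow> g \<in> R \<Longrightarrow> A (f + g) = A f + A g"
    and point_derivs_scale: "f \<in> R \<Longrightarrow> A (\<lambda>y. c * f y) = c * A f"
    and point_derivs_mult: "f \<in> R \<Longrightarrow> g \<in> R \<Longrightarrow> A (f * g) = f x * A g + g x * A f"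
    and point_derivs_vanish: "f \<in> R \<Longrightarrow> vanishes_on X f \<Longrightarrow> A f = 0"
  using assms unfolding point_derivs_def by blast+

lemma point_derivs_const:
  fixes R :: "('a \<Rightarrow> 'b::field) set"
  assumes "function_ring R" "A \<in> point_derivs R X x"
  shows "A (\<lambda>_. c) = 0"
proof -
  have 1: "(\<lambda>_. 1) \<in> R" by (rule function_ring_const[OF assms(1)])
  have "((\<lambda>_. 1) * (\<lambda>_. 1)) = (\<lambda>_::'a. 1 :: 'b)" by (auto simp: fun_eq_iff)
  then have "A (\<lambda>_. 1) = A (\<lambda>_. 1) + A (\<lambda>_. 1)"
    using point_derivs_mult[OF assms(2) 1 1] by (simp only: mult_1_left)
  then have "A (\<lambda>_. 1) = 0" by (metis add_cancel_right_right)
  then show ?thesis using point_derivs_scale[OF assms(2) 1, of c] by simp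
qed

lemma point_derivs_diff:
  assumes "function_ring R" "A \<in> point_derivs R X x" "f \<in> R" "g \<in> R"
  shows "A (f - g) = A f - A g"
  using point_derivs_add[OF assms(2) function_ring_diff[OF assms(1,3,4)] assms(4)]
  by (simp add: algebra_simps)

lemma point_derivs_cong:
  assumes "function_ring R" "A \<in> point_derivs R X x" "f \<in> R" "g \<in> R" "\<And>y. y \<in> X \<Longrightarrow> f y = g y"
  shows "A f = A g"
proof -
  have "vanishes_on X (f - g)" using assms(5) by (simp add: vanishes_on_def)
  then show ?thesis
    using point_derivs_diff[OF assms(1-4)]
      point_derivs_vanish[OF assms(2) function_ring_diff[OF assms(1,3,4)]] by simp
qed

lemma point_derivs_sum:
  assumes "function_ring R" "A \<in> point_derivs R X x" "\<And>i. i \<in> S \<Longrightarrow> f i \<in> R"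
  shows "A (sum f S) = (\<Sum>i\<in>S. A (f i))"
  using assms(3)
proof (induction S rule: infinite_finite_induct)
  case (insert i S)
  then have "A (f i + sum f S) = A (f i) + A (sum f S)"
    by (intro point_derivs_add[OF assms(2)] function_ring_sum[OF assms(1)]) auto
  moreover have "A (sum f S) = (\<Sum>i\<in>S. A (f i))" using insert by blast
  ultimately show ?case by (simp only: sum.insert[OF insert.hyps])
qed (use point_derivs_const[OF assms(1,2), of 0] in \<open>simp_all add: zero_fun_def\<close>)

lemma point_derivs_mono: "X \<subseteq> Y \<Longrightarrow> point_derivs R X x \<subseteq> point_derivs R Y x"
  unfolding point_derivs_def using vanishes_on_subset by blast

text \<open>If \<open>g\<close> vanishes on \<open>Y\<close>, then \<open>f g\<close> vanishes on \<open>X\<close>, and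
  the Leibniz rule at \<open>x\<close> gives \<open>0 = f x * A g\<close>.\<close>

lemma point_derivs_local:
  assumes "f \<in> R" "f x \<noteq> 0" "vanishes_on Z f" "X \<subseteq> Y \<union> Z" "function_ring R" "Y \<subseteq> X" "x \<in> Y"
  shows "point_derivs R X x = point_derivs R Y x"
proof
  show "point_derivs R X x \<subseteq> point_derivs R Y x"
  proof
    fix A assume A: "A \<in> point_derivs R X x"
    have "A g = 0" if g: "g \<in> R" "vanishes_on Y g" for g
    proof -
      have "vanishes_on X (f * g)"
        using g(2) assms(3,4) by (auto simp: vanishes_on_def)
      then have "f x * A g + g x * A f = 0"
        using point_derivs_mult[OF A assms(1) g(1)] point_derivs_vanish[OF A]
          function_ring_mult[OF assms(5,1) g(1)] by simp
      then show ?thesis using assms(2,7) g(2) by (simp add: vanishes_on_def)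
    qed
    then show "A \<in> point_derivs R Y x" using A unfolding point_derivs_def by simp
  qed
qed (rule point_derivs_mono[OF assms(6)])

lemma subspace_point_derivs:
  fixes R :: "('a \<Rightarrow> 'k::field) set"
  assumes R: "function_ring R" shows "functional.subspace (point_derivs R X x)"
proof (rule functional.subspaceI)
  show "0 \<in> point_derivs R X x" by (simp add: point_derivs_def)
  show "A + B \<in> point_derivs R X x" if "A \<in> point_derivs R X x" "B \<in> point_derivs R X x" for A B
    using that unfolding point_derivs_def by (simp add: algebra_simps)
  show "scale_functional c A \<in> point_derivs R X x" if "A \<in> point_derivs R X x" for c A
    using that unfolding point_derivs_def scale_functional_def by (simp add: algebra_simps)
qed

lemma differential_id: "differential R id A = (\<lambda>f. if f \<in> R then A f else 0)"
  by (simp add: differential_def fun_eq_iff)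

text \<open>Derivations that kill the functions vanishing on \<open>X\<close> only see restrictions to
  \<open>X\<close>, so the ring may be replaced by any other one with the same restrictions.  This compares
  the regular functions on a closed subvariety, on a member of the filtration and on the whole
  ind-variety.\<close>

lemma point_derivs_change_ring:
  assumes R: "function_ring R" and R': "function_ring R'" and sub: "R \<subseteq> R'"
    and ext: "\<And>f. f \<in> R' \<Longrightarrow> \<exists>g\<in>R. \<forall>y\<in>X. f y = g y" and x: "x \<in> X"
  shows "bij_betw (differential R id) (point_derivs R' X x) (point_derivs R X x)"
proof (rule bij_betwI')
  fix A B assume A: "A \<in> point_derivs R' X x" and B: "B \<in> point_derivs R' X x"
  show "differential R id A = differential R id B \<longleftrightarrow> A = B"
  proof
    assume eq: "differential R id A = differential R id B"
    show "A = B"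
    proof
      fix f show "A f = B f"
      proof (cases "f \<in> R'")
        case True
        then obtain g where g: "g \<in> R" "\<forall>y\<in>X. f y = g y" using ext by blast
        have "A f = A g" "B f = B g"
          using g sub True by (auto intro!: point_derivs_cong[OF R' A] point_derivs_cong[OF R' B])
        moreover have "A g = B g"
          using fun_cong[OF eq, of g] g(1) by (simp add: differential_id)
        ultimately show ?thesis by simp
      qed (use point_derivs_outside[OF A] point_derivs_outside[OF B] in simp)
    qed
  qed simp
next
  fix A assume A: "A \<in> point_derivs R' X x"
  show "differential R id A \<in> point_derivs R X x"
    unfolding point_derivs_def differential_id
    using function_ringD[OF R] function_ring_scale[OF R] point_derivsD[OF A] sub
    by (auto simp: subset_iff)
next
  fix B assume B: "B \<in> point_derivs R X x"
  have "\<forall>f\<in>R'. \<exists>g. g \<in> R \<and> (\<forall>y\<in>X. f y = g y)" using ext by blast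
  from bchoice[OF this] obtain ch where "\<forall>f\<in>R'. ch f \<in> R \<and> (\<forall>y\<in>X. f y = ch f y)" ..
  then have ch: "ch f \<in> R" "y \<in> X \<Longrightarrow> ch f y = f y" if "f \<in> R'" for f y
    using that by auto
  have Bch: "B (ch f) = B g" if "f \<in> R'" "g \<in> R" "\<And>y. y \<in> X \<Longrightarrow> f y = g y" for f g
    using ch[OF that(1)] that by (intro point_derivs_cong[OF R B]) auto
  define A where "A f = (if f \<in> R' then B (ch f) else 0)" for f
  have AB: "differential R id A = B"
    unfolding differential_id A_def using sub Bch point_derivs_outside[OF B] by (auto simp: fun_eq_iff)
  have "A \<in> point_derivs R' X x"
    unfolding point_derivs_def
  proof (intro CollectI conjI allI ballI impI)
    fix f g assume f: "f \<in> R'" and g: "g \<in> R'"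
    have "B (ch (f + g)) = B (ch f + ch g)"
      by (rule Bch) (use f g ch function_ringD[OF R'] function_ringD[OF R] in auto)
    then show "A (f + g) = A f + A g"
      using f g function_ringD[OF R'] ch point_derivs_add[OF B] by (simp add: A_def)
    have "B (ch (f * g)) = B (ch f * ch g)"
      by (rule Bch) (use f g ch function_ringD[OF R'] function_ringD[OF R] in auto)
    then show "A (f * g) = f x * A g + g x * A f"
      using f g function_ringD[OF R'] ch point_derivs_mult[OF B] x by (simp add: A_def)
  next
    fix c f assume f: "f \<in> R'"
    have "B (ch (\<lambda>y. c * f y)) = B (\<lambda>y. c * ch f y)"
      by (rule Bch) (use f ch function_ring_scale[OF R'] function_ring_scale[OF R] in auto)
    then show "A (\<lambda>y. c * f y) = c * A f"
      using f function_ring_scale[OF R'] ch point_derivs_scale[OF B] by (simp add: A_def)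
  next
    fix f assume f: "f \<in> R'" "vanishes_on X f"
    then have "B (ch f) = 0"
      using ch by (intro point_derivs_vanish[OF B]) (auto simp: vanishes_on_def)
    then show "A f = 0" by (simp add: A_def)
  qed (simp add: A_def)
  with AB show "\<exists>A\<in>point_derivs R' X x. B = differential R id A" by blast
qed

lemma linear_differential:
  "Vector_Spaces.linear scale_functional scale_functional (differential R \<phi>)"
  by unfold_locales (auto simp: differential_def scale_functional_def fun_eq_iff algebra_simps)

lemma dim_differential:
  assumes S: "functional.subspace S" and inj: "inj_on (differential R \<phi>) S"
  shows "functional.dim (differential R \<phi> ` S) = functional.dim S"
proof -
  interpret l: Vector_Spaces.linear scale_functional scale_functional "differential R \<phi>"
    by (rule linear_differential)
  obtain B where B: "B \<subseteq> S" "functional.independent B" "S \<subseteq> functional.span B"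
    "card B = functional.dim S"
    using functional.basis_exists by blast
  have span: "functional.span B = S" using B(1,3) S functional.span_minimal by blast
  show ?thesis
  proof (rule functional.dim_unique)
    show "differential R \<phi> ` B \<subseteq> differential R \<phi> ` S" using B(1) by blast
    show "differential R \<phi> ` S \<subseteq> functional.span (differential R \<phi> ` B)"
      by (simp add: l.span_image span)
    show "functional.independent (differential R \<phi> ` B)"
      by (rule l.independent_injective_image[OF B(2)]) (simp add: span inj)
    show "card (differential R \<phi> ` B) = functional.dim S"
      using card_image[OF inj_on_subset[OF inj B(1)]] B(4) by simp
  qed
qed

section \<open>Generators of the coordinate ring and the tangent space\<close>

text \<open>The functions \<open>a i\<close> for \<open>i \<in> J\<close> generate the ring of restrictions to
  \<open>X\<close>, and so \<open>x \<mapsto> (\<lambda>i. a i x)\<close> replaces \<open>X\<close> by a set of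
  points with coordinates in \<open>J\<close>.\<close>

definition generators :: "('a \<Rightarrow> 'k::comm_ring_1) set \<Rightarrow> 'a set \<Rightarrow> (nat \<Rightarrow> 'a \<Rightarrow> 'k) \<Rightarrow> nat set \<Rightarrow> bool" where
  "generators R X a J \<longleftrightarrow> (\<forall>i\<in>J. a i \<in> R) \<and>
     (\<forall>f\<in>R. \<exists>p\<in>polys_on J. \<forall>x\<in>X. f x = p (\<lambda>i. a i x))"

lemma polys_on_comp_in_ring:
  assumes "function_ring R" "p \<in> polys_on J" "\<And>i. i \<in> J \<Longrightarrow> a i \<in> R"
  shows "(\<lambda>x. p (\<lambda>i. a i x)) \<in> R"
  using assms(2)
proof induction
  case (add p q)
  then show ?case using function_ring_add[OF assms(1)] by (auto simp: plus_fun_def)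
next
  case (mult p q)
  then show ?case using function_ring_mult[OF assms(1)] by (auto simp: times_fun_def)
qed (use assms(3) function_ring_const[OF assms(1)] in auto)

lemma point_derivs_chain:
  fixes R :: "('a \<Rightarrow> 'k::field_char_0) set"
  assumes R: "function_ring R" and a: "\<And>i. i \<in> J \<Longrightarrow> a i \<in> R" and A: "A \<in> point_derivs R X x"
    and p: "p \<in> polys_on J"
  shows "A (\<lambda>y. p (\<lambda>i. a i y)) = dirderiv (\<lambda>i. a i x) (\<lambda>i. A (a i)) p"
  using p
proof induction
  case (const c)
  then show ?case by (simp add: dirderiv_const point_derivs_const[OF R A])
next
  case (coord i)
  have "(\<lambda>y. a i y) = a i" by simp
  then show ?case by (simp only: dirderiv_coord)
next
  case (add p q)
  note pq = polys_on_comp_in_ring[OF R add(1) a] polys_on_comp_in_ring[OF R add(2) a]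
  have "A ((\<lambda>y. p (\<lambda>i. a i y)) + (\<lambda>y. q (\<lambda>i. a i y))) =
      A (\<lambda>y. p (\<lambda>i. a i y)) + A (\<lambda>y. q (\<lambda>i. a i y))"
    by (rule point_derivs_add[OF A pq])
  then show ?case
    using dirderiv_add[OF add(1,2)] add by (simp add: plus_fun_def)
next
  case (mult p q)
  note pq = polys_on_comp_in_ring[OF R mult(1) a] polys_on_comp_in_ring[OF R mult(2) a]
  have "A ((\<lambda>y. p (\<lambda>i. a i y)) * (\<lambda>y. q (\<lambda>i. a i y))) =
      p (\<lambda>i. a i x) * A (\<lambda>y. q (\<lambda>i. a i y)) + q (\<lambda>i. a i x) * A (\<lambda>y. p (\<lambda>i. a i y))"
    by (rule point_derivs_mult[OF A pq])
  then show ?case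
    using dirderiv_mult[OF mult(1,2)] mult by (simp add: times_fun_def)
qed

lemma point_derivs_tangent_dirs:
  fixes R :: "('a \<Rightarrow> 'k::field_char_0) set"
  assumes R: "function_ring R" and a: "\<And>i. i \<in> J \<Longrightarrow> a i \<in> R" and A: "A \<in> point_derivs R X x"
  shows "(\<lambda>i. A (a i)) \<in> tangent_dirs J ((\<lambda>x i. a i x) ` X) (\<lambda>i. a i x)"
  unfolding tangent_dirs_def
proof clarify
  fix f assume f: "f \<in> polys_on J" "vanishes_on ((\<lambda>x i. a i x) ` X) f"
  then have "A (\<lambda>y. f (\<lambda>i. a i y)) = 0"
    by (intro point_derivs_vanish[OF A] polys_on_comp_in_ring[OF R _ a]) (auto simp: vanishes_on_def)
  then show "dirderiv (\<lambda>i. a i x) (\<lambda>i. A (a i)) f = 0"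
    using point_derivs_chain[OF R a A f(1)] by simp
qed

lemma point_derivs_determined:
  fixes R :: "('a \<Rightarrow> 'k::field_char_0) set"
  assumes R: "function_ring R" and gen: "generators R X a J"
    and A: "A \<in> point_derivs R X x" and B: "B \<in> point_derivs R X x"
    and eq: "\<And>i. i \<in> J \<Longrightarrow> A (a i) = B (a i)"
  shows "A = B"
proof
  fix f show "A f = B f"
  proof (cases "f \<in> R")
    case True
    have a: "\<And>i. i \<in> J \<Longrightarrow> a i \<in> R" using gen unfolding generators_def by blast
    obtain p where p: "p \<in> polys_on J" "\<forall>x\<in>X. f x = p (\<lambda>i. a i x)"
      using True gen unfolding generators_def by blast
    have pR: "(\<lambda>x. p (\<lambda>i. a i x)) \<in> R" by (rule polys_on_comp_in_ring[OF R p(1) a])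
    have "A f = A (\<lambda>x. p (\<lambda>i. a i x))" "B f = B (\<lambda>x. p (\<lambda>i. a i x))"
      using p(2) by (auto intro!: point_derivs_cong[OF R A True pR] point_derivs_cong[OF R B True pR])
    moreover have "dirderiv (\<lambda>i. a i x) (\<lambda>i. A (a i)) p = dirderiv (\<lambda>i. a i x) (\<lambda>i. B (a i)) p"
      by (rule dirderiv_cong[OF p(1)]) (use eq in auto)
    ultimately show ?thesis
      using point_derivs_chain[OF R a A p(1)] point_derivs_chain[OF R a B p(1)] by simp
  qed (use point_derivs_outside[OF A] point_derivs_outside[OF B] in simp)
qed

text \<open>A tangent direction \<open>v\<close> differentiates every polynomial expression of a function in the
  generators, and tangency makes the result independent of the expression.\<close>

lemma point_derivs_exists:
  fixes R :: "('a \<Rightarrow> 'k::field_char_0) set"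
  assumes R: "function_ring R" and gen: "generators R X a J" and x: "x \<in> X"
    and v: "v \<in> tangent_dirs J ((\<lambda>x i. a i x) ` X) (\<lambda>i. a i x)"
  obtains A where "A \<in> point_derivs R X x" "\<And>i. i \<in> J \<Longrightarrow> A (a i) = v i"
proof -
  let ?\<alpha> = "\<lambda>x i. a i x"
  have "\<forall>f\<in>R. \<exists>p. p \<in> polys_on J \<and> (\<forall>x\<in>X. f x = p (?\<alpha> x))"
    using gen unfolding generators_def by blast
  from bchoice[OF this] obtain pp where "\<forall>f\<in>R. pp f \<in> polys_on J \<and> (\<forall>x\<in>X. f x = pp f (?\<alpha> x))" ..
  then have pp: "pp f \<in> polys_on J" "y \<in> X \<Longrightarrow> pp f (?\<alpha> y) = f y" if "f \<in> R" for f y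
    using that by auto
  define A where "A f = (if f \<in> R then dirderiv (?\<alpha> x) v (pp f) else 0)" for f
  have A: "A f = dirderiv (?\<alpha> x) v p"
    if f: "f \<in> R" and p: "p \<in> polys_on J" "\<And>y. y \<in> X \<Longrightarrow> f y = p (?\<alpha> y)" for f p
  proof -
    have "vanishes_on (?\<alpha> ` X) (pp f - p)" using pp[OF f] p by (auto simp: vanishes_on_def)
    then have "dirderiv (?\<alpha> x) v (pp f - p) = 0"
      using v polys_on_diff[OF pp(1)[OF f] p(1)] unfolding tangent_dirs_def by blast
    then show ?thesis using dirderiv_diff[OF pp(1)[OF f] p(1)] f by (simp add: A_def)
  qed
  have "A \<in> point_derivs R X x"
    unfolding point_derivs_def
  proof (intro CollectI conjI allI ballI impI)
    fix f g assume f: "f \<in> R" and g: "g \<in> R"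
    have "A (f + g) = dirderiv (?\<alpha> x) v (pp f + pp g)"
      by (rule A[OF function_ring_add[OF R f g] polys_on_add[OF pp(1)[OF f] pp(1)[OF g]]])
        (simp add: pp f g)
    then show "A (f + g) = A f + A g"
      using dirderiv_add[OF pp(1)[OF f] pp(1)[OF g]] f g by (simp add: A_def)
    have "A (f * g) = dirderiv (?\<alpha> x) v (pp f * pp g)"
      by (rule A[OF function_ring_mult[OF R f g] polys_on_mult[OF pp(1)[OF f] pp(1)[OF g]]])
        (simp add: pp f g)
    then show "A (f * g) = f x * A g + g x * A f"
      using dirderiv_mult[OF pp(1)[OF f] pp(1)[OF g]] f g pp x by (simp add: A_def)
  next
    fix c f assume f: "f \<in> R"
    have "A (\<lambda>y. c * f y) = dirderiv (?\<alpha> x) v ((\<lambda>_. c) * pp f)"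
      by (rule A[OF function_ring_scale[OF R f] polys_on_mult[OF polys_on.const pp(1)[OF f]]])
        (simp add: pp f)
    then show "A (\<lambda>y. c * f y) = c * A f"
      using dirderiv_mult[OF polys_on.const[of c J] pp(1)[OF f]] f by (simp add: A_def dirderiv_const)
  next
    fix f assume f: "f \<in> R" "vanishes_on X f"
    have "A f = dirderiv (?\<alpha> x) v 0"
      by (rule A[OF f(1) polys_on_0]) (use f(2) in \<open>simp add: vanishes_on_def\<close>)
    then show "A f = 0" by (simp add: dirderiv_0)
  qed (simp add: A_def)
  moreover have "A (a i) = v i" if i: "i \<in> J" for i
  proof -
    have "A (a i) = dirderiv (?\<alpha> x) v (coord i)"
      by (rule A) (use i gen in \<open>auto simp: generators_def polys_on.coord\<close>)
    then show ?thesis by (simp add: dirderiv_coord)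
  qed
  ultimately show thesis using that by blast
qed

lemma dirderiv_basis:
  assumes "finite J" "p \<in> polys_on J"
  shows "dirderiv z v p = (\<Sum>i\<in>J. v i * dirderiv z (\<lambda>k. if k = i then 1 else 0) p)"
  using assms(2)
proof induction
  case (coord i)
  have "(\<Sum>k\<in>J. v k * (if i = k then 1 else 0)) = v i"
    using coord assms(1) by (simp add: sum.delta' if_distrib cong: if_cong)
  then show ?case by (simp only: dirderiv_coord)
next
  case (add p q)
  then show ?case
    using dirderiv_add[OF add(1,2)] by (simp add: plus_fun_def sum.distrib algebra_simps)
next
  case (mult p q)
  then show ?case
    using dirderiv_mult[OF mult(1,2)]
    by (simp add: times_fun_def sum.distrib sum_distrib_left algebra_simps)
qed (simp add: dirderiv_const)

lemma finite_dimensional_subspace: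
  assumes "functional.subspace S" "S \<subseteq> functional.span E" "finite E"
  shows "finite_dimensional S"
proof -
  obtain B where B: "B \<subseteq> S" "functional.independent B" "S \<subseteq> functional.span B"
    using functional.maximal_independent_subset by blast
  have "B \<subseteq> functional.span E" using B(1) assms(2) by blast
  then have "finite B" using functional.independent_span_bound[OF assms(3) B(2)] by blast
  moreover have "functional.span B = S" using B assms(1) functional.span_minimal by blast
  ultimately show ?thesis unfolding finite_dimensional_def by blast
qed

text \<open>A derivation is a linear combination of the partial derivatives, applied to chosen polynomial
  expressions in the generators.  These are merely functionals, but they span a finite dimensional space
  that contains the derivations.\<close>

lemma finite_dimensional_point_derivs:
  fixes R :: "('a \<Rightarrow> 'k::field_char_0) set"
  assumes R: "function_ring R" and gen: "generators R X a J" and J: "finite J"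
    and S: "functional.subspace S" "S \<subseteq> point_derivs R X x"
  shows "finite_dimensional S"
proof -
  let ?\<alpha> = "\<lambda>x i. a i x"
  have "\<forall>f\<in>R. \<exists>p. p \<in> polys_on J \<and> (\<forall>x\<in>X. f x = p (?\<alpha> x))"
    using gen unfolding generators_def by blast
  from bchoice[OF this] obtain pp where "\<forall>f\<in>R. pp f \<in> polys_on J \<and> (\<forall>x\<in>X. f x = pp f (?\<alpha> x))" ..
  then have pp: "pp f \<in> polys_on J" "y \<in> X \<Longrightarrow> f y = pp f (?\<alpha> y)" if "f \<in> R" for f y
    using that by auto
  define E where "E i f = (if f \<in> R then dirderiv (?\<alpha> x) (\<lambda>k. if k = i then 1 else 0) (pp f) else 0)" for i f
  have a: "\<And>i. i \<in> J \<Longrightarrow> a i \<in> R" using gen unfolding generators_def by blast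
  have "A \<in> functional.span (E ` J)" if "A \<in> S" for A
  proof -
    have A: "A \<in> point_derivs R X x" using S(2) that by blast
    have "A = (\<Sum>i\<in>J. scale_functional (A (a i)) (E i))"
    proof
      fix f show "A f = (\<Sum>i\<in>J. scale_functional (A (a i)) (E i)) f"
      proof (cases "f \<in> R")
        case True
        have "A f = A (\<lambda>y. pp f (?\<alpha> y))"
          by (rule point_derivs_cong[OF R A True polys_on_comp_in_ring[OF R pp(1)[OF True] a]])
            (use pp(2)[OF True] in auto)
        also have "\<dots> = dirderiv (?\<alpha> x) (\<lambda>i. A (a i)) (pp f)"
          by (rule point_derivs_chain[OF R a A pp(1)[OF True]])
        also have "\<dots> = (\<Sum>i\<in>J. A (a i) * E i f)"
          by (subst dirderiv_basis[OF J pp(1)[OF True]]) (simp add: E_def True)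
        also have "\<dots> = (\<Sum>i\<in>J. scale_functional (A (a i)) (E i)) f"
          using J by (induction J rule: finite_induct) (auto simp: scale_functional_def)
        finally show ?thesis .
      next
        case False
        have "(\<Sum>i\<in>J. scale_functional (A (a i)) (E i)) f = 0"
          using J by (induction J rule: finite_induct) (auto simp: scale_functional_def E_def False)
        then show ?thesis using point_derivs_outside[OF A False] by simp
      qed
    qed
    then show ?thesis
      by (metis (mono_tags, lifting) functional.span_sum functional.span_scale functional.span_base imageI)
  qed
  then show ?thesis using finite_dimensional_subspace[OF S(1), of "E ` J"] J by blast
qed

section \<open>The dimension of an irreducible set\<close>

definition transcendence_basis :: "(nat \<Rightarrow> 'k::comm_ring_1) set \<Rightarrow> nat set \<Rightarrow> nat set \<Rightarrow> bool" where
  "transcendence_basis Z J I \<longleftrightarrow>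
     I \<subseteq> J \<and> alg_independent Z I \<and> (\<forall>j\<in>J - I. algebraic_over I Z j)"

lemma algebraic_over_dependent:
  assumes I: "alg_independent Z I" and dep: "\<not> alg_independent Z (insert j I)"
  shows "algebraic_over I Z j"
proof -
  obtain f where f: "f \<in> polys_on (insert j I)" "vanishes_on Z f" "f \<noteq> 0"
    using dep unfolding alg_independent_def by blast
  obtain P where P: "P \<in> polys_over I" "f = poly P (coord j)" using polys_on_expand[OF f(1)] .
  have "\<not> (\<forall>i. vanishes_on Z (coeff P i))"
  proof
    assume "\<forall>i. vanishes_on Z (coeff P i)"
    then have "coeff P i = 0" for i
      using I polys_over_coeff[OF P(1)] unfolding alg_independent_def by blast
    then have "P = 0" by (intro poly_eqI) (simp only: coeff_0)
    then have "f = 0" unfolding P(2) by (simp only: poly_0)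
    with f(3) show False ..
  qed
  then show ?thesis using P f(2) unfolding algebraic_over_def by blast
qed

lemma transcendence_basis_extend:
  assumes J: "finite J" and I: "I \<subseteq> J" "alg_independent Z I"
  obtains I' where "I \<subseteq> I'" "transcendence_basis Z J I'"
proof -
  let ?A = "\<lambda>I'. I \<subseteq> I' \<and> I' \<subseteq> J \<and> alg_independent Z I'"
  have fin: "card I' \<le> card J" if "?A I'" for I' using card_mono[OF J] that by blast
  have "\<exists>I'. ?A I' \<and> (\<forall>K. ?A K \<longrightarrow> card K \<le> card I')"
    by (rule ex_has_greatest_nat[of ?A I card "Suc (card J)"]) (use I fin in \<open>auto simp: less_Suc_eq_le\<close>)
  then obtain I' where I': "?A I'" "\<And>K. ?A K \<Longrightarrow> card K \<le> card I'" by blast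
  have "algebraic_over I' Z j" if j: "j \<in> J - I'" for j
  proof (rule algebraic_over_dependent)
    show "alg_independent Z I'" using I' by blast
    have "finite I'" using I'(1) J finite_subset by blast
    then have "\<not> ?A (insert j I')" using I'(2)[of "insert j I'"] j by auto
    then show "\<not> alg_independent Z (insert j I')" using I'(1) j by blast
  qed
  then show thesis using that I'(1) unfolding transcendence_basis_def by blast
qed

lemma transcendence_basis_exists:
  fixes Z :: "(nat \<Rightarrow> 'k::comm_ring_1) set"
  assumes J: "finite J" and Z: "Z \<noteq> {}"
  obtains I where "transcendence_basis Z J I"
proof -
  have "alg_independent Z {}"
    unfolding alg_independent_def
  proof (intro ballI impI)
    fix f :: "(nat \<Rightarrow> 'k) \<Rightarrow> 'k" assume f: "f \<in> polys_on {}" "vanishes_on Z f"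
    obtain w where "w \<in> Z" using Z by blast
    then have "f w = 0" using f(2) by (simp add: vanishes_on_def)
    then have "f z = 0" for z using polys_on_cong[OF f(1), of z w] by simp
    then show "f = 0" by (simp add: fun_eq_iff)
  qed
  then show thesis using transcendence_basis_extend[OF J empty_subsetI] that by metis
qed

lemma generators_subset: "generators R X a J \<Longrightarrow> Y \<subseteq> X \<Longrightarrow> generators R Y a J"
  unfolding generators_def by blast

lemma prime_on_polys:
  assumes R: "function_ring R" and gen: "generators R X a J" and X: "prime_on R X"
  shows "prime_on (polys_on J) ((\<lambda>x i. a i x) ` X)"
  unfolding prime_on_def
proof (intro conjI ballI impI)
  show "(\<lambda>x i. a i x) ` X \<noteq> {}" using X unfolding prime_on_def by blast
next
  fix f g assume f: "f \<in> polys_on J" and g: "g \<in> polys_on J"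
    and fg: "vanishes_on ((\<lambda>x i. a i x) ` X) (f * g)"
  have a: "\<And>i. i \<in> J \<Longrightarrow> a i \<in> R" using gen unfolding generators_def by blast
  have fR: "(\<lambda>x. f (\<lambda>i. a i x)) \<in> R" and gR: "(\<lambda>x. g (\<lambda>i. a i x)) \<in> R"
    by (rule polys_on_comp_in_ring[OF R _ a], rule f, assumption)
      (rule polys_on_comp_in_ring[OF R _ a], rule g, assumption)
  have "vanishes_on X ((\<lambda>x. f (\<lambda>i. a i x)) * (\<lambda>x. g (\<lambda>i. a i x)))"
    using fg by (auto simp: vanishes_on_def)
  then have "vanishes_on X (\<lambda>x. f (\<lambda>i. a i x)) \<or> vanishes_on X (\<lambda>x. g (\<lambda>i. a i x))"
    using X fR gR unfolding prime_on_def by blast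
  then show "vanishes_on ((\<lambda>x i. a i x) ` X) f \<or> vanishes_on ((\<lambda>x i. a i x) ` X) g"
    by (auto simp: vanishes_on_def)
qed

lemma sum_scale_functional_apply:
  "finite I \<Longrightarrow> (\<Sum>i\<in>I. scale_functional (c i) (D i)) f = (\<Sum>i\<in>I. c i * D i f)"
  by (induction I rule: finite_induct) (auto simp: scale_functional_def)

text \<open>Evaluation at the points \<open>e k\<close> separates the members of the family.\<close>

lemma dual_family:
  fixes D :: "'i \<Rightarrow> ('a \<Rightarrow> 'k::field) \<Rightarrow> 'k"
  assumes I: "finite I" and D: "\<And>i k. k \<in> I \<Longrightarrow> D i (e k) = (if k = i then 1 else 0)"
  shows "inj_on D I" "functional.independent (D ` I)"
proof -
  show inj: "inj_on D I"
  proof (rule inj_onI, rule ccontr)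
    fix i k assume "i \<in> I" "k \<in> I" "D i = D k" "i \<noteq> k"
    then show False using D[of i i] D[of i k] by auto
  qed
  show "functional.independent (D ` I)"
  proof
    assume "functional.dependent (D ` I)"
    then obtain S c where Sc: "finite S \<and> S \<subseteq> D ` I \<and> (\<Sum>B\<in>S. scale_functional (c B) B) = 0 \<and>
        (\<exists>A\<in>S. c A \<noteq> 0)"
      unfolding functional.dependent_explicit by (elim exE)
    then have S: "finite S" "S \<subseteq> D ` I" and 0: "(\<Sum>B\<in>S. scale_functional (c B) B) = 0" by simp_all
    from Sc obtain A where A: "A \<in> S" "c A \<noteq> 0" by blast
    then obtain k where k: "k \<in> I" "A = D k" using S(2) by blast
    have "(\<Sum>B\<in>S. c B * B (e k)) = (\<Sum>B\<in>S. if B = A then c B else 0)"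
    proof (rule sum.cong)
      fix B assume "B \<in> S"
      then obtain i where i: "i \<in> I" "B = D i" using S(2) by blast
      then have "B = A \<longleftrightarrow> i = k" using k inj by (auto simp: inj_on_def)
      then show "c B * B (e k) = (if B = A then c B else 0)" using i D[OF k(1), of i] by auto
    qed simp
    moreover have "(\<Sum>B\<in>S. c B * B (e k)) = 0"
      using sum_scale_functional_apply[OF S(1), of c "\<lambda>B. B" "e k"] unfolding 0 zero_fun_apply by (rule sym)
    ultimately show False using A S(1) by simp
  qed
qed

text \<open>At a general point the differentials of a transcendence basis form a basis of the cotangent
  space.  The derivations dual to them are obtained by extending tangent vectors along the algebraic
  coordinates.\<close>

lemma generic_dim_eq_card:
  fixes R :: "('a \<Rightarrow> 'k::{alg_closed_field,field_char_0}) set"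
  assumes R: "function_ring R" and gen: "generators R X a J" and J: "finite J"
    and X: "prime_on R X" and I: "transcendence_basis ((\<lambda>x i. a i x) ` X) J I"
  obtains w where "w \<in> R" "\<not> vanishes_on X w"
    "\<And>x. x \<in> X \<Longrightarrow> w x \<noteq> 0 \<Longrightarrow> functional.dim (point_derivs R X x) = card I"
proof -
  let ?\<alpha> = "\<lambda>x i. a i x"
  let ?Z = "?\<alpha> ` X"
  have IJ: "I \<subseteq> J" "J = I \<union> (J - I)" "finite I"
    using I J finite_subset unfolding transcendence_basis_def by blast+
  have a: "\<And>i. i \<in> J \<Longrightarrow> a i \<in> R" using gen unfolding generators_def by blast
  have "\<exists>w\<in>polys_on (I \<union> (J - I)). \<not> vanishes_on ?Z w \<and> (\<forall>z\<in>?Z. w z \<noteq> 0 \<longrightarrow>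
      (\<forall>v\<in>tangent_dirs I ?Z z. \<exists>v'\<in>tangent_dirs (I \<union> (J - I)) ?Z z. \<forall>i\<in>I. v' i = v i) \<and>
      (\<forall>v\<in>tangent_dirs (I \<union> (J - I)) ?Z z. \<forall>v'\<in>tangent_dirs (I \<union> (J - I)) ?Z z.
         (\<forall>i\<in>I. v i = v' i) \<longrightarrow> (\<forall>i\<in>I \<union> (J - I). v i = v' i)))"
  proof (rule algebraic_tower_tangent)
    show "finite (J - I)" "I \<inter> (J - I) = {}" using J by blast+
    show "prime_on (polys_on (I \<union> (J - I))) ?Z"
      using prime_on_polys[OF R gen X] by (simp only: IJ(2)[symmetric])
    show "algebraic_over I ?Z j" if "j \<in> J - I" for j
      using I that unfolding transcendence_basis_def by blast
  qed
  then obtain w where w: "w \<in> polys_on J" "\<not> vanishes_on ?Z w"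
    and all: "\<forall>z\<in>?Z. w z \<noteq> 0 \<longrightarrow>
      (\<forall>v\<in>tangent_dirs I ?Z z. \<exists>v'\<in>tangent_dirs J ?Z z. \<forall>i\<in>I. v' i = v i) \<and>
      (\<forall>v\<in>tangent_dirs J ?Z z. \<forall>v'\<in>tangent_dirs J ?Z z.
         (\<forall>i\<in>I. v i = v' i) \<longrightarrow> (\<forall>i\<in>J. v i = v' i))"
    unfolding IJ(2)[symmetric] by (elim bexE conjE)
  show thesis
  proof (rule that[of "\<lambda>x. w (?\<alpha> x)"])
    show "(\<lambda>x. w (?\<alpha> x)) \<in> R" by (rule polys_on_comp_in_ring[OF R w(1) a])
    show "\<not> vanishes_on X (\<lambda>x. w (?\<alpha> x))" using w(2) by (auto simp: vanishes_on_def)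
    fix x assume x: "x \<in> X" "w (?\<alpha> x) \<noteq> 0"
    have ex: "\<exists>v'\<in>tangent_dirs J ?Z (?\<alpha> x). \<forall>i\<in>I. v' i = v i"
      if "v \<in> tangent_dirs I ?Z (?\<alpha> x)" for v
      using all x that by blast
    have uq: "\<forall>i\<in>J. v i = v' i"
      if "v \<in> tangent_dirs J ?Z (?\<alpha> x)" "v' \<in> tangent_dirs J ?Z (?\<alpha> x)" "\<forall>i\<in>I. v i = v' i" for v v'
      using all x that by blast
    have all_dirs: "v \<in> tangent_dirs I ?Z (?\<alpha> x)" for v
    proof -
      have "dirderiv (?\<alpha> x) v f = 0" if "f \<in> polys_on I" "vanishes_on ?Z f" for f
      proof -
        have "f = 0" using I that unfolding transcendence_basis_def alg_independent_def by blast
        then show ?thesis by (simp only: dirderiv_0)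
      qed
      then show ?thesis unfolding tangent_dirs_def by blast
    qed
    have "\<forall>i. \<exists>A. A \<in> point_derivs R X x \<and> (\<forall>k\<in>I. A (a k) = (if k = i then 1 else 0))"
    proof
      fix i
      obtain v where v: "v \<in> tangent_dirs J ?Z (?\<alpha> x)" "\<forall>k\<in>I. v k = (if k = i then 1 else 0)"
        using ex[OF all_dirs, of "\<lambda>k. if k = i then 1 else 0"] by blast
      obtain A where "A \<in> point_derivs R X x" "\<And>k. k \<in> J \<Longrightarrow> A (a k) = v k"
        using point_derivs_exists[OF R gen x(1) v(1)] by blast
      then show "\<exists>A. A \<in> point_derivs R X x \<and> (\<forall>k\<in>I. A (a k) = (if k = i then 1 else 0))"
        using v(2) IJ(1) by (intro exI[of _ A]) auto
    qed
    then obtain D where D: "\<And>i. D i \<in> point_derivs R X x"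
      "\<And>i k. k \<in> I \<Longrightarrow> D i (a k) = (if k = i then 1 else 0)"
      by metis
    have D': "D i (a k) = (if k = i then 1 else 0)" if "k \<in> I" for i k using D(2)[OF that] .
    note inj = dual_family(1)[where D = D and e = a, OF IJ(3) D']
      and indep = dual_family(2)[where D = D and e = a, OF IJ(3) D']
    have sum_apply: "(\<Sum>i\<in>I. scale_functional (c i) (D i)) f = (\<Sum>i\<in>I. c i * D i f)" for c f
      by (rule sum_scale_functional_apply[OF IJ(3)])
    show "functional.dim (point_derivs R X x) = card I"
    proof (rule functional.dim_unique)
      show "D ` I \<subseteq> point_derivs R X x" using D(1) by blast
      show "point_derivs R X x \<subseteq> functional.span (D ` I)"
      proof
        fix A assume A: "A \<in> point_derivs R X x"
        define B where "B = (\<Sum>i\<in>I. scale_functional (A (a i)) (D i))"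
        have B: "B \<in> point_derivs R X x"
          unfolding B_def
          by (intro functional.subspace_sum functional.subspace_scale subspace_point_derivs R D(1))
        have "B (a k) = A (a k)" if "k \<in> I" for k
        proof -
          have "B (a k) = (\<Sum>i\<in>I. if k = i then A (a i) else 0)"
            unfolding B_def sum_apply by (rule sum.cong) (auto simp: D(2)[OF that])
          then show ?thesis using that IJ(3) by simp
        qed
        then have J_eq: "\<forall>i\<in>J. B (a i) = A (a i)"
          using uq[OF point_derivs_tangent_dirs[OF R a B] point_derivs_tangent_dirs[OF R a A]] by blast
        have "B = A" by (rule point_derivs_determined[OF R gen B A]) (rule J_eq[rule_format])
        moreover have "B \<in> functional.span (D ` I)"
          unfolding B_def
          by (intro functional.span_sum functional.span_scale functional.span_base) blast
        ultimately show "A \<in> functional.span (D ` I)" by simp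
      qed
      show "functional.independent (D ` I)" by (rule indep)
      show "card (D ` I) = card I" by (rule card_image[OF inj])
    qed
  qed
qed

text \<open>The dimension of the tangent space at a general point of \<open>X\<close>.\<close>

definition generic_dim :: "('a \<Rightarrow> 'k::field) set \<Rightarrow> 'a set \<Rightarrow> nat" where
  "generic_dim R X = (THE d. \<exists>w\<in>R. \<not> vanishes_on X w \<and>
     (\<forall>x\<in>X. w x \<noteq> 0 \<longrightarrow> functional.dim (point_derivs R X x) = d))"

lemma generic_dim_eqI:
  assumes R: "function_ring R" and X: "prime_on R X" and w: "w \<in> R" "\<not> vanishes_on X w"
    and d: "\<And>x. x \<in> X \<Longrightarrow> w x \<noteq> 0 \<Longrightarrow> functional.dim (point_derivs R X x) = d"
  shows "generic_dim R X = d"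
  unfolding generic_dim_def
proof (rule the_equality)
  show "\<exists>w\<in>R. \<not> vanishes_on X w \<and> (\<forall>x\<in>X. w x \<noteq> 0 \<longrightarrow> functional.dim (point_derivs R X x) = d)"
    using w d by blast
next
  fix e assume "\<exists>w\<in>R. \<not> vanishes_on X w \<and> (\<forall>x\<in>X. w x \<noteq> 0 \<longrightarrow> functional.dim (point_derivs R X x) = e)"
  then obtain w' where w': "w' \<in> R" "\<not> vanishes_on X w'"
    "\<And>x. x \<in> X \<Longrightarrow> w' x \<noteq> 0 \<Longrightarrow> functional.dim (point_derivs R X x) = e" by blast
  have "\<not> vanishes_on X (w * w')" using prime_on_prod[OF X w(2) w'(2) w(1) w'(1)] .
  then obtain x where "x \<in> X" "w x \<noteq> 0" "w' x \<noteq> 0" by (auto simp: vanishes_on_def)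
  then show "e = d" using d w'(3) by metis
qed

lemma generic_dim_card:
  fixes R :: "('a \<Rightarrow> 'k::{alg_closed_field,field_char_0}) set"
  assumes R: "function_ring R" and gen: "generators R X a J" and J: "finite J"
    and X: "prime_on R X" and I: "transcendence_basis ((\<lambda>x i. a i x) ` X) J I"
  shows "generic_dim R X = card I"
  using generic_dim_eq_card[OF assms] generic_dim_eqI[OF R X] by metis

lemma generic_dim_point:
  fixes R :: "('a \<Rightarrow> 'k::{alg_closed_field,field_char_0}) set"
  assumes R: "function_ring R" and gen: "generators R X a J" and J: "finite J"
    and X: "prime_on R X"
  obtains w where "w \<in> R" "\<not> vanishes_on X w"
    "\<And>x. x \<in> X \<Longrightarrow> w x \<noteq> 0 \<Longrightarrow> functional.dim (point_derivs R X x) = generic_dim R X"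
proof -
  have "(\<lambda>x i. a i x) ` X \<noteq> {}" using X unfolding prime_on_def by blast
  then obtain I where I: "transcendence_basis ((\<lambda>x i. a i x) ` X) J I"
    using transcendence_basis_exists[OF J] by metis
  show thesis
    using generic_dim_eq_card[OF R gen J X I] that generic_dim_card[OF R gen J X I] by metis
qed

text \<open>Every function is algebraic over a transcendence basis: otherwise it could be added to the
  basis as a further generator, but the size of the basis is the dimension of the tangent space at a
  general point, which does not depend on the generators.  The constant coefficient of a relation of
  minimal degree is a multiple of the function.\<close>

lemma algebraic_constant_term:
  fixes R :: "('a \<Rightarrow> 'k::{alg_closed_field,field_char_0}) set"
  assumes R: "function_ring R" and gen: "generators R X a J" and J: "finite J"
    and X: "prime_on R X" and I: "transcendence_basis ((\<lambda>x i. a i x) ` X) J I"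
    and f: "f \<in> polys_on K" "I \<subseteq> K" "K \<subseteq> J" "\<not> vanishes_on ((\<lambda>x i. a i x) ` X) f"
  obtains p s where "p \<in> polys_on I" "s \<in> polys_on K"
    "\<not> vanishes_on ((\<lambda>x i. a i x) ` X) p" "vanishes_on ((\<lambda>x i. a i x) ` X) (p - f * s)"
proof -
  \<comment> \<open>adjoin \<open>f\<close> as a further generator with a fresh index\<close>
  obtain n where n: "n \<notin> J" using J ex_new_if_finite infinite_UNIV_nat by blast
  let ?\<alpha> = "\<lambda>x i. a i x"
  define a' where "a' = a(n := (\<lambda>x. f (?\<alpha> x)))"
  let ?\<beta> = "\<lambda>x i. a' i x"
  let ?J = "insert n J"
  have a: "\<And>i. i \<in> J \<Longrightarrow> a i \<in> R" using gen unfolding generators_def by blast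
  have IJ: "I \<subseteq> J" and Iind: "alg_independent (?\<alpha> ` X) I"
    using I unfolding transcendence_basis_def by blast+
  have fJ: "f \<in> polys_on J" by (rule polys_on_mono[OF f(1,3)])
  have same: "p (?\<beta> x) = p (?\<alpha> x)" if "p \<in> polys_on J" for p x
    by (rule polys_on_cong[OF that]) (use n in \<open>auto simp: a'_def\<close>)
  have gen': "generators R X a' ?J"
    unfolding generators_def
  proof (intro conjI ballI)
    fix i assume "i \<in> ?J"
    then show "a' i \<in> R" using a polys_on_comp_in_ring[OF R fJ a] by (auto simp: a'_def)
  next
    fix g assume "g \<in> R"
    then obtain p where p: "p \<in> polys_on J" "\<forall>x\<in>X. g x = p (?\<alpha> x)"
      using gen unfolding generators_def by blast
    then show "\<exists>p\<in>polys_on ?J. \<forall>x\<in>X. g x = p (?\<beta> x)"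
      using same[OF p(1)] polys_on_mono[OF p(1) subset_insertI] by (intro bexI[of _ p]) auto
  qed
  have "alg_independent (?\<beta> ` X) I"
    unfolding alg_independent_def
  proof (intro ballI impI)
    fix p assume p: "p \<in> polys_on I" "vanishes_on (?\<beta> ` X) p"
    then have "vanishes_on (?\<alpha> ` X) p"
      using same[OF polys_on_mono[OF p(1) IJ]] by (simp add: vanishes_on_def)
    then show "p = 0" using Iind p(1) unfolding alg_independent_def by blast
  qed
  then obtain I' where I': "I \<subseteq> I'" "transcendence_basis (?\<beta> ` X) ?J I'"
    using transcendence_basis_extend[of ?J I] J IJ by blast
  have "card I' = card I"
    using generic_dim_card[OF R gen J X I] generic_dim_card[OF R gen' _ X I'(2)] J by simp
  moreover have "finite I'" using I'(2) J finite_subset unfolding transcendence_basis_def by blast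
  ultimately have "I' = I" using I'(1) by (metis card_subset_eq)
  then have "algebraic_over I (?\<beta> ` X) n"
    using I'(2) n IJ unfolding transcendence_basis_def by blast
  then obtain Q where Q: "Q \<in> polys_over I" "vanishes_on (?\<beta> ` X) (poly Q (coord n))"
    "\<not> (\<forall>i. vanishes_on (?\<beta> ` X) (coeff Q i))"
    unfolding algebraic_over_def by blast
  define L where "L = {Q \<in> polys_over I. vanishes_on (?\<beta> ` X) (poly Q (coord n))}"
  have L: "relation_ideal I (?\<beta> ` X) L" unfolding L_def by (rule relations_form_ideal)
  obtain P where P: "P \<in> L" "\<not> vanishes_on (?\<beta> ` X) (lead_coeff P)"
    and min: "\<And>Q i. Q \<in> L \<Longrightarrow> degree Q < degree P \<Longrightarrow> vanishes_on (?\<beta> ` X) (coeff Q i)"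
    using relation_ideal_min_degree[OF L _ Q(3)] Q(1,2) unfolding L_def by blast
  obtain p P' where pP: "P = pCons p P'" by (cases P)
  have p: "p \<in> polys_on I" and P': "P' \<in> polys_over I"
    using P(1) by (simp_all add: L_def pP polys_over_pCons)
  have eval: "poly Q (coord n) (?\<beta> x) = poly Q f (?\<alpha> x)" if "Q \<in> polys_over I" for Q x
  proof -
    have "map_poly (\<lambda>q. q (?\<beta> x)) Q = map_poly (\<lambda>q. q (?\<alpha> x)) Q"
      by (intro poly_eqI) (simp add: coeff_map_poly same[OF polys_on_mono[OF polys_over_coeff[OF that] IJ]])
    then show ?thesis by (simp add: poly_apply a'_def)
  qed
  have p_eq: "p (?\<beta> x) = p (?\<alpha> x)" for x by (rule same[OF polys_on_mono[OF p IJ]])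
  have rel: "p (?\<alpha> x) + f (?\<alpha> x) * poly P' f (?\<alpha> x) = 0" if "x \<in> X" for x
  proof -
    have "poly P (coord n) (?\<beta> x) = 0" using P(1) that unfolding L_def vanishes_on_def by blast
    then have "poly P f (?\<alpha> x) = 0" using eval[of P x] P(1) unfolding L_def by simp
    then show ?thesis by (simp add: pP)
  qed
  have P'f: "poly P' f \<in> polys_on K"
    using P'
  proof (induction P')
    case (pCons c Q)
    then have "c \<in> polys_on I" "Q \<in> polys_over I" by (simp_all add: polys_over_pCons)
    then show ?case
      unfolding poly_pCons using pCons.IH f by (intro polys_on_add polys_on_mult) (auto intro: polys_on_mono)
  qed (simp only: poly_0 polys_on_0)
  have "\<not> vanishes_on (?\<alpha> ` X) p"
  proof
    assume "vanishes_on (?\<alpha> ` X) p"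
    then have p0: "p (?\<alpha> x) = 0" if "x \<in> X" for x using that by (simp add: vanishes_on_def)
    have "vanishes_on (?\<alpha> ` X) (f * poly P' f)" using rel p0 by (simp add: vanishes_on_def)
    then have "vanishes_on (?\<alpha> ` X) (poly P' f)"
      using prime_on_polys[OF R gen X] fJ polys_on_mono[OF P'f f(3)] f(4) unfolding prime_on_def by blast
    then have "P' \<in> L" using P' eval[OF P'] unfolding L_def by (simp add: vanishes_on_def)
    show False
    proof (cases "P' = 0")
      case True
      then have "lead_coeff P = p" by (simp add: pP)
      then show False using P(2) p0 p_eq by (simp add: vanishes_on_def)
    next
      case False
      then have "degree P' < degree P" "lead_coeff P = coeff P' (degree P')" by (simp_all add: pP)
      then show False using min[OF \<open>P' \<in> L\<close>, of "degree P'"] P(2) by simp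
    qed
  qed
  moreover have "vanishes_on (?\<alpha> ` X) (p - f * (- poly P' f))"
    using rel by (simp add: vanishes_on_def)
  ultimately show thesis using that[OF p polys_on_uminus[OF P'f]] by blast
qed

text \<open>A function that vanishes on \<open>Y\<close> but not on \<open>X\<close> forces a relation on
  \<open>Y\<close> between the members of any transcendence basis of \<open>X\<close>.\<close>

lemma generic_dim_strict_mono:
  fixes R :: "('a \<Rightarrow> 'k::{alg_closed_field,field_char_0}) set"
  assumes R: "function_ring R" and gen: "generators R X a J" and J: "finite J"
    and X: "prime_on R X" and Y: "prime_on R Y" "Y \<subseteq> X"
    and f: "f \<in> R" "vanishes_on Y f" "\<not> vanishes_on X f"
  shows "generic_dim R Y < generic_dim R X"
proof -
  let ?\<alpha> = "\<lambda>x i. a i x"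
  have genY: "generators R Y a J" by (rule generators_subset[OF gen Y(2)])
  have "?\<alpha> ` Y \<noteq> {}" using Y unfolding prime_on_def by blast
  then obtain I where I: "transcendence_basis (?\<alpha> ` Y) J I"
    using transcendence_basis_exists[OF J] by metis
  have IJ: "I \<subseteq> J" and Iind: "alg_independent (?\<alpha> ` Y) I"
    using I unfolding transcendence_basis_def by blast+
  have "alg_independent (?\<alpha> ` X) I"
    unfolding alg_independent_def
  proof (intro ballI impI)
    fix p assume p: "p \<in> polys_on I" "vanishes_on (?\<alpha> ` X) p"
    have "vanishes_on (?\<alpha> ` Y) p" by (rule vanishes_on_subset[OF p(2) image_mono[OF Y(2)]])
    then show "p = 0" using Iind p(1) unfolding alg_independent_def by blast
  qed
  then obtain I' where I': "I \<subseteq> I'" "transcendence_basis (?\<alpha> ` X) J I'"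
    using transcendence_basis_extend[OF J IJ] by metis
  have fin: "finite I'" using I'(2) J finite_subset unfolding transcendence_basis_def by blast
  have dims: "generic_dim R Y = card I" "generic_dim R X = card I'"
    using generic_dim_card[OF R genY J Y(1) I] generic_dim_card[OF R gen J X I'(2)] .
  have "I \<noteq> I'"
  proof
    assume eq: "I = I'"
    obtain q where q: "q \<in> polys_on J" "\<forall>x\<in>X. f x = q (?\<alpha> x)"
      using f(1) gen unfolding generators_def by blast
    have qX: "\<not> vanishes_on (?\<alpha> ` X) q" and qY: "vanishes_on (?\<alpha> ` Y) q"
      using f(2,3) q(2) subsetD[OF Y(2)] unfolding vanishes_on_def by force+
    obtain p s where p: "p \<in> polys_on I'" "\<not> vanishes_on (?\<alpha> ` X) p"
      and s: "vanishes_on (?\<alpha> ` X) (p - q * s)"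
      using algebraic_constant_term[OF R gen J X I'(2) q(1) _ subset_refl qX] I'(2)
      unfolding transcendence_basis_def by metis
    have "vanishes_on (?\<alpha> ` Y) p"
      unfolding vanishes_on_def
    proof clarify
      fix y assume y: "y \<in> Y"
      then have "(p - q * s) (?\<alpha> y) = 0" using s Y(2) unfolding vanishes_on_def by blast
      moreover have "q (?\<alpha> y) = 0" using qY y unfolding vanishes_on_def by blast
      ultimately show "p (?\<alpha> y) = 0" by simp
    qed
    then have "p = 0" using Iind p(1) eq unfolding alg_independent_def by blast
    then show False using p(2) by (simp add: vanishes_on_def)
  qed
  then have "I \<subset> I'" using I'(1) by blast
  then show ?thesis unfolding dims using psubset_card_mono[OF fin] by blast
qed

lemma polys_on_fix_coord: "f \<in> polys_on I \<Longrightarrow> (\<lambda>z. f (z(i := c))) \<in> polys_on (I - {i})"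
proof (induction rule: polys_on.induct)
  case (coord k)
  then show ?case by (cases "k = i") (auto intro: polys_on.intros)
qed (auto intro: polys_on.intros)

text \<open>The projection of \<open>X\<close> to a transcendence basis hits every point outside the zeros of some
  function \<open>h\<close>.  On a coordinate hyperplane where \<open>h\<close> is not identically zero the
  remaining coordinates of the basis therefore satisfy no relation.  If each of finitely many pieces of
  the section satisfied one, the product of these would be a relation on the whole section; so the
  remaining coordinates are independent on some piece.\<close>

lemma hyperplane_section:
  fixes R :: "('a \<Rightarrow> 'k::{alg_closed_field,field_char_0}) set"
  assumes R: "function_ring R" and gen: "generators R X a J" and J: "finite J"
    and X: "prime_on R X"
    and closed: "\<And>z. z \<in> coord_hull J ((\<lambda>x i. a i x) ` X) \<Longrightarrow> \<exists>x\<in>X. \<forall>i\<in>J. a i x = z i"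
    and pos: "generic_dim R X > 0"
  obtains g where "g \<in> R" "\<not> vanishes_on X g"
    "\<forall>\<D>. finite \<D> \<longrightarrow> {x \<in> X. g x = 0} = \<Union>\<D> \<longrightarrow> (\<forall>D\<in>\<D>. prime_on R D) \<longrightarrow>
      (\<exists>D\<in>\<D>. generic_dim R X \<le> Suc (generic_dim R D))"
proof -
  let ?\<alpha> = "\<lambda>x i. a i x"
  have a: "\<And>i. i \<in> J \<Longrightarrow> a i \<in> R" using gen unfolding generators_def by blast
  have "?\<alpha> ` X \<noteq> {}" using X unfolding prime_on_def by blast
  then obtain I where I: "transcendence_basis (?\<alpha> ` X) J I"
    using transcendence_basis_exists[OF J] by metis
  have IJ: "I \<subseteq> J" "J = I \<union> (J - I)" and Iind: "alg_independent (?\<alpha> ` X) I"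
    using I unfolding transcendence_basis_def by blast+
  have finI: "finite I" using J IJ(1) finite_subset by blast
  have dimX: "generic_dim R X = card I" by (rule generic_dim_card[OF R gen J X I])
  then have "I \<noteq> {}" using pos by auto
  then obtain i where i: "i \<in> I" by blast
  have "\<exists>h\<in>polys_on I. \<not> vanishes_on (?\<alpha> ` X) h \<and>
    (\<forall>z\<in>coord_hull I (?\<alpha> ` X). h z \<noteq> 0 \<longrightarrow>
      (\<exists>z'\<in>coord_hull (I \<union> (J - I)) (?\<alpha> ` X). \<forall>i\<in>I. z' i = z i))"
  proof (rule algebraic_tower_lift)
    show "finite (J - I)" "I \<inter> (J - I) = {}" using J by blast+
    show "prime_on (polys_on (I \<union> (J - I))) (?\<alpha> ` X)"
      using prime_on_polys[OF R gen X] by (simp only: IJ(2)[symmetric])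
    show "algebraic_over I (?\<alpha> ` X) j" if "j \<in> J - I" for j
      using I that unfolding transcendence_basis_def by blast
    show "\<exists>p\<in>polys_on I. \<exists>s\<in>polys_on K. \<not> vanishes_on (?\<alpha> ` X) p \<and> vanishes_on (?\<alpha> ` X) (p - f * s)"
      if K: "I \<subseteq> K" "K \<subseteq> I \<union> (J - I)" and f: "f \<in> polys_on K" "\<not> vanishes_on (?\<alpha> ` X) f" for K f
    proof -
      have "K \<subseteq> J" using K(2) by (simp only: IJ(2)[symmetric])
      then show ?thesis using algebraic_constant_term[OF R gen J X I f(1) K(1) _ f(2)] by metis
    qed
  qed
  then obtain h where h: "h \<in> polys_on I" "\<not> vanishes_on (?\<alpha> ` X) h"
    and h_lift: "\<And>z. z \<in> coord_hull I (?\<alpha> ` X) \<Longrightarrow> h z \<noteq> 0 \<Longrightarrow>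
      \<exists>z'\<in>coord_hull J (?\<alpha> ` X). \<forall>i\<in>I. z' i = z i"
    unfolding IJ(2)[symmetric] by blast
  have hull: "z \<in> coord_hull I (?\<alpha> ` X)" for z
    using Iind unfolding coord_hull_def zero_set_def alg_independent_def by auto
  obtain z0 where z0: "h z0 \<noteq> 0" using h(2) by (auto simp: vanishes_on_def)
  define c where "c = z0 i"
  define g where "g = (\<lambda>x. a i x - c)"
  have gR: "g \<in> R"
  proof -
    have "a i - (\<lambda>_. c) \<in> R"
      by (rule function_ring_diff[OF R a function_ring_const[OF R]]) (use i IJ in blast)
    moreover have "a i - (\<lambda>_. c) = g" by (simp add: g_def fun_eq_iff)
    ultimately show ?thesis by simp
  qed
  have gX: "\<not> vanishes_on X g"
  proof
    assume "vanishes_on X g"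
    then have "vanishes_on (?\<alpha> ` X) (coord i - (\<lambda>_. c))" by (simp add: vanishes_on_def g_def)
    moreover have "coord i - (\<lambda>_. c) \<in> polys_on I" by (intro polys_on_diff polys_on.coord polys_on.const i)
    ultimately have 0: "coord i - (\<lambda>_. c) = 0" using Iind unfolding alg_independent_def by blast
    show False using fun_cong[OF 0, of "\<lambda>_. c + 1"] by simp
  qed
  have main: "\<exists>D\<in>\<D>. generic_dim R X \<le> Suc (generic_dim R D)"
    if \<D>: "finite \<D>" "{x \<in> X. g x = 0} = \<Union>\<D>" and prime: "\<And>D. D \<in> \<D> \<Longrightarrow> prime_on R D" for \<D>
  proof -
    have "\<exists>D\<in>\<D>. alg_independent (?\<alpha> ` D) (I - {i})"
    proof (rule ccontr)
      assume "\<not> (\<exists>D\<in>\<D>. alg_independent (?\<alpha> ` D) (I - {i}))"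
      then have "\<forall>D\<in>\<D>. \<exists>p. p \<in> polys_on (I - {i}) \<and> vanishes_on (?\<alpha> ` D) p \<and> p \<noteq> 0"
        unfolding alg_independent_def by blast
      from bchoice[OF this] obtain p where
        p: "\<forall>D\<in>\<D>. p D \<in> polys_on (I - {i}) \<and> vanishes_on (?\<alpha> ` D) (p D) \<and> p D \<noteq> 0" ..
      define q where "q = prod p \<D>"
      define h' where "h' = (\<lambda>z. h (z(i := c)))"
      have q: "q \<in> polys_on (I - {i})" unfolding q_def by (rule polys_on_prod) (use p in blast)
      have "q \<noteq> 0"
        unfolding q_def by (rule polys_on_prod_nonzero[where J = "I - {i}"]) (use p finI \<D>(1) in blast)+
      moreover have "h' \<in> polys_on (I - {i})" unfolding h'_def by (rule polys_on_fix_coord[OF h(1)])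
      moreover have "h' \<noteq> 0"
      proof
        assume "h' = 0"
        then have "h' z0 = 0" by simp
        then show False using z0 by (simp add: h'_def c_def)
      qed
      ultimately have "q * h' \<noteq> 0"
        using polys_on_domain[of "I - {i}" q h'] q finI by blast
      then obtain z1 where z1: "q z1 \<noteq> 0" "h' z1 \<noteq> 0" by (auto simp: fun_eq_iff)
      define z2 where "z2 = z1(i := c)"
      obtain z' where z': "z' \<in> coord_hull J (?\<alpha> ` X)" "\<forall>k\<in>I. z' k = z2 k"
        using h_lift[OF hull] z1(2) unfolding h'_def z2_def by blast
      obtain x where x: "x \<in> X" "\<forall>k\<in>J. a k x = z' k" using closed[OF z'(1)] by blast
      have xk: "a k x = z2 k" if "k \<in> I" for k using x(2) z'(2) that IJ(1) by auto
      have "g x = 0" using xk[OF i] by (simp add: g_def z2_def)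
      then obtain D where D: "D \<in> \<D>" "x \<in> D" using x(1) \<D>(2) by blast
      have "p D (?\<alpha> x) = 0" using p D by (auto simp: vanishes_on_def)
      moreover have "p D (?\<alpha> x) = p D z1"
        by (rule polys_on_cong[of _ "I - {i}"]) (use p D xk in \<open>auto simp: z2_def\<close>)
      ultimately have "p D z1 = 0" by simp
      moreover have "q = p D * prod p (\<D> - {D})" unfolding q_def by (rule prod.remove[OF \<D>(1) D(1)])
      ultimately have "q z1 = 0" by simp
      then show False using z1(1) by simp
    qed
    then obtain D where D: "D \<in> \<D>" "alg_independent (?\<alpha> ` D) (I - {i})" by blast
    have DX: "D \<subseteq> X" using D(1) \<D>(2) by blast
    obtain I' where I': "I - {i} \<subseteq> I'" "transcendence_basis (?\<alpha> ` D) J I'"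
      using transcendence_basis_extend[OF J _ D(2)] IJ(1) by blast
    have "finite I'" using I'(2) J finite_subset unfolding transcendence_basis_def by blast
    then have "card (I - {i}) \<le> card I'" by (rule card_mono[OF _ I'(1)])
    moreover have "card I = Suc (card (I - {i}))" by (rule card.remove[OF finI i])
    moreover have "generic_dim R D = card I'"
      by (rule generic_dim_card[OF R generators_subset[OF gen DX] J prime[OF D(1)] I'(2)])
    ultimately show ?thesis using D(1) dimX by (intro bexI[of _ D]) linarith
  qed
  show thesis by (rule that[OF gR gX]) (intro allI impI, rule main, simp_all)
qed

section \<open>Bounded subsets of an ind-variety\<close>

lemma irreducible_inI:
  assumes "Z \<subseteq> topspace S" "Z \<noteq> {}"
    and "\<And>C D. closedin S C \<Longrightarrow> closedin S D \<Longrightarrow> Z \<subseteq> C \<union> D \<Longrightarrow> Z \<subseteq> C \<or> Z \<subseteq> D"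
  shows "irreducible_in S Z"
  using assms unfolding irreducible_in_def by simp

lemma irreducible_inD:
  assumes "irreducible_in S Z"
  shows irreducible_in_subset: "Z \<subseteq> topspace S" and irreducible_in_nonempty: "Z \<noteq> {}"
    and irreducible_in_cases: "closedin S C \<Longrightarrow> closedin S D \<Longrightarrow> Z \<subseteq> C \<union> D \<Longrightarrow> Z \<subseteq> C \<or> Z \<subseteq> D"
  using assms unfolding irreducible_in_def by simp_all

lemma irreducible_in_subtopology:
  "irreducible_in (subtopology S X) Z \<longleftrightarrow> Z \<subseteq> X \<and> irreducible_in S Z"
proof
  assume irr: "irreducible_in (subtopology S X) Z"
  have ZX: "Z \<subseteq> X" "Z \<subseteq> topspace S" using irreducible_in_subset[OF irr] by auto
  have "irreducible_in S Z"
  proof (rule irreducible_inI[OF ZX(2) irreducible_in_nonempty[OF irr]])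
    fix C D assume CD: "closedin S C" "closedin S D" "Z \<subseteq> C \<union> D"
    have "closedin (subtopology S X) (C \<inter> X)" "closedin (subtopology S X) (D \<inter> X)"
      unfolding closedin_subtopology using CD(1,2) by auto
    from irreducible_in_cases[OF irr this] show "Z \<subseteq> C \<or> Z \<subseteq> D" using CD(3) ZX by blast
  qed
  then show "Z \<subseteq> X \<and> irreducible_in S Z" using ZX(1) by simp
next
  assume Z: "Z \<subseteq> X \<and> irreducible_in S Z"
  show "irreducible_in (subtopology S X) Z"
  proof (rule irreducible_inI)
    show "Z \<subseteq> topspace (subtopology S X)" "Z \<noteq> {}"
      using Z irreducible_in_subset[of S Z] irreducible_in_nonempty[of S Z] by auto
    fix C D
    assume C: "closedin (subtopology S X) C" and D: "closedin (subtopology S X) D" and sub: "Z \<subseteq> C \<union> D"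
    obtain C' where C': "closedin S C'" "C = C' \<inter> X" using C unfolding closedin_subtopology by (elim exE conjE)
    obtain D' where D': "closedin S D'" "D = D' \<inter> X" using D unfolding closedin_subtopology by (elim exE conjE)
    from irreducible_in_cases[OF conjunct2[OF Z] C'(1) D'(1)] show "Z \<subseteq> C \<or> Z \<subseteq> D"
      using sub Z unfolding C'(2) D'(2) by blast
  qed
qed

locale ind_variety_space =
  fixes V :: "('a, 'k::{alg_closed_field,field_char_0}) ind_var"
  assumes ind_var: "ind_variety V"
begin

abbreviation "R \<equiv> ind_reg V"
abbreviation "T \<equiv> ind_zariski V"

lemma affine: "affine_variety (V k)"
  using ind_var unfolding ind_variety_def by blast

lemma function_ring_reg: "function_ring (reg (V k))"
  unfolding function_ring_def plus_fun_def times_fun_def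
  by (intro conjI allI ballI affine_variety_reg_const[OF affine] affine_variety_reg_add[OF affine]
      affine_variety_reg_mult[OF affine])

lemma function_ring_R: "function_ring R"
  unfolding function_ring_def ind_reg_def
  by (intro conjI allI ballI INT_I function_ringD[OF function_ring_reg]) blast+

lemma R_subset_reg: "R \<subseteq> reg (V k)"
  unfolding ind_reg_def by blast

lemma pts_mono: "k \<le> l \<Longrightarrow> pts (V k) \<subseteq> pts (V l)"
  by (rule ind_variety_mono(1)[OF ind_var])

text \<open>The zero sets of regular functions on \<open>X\<close>; for bounded \<open>X\<close> these are the
  closed subsets.\<close>

definition zeros :: "'a set \<Rightarrow> ('a \<Rightarrow> 'k) set \<Rightarrow> 'a set" where
  "zeros X F = {x \<in> X. \<forall>f\<in>F. f x = 0}"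

definition rel_closed :: "'a set \<Rightarrow> 'a set \<Rightarrow> bool" where
  "rel_closed X C \<longleftrightarrow> (\<exists>F\<subseteq>R. C = zeros X F)"

lemma rel_closed_subset: "rel_closed X C \<Longrightarrow> C \<subseteq> X"
  unfolding rel_closed_def zeros_def by blast

lemma rel_closed_self: "rel_closed X X"
  unfolding rel_closed_def zeros_def by (rule exI[of _ "{}"]) blast

lemma rel_closed_trans:
  assumes "rel_closed X Y" "rel_closed Y C" shows "rel_closed X C"
proof -
  obtain F G where "F \<subseteq> R" "Y = zeros X F" "G \<subseteq> R" "C = zeros Y G"
    using assms unfolding rel_closed_def by blast
  then show ?thesis unfolding rel_closed_def by (intro exI[of _ "F \<union> G"]) (auto simp: zeros_def)
qed

lemma rel_closed_zero: "f \<in> R \<Longrightarrow> rel_closed X {x \<in> X. f x = 0}"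
  unfolding rel_closed_def zeros_def by (rule exI[of _ "{f}"]) blast

lemma rel_closed_restrict: "rel_closed X C \<Longrightarrow> Y \<subseteq> X \<Longrightarrow> rel_closed Y (Y \<inter> C)"
  unfolding rel_closed_def zeros_def by blast

lemma zariski_closed_iff: "zariski_closed_in (V k) C \<longleftrightarrow> rel_closed (pts (V k)) C"
proof
  assume "zariski_closed_in (V k) C"
  then obtain F where F: "F \<subseteq> reg (V k)" "C = {x \<in> pts (V k). \<forall>f\<in>F. f x = 0}"
    unfolding zariski_closed_in_def by blast
  let ?G = "{g \<in> R. \<exists>f\<in>F. \<forall>x\<in>pts (V k). g x = f x}"
  have "C = zeros (pts (V k)) ?G"
  proof (intro equalityI subsetI)
    fix x assume x: "x \<in> zeros (pts (V k)) ?G"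
    have "f x = 0" if f: "f \<in> F" for f
    proof -
      obtain g where g: "g \<in> R" "\<And>x. x \<in> pts (V k) \<Longrightarrow> g x = f x"
        using ind_reg_extend[OF ind_var] f F(1) by blast
      then have "g x = 0" using x f unfolding zeros_def by blast
      then show ?thesis using g(2)[of x] x unfolding zeros_def by simp
    qed
    then show "x \<in> C" using x F(2) by (simp add: zeros_def)
  qed (auto simp: F(2) zeros_def)
  moreover have "?G \<subseteq> R" by blast
  ultimately show "rel_closed (pts (V k)) C" unfolding rel_closed_def by (intro exI[of _ ?G] conjI)
next
  assume "rel_closed (pts (V k)) C"
  then obtain F where "F \<subseteq> R" "C = zeros (pts (V k)) F" unfolding rel_closed_def by blast
  then show "zariski_closed_in (V k) C"
    unfolding zeros_def zariski_closed_in_def using R_subset_reg[of k] by (intro exI[of _ F]) auto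
qed

lemma rel_closed_pts:
  assumes "k \<le> m" shows "rel_closed (pts (V m)) (pts (V k))"
  using assms
proof (induction m rule: dec_induct)
  case base
  show ?case by (rule rel_closed_self)
next
  case (step m)
  have "zariski_closed_in (V (Suc m)) (pts (V m))"
    using ind_var unfolding ind_variety_def is_closed_subvariety_def by blast
  then show ?case using step.IH rel_closed_trans zariski_closed_iff by blast
qed

lemma closedin_iff:
  "closedin T Z \<longleftrightarrow> Z \<subseteq> ind_pts V \<and> (\<forall>k. rel_closed (pts (V k)) (pts (V k) \<inter> Z))"
  unfolding closedin_ind_zariski[OF ind_var] zariski_closed_iff ..

lemma topspace_T: "topspace T = ind_pts V"
  by (rule topspace_ind_zariski[OF ind_var])

lemma pts_subset: "pts (V k) \<subseteq> ind_pts V"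
  unfolding ind_pts_def by blast

lemma closedin_pts: "closedin T (pts (V k))"
  unfolding closedin_iff
proof (intro conjI allI)
  fix m show "rel_closed (pts (V m)) (pts (V m) \<inter> pts (V k))"
  proof (cases "k \<le> m")
    case True
    then show ?thesis using rel_closed_pts[OF True] pts_mono[OF True] by (simp add: Int_absorb1)
  next
    case False
    then have "pts (V m) \<inter> pts (V k) = pts (V m)" using pts_mono[of m k] by auto
    then show ?thesis using rel_closed_self by simp
  qed
qed (rule pts_subset)

lemma closedin_zeros: "F \<subseteq> R \<Longrightarrow> closedin T (zeros (ind_pts V) F)"
  unfolding closedin_iff
proof (intro conjI allI)
  fix k assume "F \<subseteq> R"
  moreover have "pts (V k) \<inter> zeros (ind_pts V) F = zeros (pts (V k)) F"
    using pts_subset[of k] by (auto simp: zeros_def)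
  ultimately show "rel_closed (pts (V k)) (pts (V k) \<inter> zeros (ind_pts V) F)"
    unfolding rel_closed_def by auto
qed (auto simp: zeros_def)

lemma closedin_subtopology_iff:
  assumes X: "X \<subseteq> pts (V k)"
  shows "closedin (subtopology T X) C \<longleftrightarrow> rel_closed X C"
proof
  assume "closedin (subtopology T X) C"
  then obtain D where D: "closedin T D" "C = D \<inter> X" unfolding closedin_subtopology by blast
  then have "rel_closed X (X \<inter> (pts (V k) \<inter> D))"
    using closedin_iff rel_closed_restrict[OF _ X] by blast
  moreover have "X \<inter> (pts (V k) \<inter> D) = C" using X D(2) by blast
  ultimately show "rel_closed X C" by simp
next
  assume "rel_closed X C"
  then obtain F where F: "F \<subseteq> R" "C = zeros X F" unfolding rel_closed_def by blast
  have "C = zeros (ind_pts V) F \<inter> X" using F(2) X pts_subset[of k] by (auto simp: zeros_def)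
  then show "closedin (subtopology T X) C"
    unfolding closedin_subtopology using closedin_zeros[OF F(1)] by blast
qed

lemma rel_closed_Union:
  assumes X: "X \<subseteq> pts (V k)" and "finite \<E>" "\<And>D. D \<in> \<E> \<Longrightarrow> rel_closed X D"
  shows "rel_closed X (\<Union>\<E>)"
  using assms(2,3) unfolding closedin_subtopology_iff[OF X, symmetric] by (rule closedin_Union)

lemma rel_closed_pts_iff: "rel_closed (pts (V k)) Z \<longleftrightarrow> closedin T Z \<and> Z \<subseteq> pts (V k)"
  unfolding closedin_subtopology_iff[OF order_refl, symmetric]
  by (rule closedin_closed_subtopology[OF closedin_pts])

lemma closedin_if_rel_closed: "rel_closed (pts (V k)) Z \<Longrightarrow> closedin T Z"
  unfolding rel_closed_pts_iff by (rule conjunct1)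

lemma rel_closed_if_closedin: "closedin T Z \<Longrightarrow> Z \<subseteq> pts (V k) \<Longrightarrow> rel_closed (pts (V k)) Z"
  unfolding rel_closed_pts_iff by (rule conjI)

lemma irreducible_iff_prime:
  assumes X: "X \<subseteq> pts (V k)"
  shows "irreducible_in T X \<longleftrightarrow> prime_on R X"
proof
  assume irr: "irreducible_in T X"
  have XT: "X \<subseteq> ind_pts V" using X pts_subset by blast
  show "prime_on R X"
    unfolding prime_on_def
  proof (intro conjI ballI impI)
    show "X \<noteq> {}" using irr unfolding irreducible_in_def by blast
    fix f g assume f: "f \<in> R" and g: "g \<in> R" and fg: "vanishes_on X (f * g)"
    have "X \<subseteq> zeros (ind_pts V) {f} \<union> zeros (ind_pts V) {g}"
      using fg XT by (auto simp: zeros_def vanishes_on_def)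
    moreover have "closedin T (zeros (ind_pts V) {f})" "closedin T (zeros (ind_pts V) {g})"
      using closedin_zeros f g by blast+
    ultimately have "X \<subseteq> zeros (ind_pts V) {f} \<or> X \<subseteq> zeros (ind_pts V) {g}"
      using irr unfolding irreducible_in_def by blast
    then show "vanishes_on X f \<or> vanishes_on X g" by (auto simp: zeros_def vanishes_on_def)
  qed
next
  assume prime: "prime_on R X"
  show "irreducible_in T X"
    unfolding irreducible_in_def topspace_T
  proof (intro conjI allI impI)
    show "X \<subseteq> ind_pts V" using X pts_subset by blast
    show "X \<noteq> {}" using prime unfolding prime_on_def by blast
    fix C D assume CD: "closedin T C \<and> closedin T D \<and> X \<subseteq> C \<union> D"
    then have "rel_closed X (C \<inter> X)" "rel_closed X (D \<inter> X)"
      using closedin_subtopology_iff[OF X] unfolding closedin_subtopology by blast+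
    then obtain F G where F: "F \<subseteq> R" "C \<inter> X = zeros X F" and G: "G \<subseteq> R" "D \<inter> X = zeros X G"
      unfolding rel_closed_def by blast
    show "X \<subseteq> C \<or> X \<subseteq> D"
    proof (rule ccontr)
      assume "\<not> (X \<subseteq> C \<or> X \<subseteq> D)"
      then obtain x y where "x \<in> X" "x \<notin> C \<inter> X" "y \<in> X" "y \<notin> D \<inter> X" by blast
      then obtain f g where fg: "f \<in> F" "f x \<noteq> 0" "g \<in> G" "g y \<noteq> 0" unfolding F(2) G(2) zeros_def by blast
      then have "\<not> vanishes_on X f" "\<not> vanishes_on X g"
        using \<open>x \<in> X\<close> \<open>y \<in> X\<close> unfolding vanishes_on_def by blast+
      then have "\<not> vanishes_on X (f * g)"
        using prime fg F(1) G(1) prime_on_prod by blast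
      moreover have "(f * g) z = 0" if z: "z \<in> X" for z
      proof -
        have "z \<in> C \<inter> X \<or> z \<in> D \<inter> X" using z CD by blast
        then show ?thesis using fg unfolding F(2) G(2) zeros_def by auto
      qed
      ultimately show False unfolding vanishes_on_def by blast
    qed
  qed
qed

section \<open>Affine coordinates on bounded sets\<close>

text \<open>Generators that embed \<open>X\<close> as a closed set: every solution of the relations between them
  comes from a point of \<open>X\<close>.\<close>

definition coordinates :: "'a set \<Rightarrow> (nat \<Rightarrow> 'a \<Rightarrow> 'k) \<Rightarrow> nat set \<Rightarrow> bool" where
  "coordinates X a J \<longleftrightarrow> finite J \<and> generators R X a J \<and>
     (\<forall>z\<in>coord_hull J ((\<lambda>x i. a i x) ` X). \<exists>x\<in>X. \<forall>i\<in>J. a i x = z i)"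

lemma coordinates_pts: obtains a J where "coordinates (pts (V k)) a J"
proof -
  obtain n S \<phi> where S: "S \<subseteq> poly_fun n" and bij: "bij_betw \<phi> (pts (V k)) (zero_locus n S)"
    and regV: "reg (V k) = {f. \<exists>p\<in>poly_fun n. \<forall>x\<in>pts (V k). f x = p (\<phi> x)}"
    using affine[of k] unfolding affine_variety_def by blast
  have "\<forall>i\<in>{..<n}. \<exists>f. f \<in> R \<and> (\<forall>x\<in>pts (V k). f x = \<phi> x i)"
  proof
    fix i assume "i \<in> {..<n}"
    then have "(\<lambda>x. \<phi> x i) \<in> reg (V k)"
      unfolding regV using poly_fun.coord[of i n] by (auto intro!: bexI[of _ "\<lambda>v. v i"])
    then show "\<exists>f. f \<in> R \<and> (\<forall>x\<in>pts (V k). f x = \<phi> x i)"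
      using ind_reg_extend[OF ind_var] by metis
  qed
  from bchoice[OF this] obtain a where a: "\<forall>i\<in>{..<n}. a i \<in> R \<and> (\<forall>x\<in>pts (V k). a i x = \<phi> x i)" ..
  have same: "p (\<lambda>i. a i x) = p (\<phi> x)" if "p \<in> poly_fun n" "x \<in> pts (V k)" for p x
    using that a unfolding poly_fun_eq_polys_on by (intro polys_on_cong[of p "{..<n}"]) auto
  have "generators R (pts (V k)) a {..<n}"
    unfolding generators_def
  proof (intro conjI ballI)
    fix f assume "f \<in> R"
    then obtain p where "p \<in> poly_fun n" "\<forall>x\<in>pts (V k). f x = p (\<phi> x)"
      using subsetD[OF R_subset_reg[of k]] unfolding regV mem_Collect_eq by blast
    then show "\<exists>p\<in>polys_on {..<n}. \<forall>x\<in>pts (V k). f x = p (\<lambda>i. a i x)"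
      using same[of p] unfolding poly_fun_eq_polys_on by (intro bexI[of _ p]) auto
  qed (use a in blast)
  moreover have "\<exists>x\<in>pts (V k). \<forall>i\<in>{..<n}. a i x = z i"
    if z: "z \<in> coord_hull {..<n} ((\<lambda>x i. a i x) ` pts (V k))" for z
  proof -
    define z' where "z' = (\<lambda>i. if i < n then z i else 0)"
    have "p z' = 0" if p: "p \<in> S" for p
    proof -
      have pn: "p \<in> poly_fun n" using p S by blast
      have "p (\<lambda>i. a i x) = 0" if "x \<in> pts (V k)" for x
      proof -
        have "\<phi> x \<in> zero_locus n S" using bij that unfolding bij_betw_def by blast
        then show ?thesis using same[OF pn that] p unfolding zero_locus_def by auto
      qed
      then have "vanishes_on ((\<lambda>x i. a i x) ` pts (V k)) p" by (simp add: vanishes_on_def)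
      then have "p z = 0" using z pn unfolding coord_hull_def zero_set_def poly_fun_eq_polys_on by blast
      moreover have "p z' = p z"
        using pn unfolding poly_fun_eq_polys_on by (rule polys_on_cong) (simp add: z'_def)
      ultimately show ?thesis by simp
    qed
    then have "z' \<in> zero_locus n S" by (auto simp: zero_locus_def affine_space_def z'_def)
    then have "z' \<in> \<phi> ` pts (V k)" using bij by (simp add: bij_betw_def)
    then obtain x where x: "z' = \<phi> x" "x \<in> pts (V k)" by (rule imageE)
    have "a i x = z i" if "i \<in> {..<n}" for i
      using a x(2) that fun_cong[OF x(1), of i] by (simp add: z'_def)
    then show ?thesis using x(2) by blast
  qed
  ultimately have "coordinates (pts (V k)) a {..<n}" unfolding coordinates_def by simp
  then show thesis by (rule that)
qed

lemma coord_hull_mono: "Y \<subseteq> X \<Longrightarrow> coord_hull J Y \<subseteq> coord_hull J X"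
  unfolding coord_hull_def zero_set_def by (auto dest: vanishes_on_subset)

lemma coordinates_rel_closed:
  assumes a: "coordinates X a J" and C: "rel_closed X C"
  shows "coordinates C a J"
proof -
  obtain F where F: "F \<subseteq> R" "C = zeros X F" using C unfolding rel_closed_def by blast
  have CX: "C \<subseteq> X" by (rule rel_closed_subset[OF C])
  have gen: "generators R X a J" using a unfolding coordinates_def by blast
  have "\<exists>x\<in>C. \<forall>i\<in>J. a i x = z i" if z: "z \<in> coord_hull J ((\<lambda>x i. a i x) ` C)" for z
  proof -
    have "z \<in> coord_hull J ((\<lambda>x i. a i x) ` X)"
      using z coord_hull_mono[OF image_mono[OF CX]] by blast
    then obtain x where x: "x \<in> X" "\<forall>i\<in>J. a i x = z i" using a unfolding coordinates_def by blast
    have "f x = 0" if f: "f \<in> F" for f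
    proof -
      obtain p where p: "p \<in> polys_on J" "\<forall>x\<in>X. f x = p (\<lambda>i. a i x)"
        using f F(1) gen unfolding generators_def by blast
      have "p (\<lambda>i. a i y) = 0" if "y \<in> C" for y
      proof -
        have "f y = 0" using that f unfolding F(2) zeros_def by blast
        then show ?thesis using p(2) that CX by auto
      qed
      then have "p z = 0" using z p(1) unfolding coord_hull_def zero_set_def vanishes_on_def by blast
      moreover have "p (\<lambda>i. a i x) = p z" by (rule polys_on_cong[OF p(1)]) (use x in auto)
      ultimately show ?thesis using p(2) x(1) by simp
    qed
    then have "x \<in> C" using x(1) unfolding F(2) zeros_def by blast
    then show ?thesis using x(2) by blast
  qed
  then show ?thesis using a generators_subset[OF gen CX] unfolding coordinates_def by blast
qed

lemma generators_bounded:
  assumes "X \<subseteq> pts (V k)"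
  obtains a J where "finite J" "generators R X a J"
proof -
  obtain a J where "coordinates (pts (V k)) a J" by (rule coordinates_pts)
  then show thesis using that generators_subset[OF _ assms] unfolding coordinates_def by blast
qed

section \<open>Decomposition into irreducible sets\<close>

text \<open>In coordinates the closed subsets of \<open>X\<close> are the traces of zero sets of polynomial
  functions.\<close>

lemma wf_rel_closed:
  assumes X: "X \<subseteq> pts (V k)"
  shows "wf {(C, D). rel_closed X C \<and> rel_closed X D \<and> C \<subset> D}"
proof (rule decseq_stabilizes_wf)
  fix C :: "nat \<Rightarrow> 'a set"
  assume C: "\<And>i. rel_closed X (C i)" and dec: "\<And>i. C (Suc i) \<subseteq> C i"
  obtain a J where J: "finite J" and gen: "generators R X a J" using generators_bounded[OF X] .
  let ?\<alpha> = "\<lambda>x i. a i x"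
  define D where "D i = coord_hull J (?\<alpha> ` C i)" for i
  have "stabilizes D"
  proof (rule zero_sets_stabilize[OF J])
    show "\<exists>F\<subseteq>polys_on J. D i = zero_set F" for i
      unfolding D_def coord_hull_def
      by (rule exI[of _ "{f \<in> polys_on J. vanishes_on (?\<alpha> ` C i) f}"]) simp
    show "D (Suc i) \<subseteq> D i" for i
      unfolding D_def by (rule coord_hull_mono[OF image_mono[OF dec]])
  qed
  moreover have "C i = {x \<in> X. ?\<alpha> x \<in> D i}" for i
  proof (intro equalityI subsetI)
    fix x assume x: "x \<in> C i"
    have "f (?\<alpha> x) = 0" if "vanishes_on (?\<alpha> ` C i) f" for f
      using that x unfolding vanishes_on_def by blast
    then show "x \<in> {x \<in> X. ?\<alpha> x \<in> D i}"
      using x rel_closed_subset[OF C] unfolding D_def coord_hull_def zero_set_def by blast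
  next
    fix x assume x: "x \<in> {x \<in> X. ?\<alpha> x \<in> D i}"
    obtain F where F: "F \<subseteq> R" "C i = zeros X F" using C unfolding rel_closed_def by blast
    have "f x = 0" if f: "f \<in> F" for f
    proof -
      obtain p where p: "p \<in> polys_on J" "\<forall>x\<in>X. f x = p (?\<alpha> x)"
        using f F(1) gen unfolding generators_def by blast
      have "p (?\<alpha> y) = 0" if "y \<in> C i" for y
      proof -
        have "f y = 0" "y \<in> X" using that f unfolding F(2) zeros_def by blast+
        then show ?thesis using p(2) by auto
      qed
      then have "vanishes_on (?\<alpha> ` C i) p" by (simp add: vanishes_on_def)
      then have "p (?\<alpha> x) = 0" using x p(1) unfolding D_def coord_hull_def zero_set_def by blast
      then show ?thesis using p(2) x by simp
    qed
    then show "x \<in> C i" using x unfolding F(2) zeros_def by blast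
  qed
  ultimately show "stabilizes C" unfolding stabilizes_def by metis
qed

text \<open>Noetherian induction: a nonempty set that is not irreducible is the union of two smaller closed
  sets, the zeros of two functions whose product vanishes.\<close>

lemma irreducible_decomposition:
  assumes X: "X \<subseteq> pts (V k)" and C: "rel_closed X C"
  obtains \<D> where "finite \<D>" "C = \<Union>\<D>" "\<And>D. D \<in> \<D> \<Longrightarrow> rel_closed X D \<and> prime_on R D"
proof -
  have "\<exists>\<D>. finite \<D> \<and> C = \<Union>\<D> \<and> (\<forall>D\<in>\<D>. rel_closed X D \<and> prime_on R D)"
    using C
  proof (induction C rule: wf_induct_rule[OF wf_rel_closed[OF X]])
    case (1 C)
    show ?case
    proof (cases "C = {} \<or> prime_on R C")
      case True
      then show ?thesis
      proof
        assume "C = {}"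
        then show ?thesis by (intro exI[of _ "{}"]) simp
      next
        assume "prime_on R C"
        then show ?thesis using 1(2) by (intro exI[of _ "{C}"]) simp
      qed
    next
      case False
      then obtain f g where fg: "f \<in> R" "g \<in> R" "vanishes_on C (f * g)"
        "\<not> vanishes_on C f" "\<not> vanishes_on C g"
        unfolding prime_on_def by blast
      have part: "\<exists>\<D>. finite \<D> \<and> {x \<in> C. h x = 0} = \<Union>\<D> \<and> (\<forall>D\<in>\<D>. rel_closed X D \<and> prime_on R D)"
        if h: "h \<in> R" "\<not> vanishes_on C h" for h
      proof (rule 1(1))
        have "rel_closed X {x \<in> C. h x = 0}" by (rule rel_closed_trans[OF 1(2) rel_closed_zero[OF h(1)]])
        then show "rel_closed X {x \<in> C. h x = 0}"
          and "({x \<in> C. h x = 0}, C) \<in> {(C, D). rel_closed X C \<and> rel_closed X D \<and> C \<subset> D}"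
          using h(2) 1(2) by (auto simp: vanishes_on_def)
      qed
      obtain \<D> where \<D>: "finite \<D>" "{x \<in> C. f x = 0} = \<Union>\<D>" "\<forall>D\<in>\<D>. rel_closed X D \<and> prime_on R D"
        using part[OF fg(1,4)] by blast
      obtain \<E> where \<E>: "finite \<E>" "{x \<in> C. g x = 0} = \<Union>\<E>" "\<forall>D\<in>\<E>. rel_closed X D \<and> prime_on R D"
        using part[OF fg(2,5)] by blast
      have "C = {x \<in> C. f x = 0} \<union> {x \<in> C. g x = 0}" using fg(3) by (auto simp: vanishes_on_def)
      then have "C = \<Union>(\<D> \<union> \<E>)" unfolding \<D>(2) \<E>(2) by simp
      moreover have "\<forall>D\<in>\<D> \<union> \<E>. rel_closed X D \<and> prime_on R D"
        using \<D>(3) \<E>(3) unfolding ball_Un by (rule conjI)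
      ultimately show ?thesis using \<D>(1) \<E>(1) by (intro exI[of _ "\<D> \<union> \<E>"] conjI finite_UnI)
    qed
  qed
  then show thesis using that by blast
qed

section \<open>Krull dimension\<close>

lemma generic_dim_strict:
  assumes X: "X \<subseteq> pts (V k)" and C: "rel_closed X C" "prime_on R C"
    and D: "prime_on R D" "D \<subseteq> X" "C \<subset> D"
  shows "generic_dim R C < generic_dim R D"
proof -
  obtain F where F: "F \<subseteq> R" "C = zeros X F" using C(1) unfolding rel_closed_def by blast
  obtain x where x: "x \<in> D" "x \<notin> C" using D(3) by blast
  then obtain f where f: "f \<in> F" "f x \<noteq> 0" using D(2) unfolding F(2) zeros_def by blast
  have van: "vanishes_on C f" using f(1) unfolding F(2) zeros_def vanishes_on_def by blast
  have nonvan: "\<not> vanishes_on D f" using x(1) f(2) unfolding vanishes_on_def by blast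
  have "D \<subseteq> pts (V k)" using D(2) X by blast
  then obtain a J where "finite J" "generators R D a J" by (rule generators_bounded)
  then show ?thesis
    using generic_dim_strict_mono[OF function_ring_R _ _ D(1) C(2) _ _ van nonvan] D(3) f(1) F(1) by blast
qed

lemma irreducible_chain_exists:
  assumes "rel_closed (pts (V k)) C" "prime_on R C" "d \<le> generic_dim R C"
  shows "\<exists>Z. (\<forall>i\<le>d. rel_closed C (Z i) \<and> prime_on R (Z i)) \<and> (\<forall>i<d. Z i \<subset> Z (Suc i)) \<and> Z d = C"
  using assms
proof (induction d arbitrary: C)
  case 0
  then show ?case by (intro exI[of _ "\<lambda>_. C"]) (simp add: rel_closed_self)
next
  case (Suc d)
  have CV: "C \<subseteq> pts (V k)" by (rule rel_closed_subset[OF Suc.prems(1)])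
  obtain a J where "coordinates (pts (V k)) a J" by (rule coordinates_pts)
  then have a: "coordinates C a J" by (rule coordinates_rel_closed[OF _ Suc.prems(1)])
  have J: "finite J" and gen: "generators R C a J"
    and hull: "\<And>z. z \<in> coord_hull J ((\<lambda>x i. a i x) ` C) \<Longrightarrow> \<exists>x\<in>C. \<forall>i\<in>J. a i x = z i"
    using a unfolding coordinates_def by simp_all
  have pos: "generic_dim R C > 0" using Suc.prems(3) by simp
  obtain g where g: "g \<in> R" "\<not> vanishes_on C g"
    and slice: "\<forall>\<D>. finite \<D> \<longrightarrow> {x \<in> C. g x = 0} = \<Union>\<D> \<longrightarrow> (\<forall>D\<in>\<D>. prime_on R D) \<longrightarrow>
      (\<exists>D\<in>\<D>. generic_dim R C \<le> Suc (generic_dim R D))"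
    by (rule hyperplane_section[OF function_ring_R gen J Suc.prems(2) hull pos])
  obtain \<D> where \<D>: "finite \<D>" "{x \<in> C. g x = 0} = \<Union>\<D>"
    "\<And>D. D \<in> \<D> \<Longrightarrow> rel_closed C D \<and> prime_on R D"
    using irreducible_decomposition[OF CV rel_closed_zero[OF g(1)]] by metis
  then obtain D where D: "D \<in> \<D>" "generic_dim R C \<le> Suc (generic_dim R D)"
    using slice[rule_format, OF \<D>(1,2)] by blast
  have DC: "rel_closed C D" "prime_on R D" using \<D>(3) D(1) by blast+
  have "D \<noteq> C" using g(2) D(1) \<D>(2) unfolding vanishes_on_def by blast
  then have sub: "D \<subset> C" using rel_closed_subset[OF DC(1)] by blast
  have "d \<le> generic_dim R D" using D(2) Suc.prems(3) by linarith
  then obtain Z where Z: "\<forall>i\<le>d. rel_closed D (Z i) \<and> prime_on R (Z i)" "\<forall>i<d. Z i \<subset> Z (Suc i)" "Z d = D"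
    using Suc.IH[OF rel_closed_trans[OF Suc.prems(1) DC(1)] DC(2)] by blast
  have "rel_closed C (Z i)" if "i \<le> d" for i using Z(1) that rel_closed_trans[OF DC(1)] by blast
  then show ?case
    using Z sub Suc.prems(2) rel_closed_self
    by (intro exI[of _ "\<lambda>i. if i \<le> d then Z i else C"]) (auto simp: le_Suc_eq less_Suc_eq)
qed

text \<open>The generic dimension decreases strictly along a chain of irreducible closed sets, which bounds the
  length of chains, and repeated hyperplane sections produce a chain of this length.\<close>

theorem krull_dim_eq_generic_dim:
  assumes C: "rel_closed (pts (V k)) C" "prime_on R C"
  shows "krull_dim (subtopology T C) = enat (generic_dim R C)"
proof -
  have CV: "C \<subseteq> pts (V k)" by (rule rel_closed_subset[OF C(1)])
  have chain_iff: "closedin (subtopology T C) Z \<and> irreducible_in (subtopology T C) Z \<longleftrightarrow>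
      rel_closed C Z \<and> prime_on R Z" for Z
    unfolding closedin_subtopology_iff[OF CV] irreducible_in_subtopology
    using rel_closed_subset[of C Z] CV irreducible_iff_prime[of Z k] by blast
  have le: "n \<le> generic_dim R C"
    if Z: "\<forall>i\<le>n. rel_closed C (Z i) \<and> prime_on R (Z i)" "\<forall>i<n. Z i \<subset> Z (Suc i)" for n and Z
  proof -
    have "i \<le> generic_dim R (Z i)" if "i \<le> n" for i
      using that
    proof (induction i)
      case (Suc i)
      have "generic_dim R (Z i) < generic_dim R (Z (Suc i))"
        using Z Suc.prems rel_closed_subset[of C "Z (Suc i)"]
        by (intro generic_dim_strict[OF CV]) auto
      then show ?case using Suc by simp
    qed simp
    then have n: "n \<le> generic_dim R (Z n)" by simp
    show ?thesis
    proof (cases "Z n = C")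
      case False
      then have "generic_dim R (Z n) < generic_dim R C"
        using Z(1) rel_closed_subset[of C "Z n"] C(2) by (intro generic_dim_strict[OF CV]) auto
      then show ?thesis using n by simp
    qed (use n in simp)
  qed
  obtain Z where "\<forall>i\<le>generic_dim R C. rel_closed C (Z i) \<and> prime_on R (Z i)"
    "\<forall>i<generic_dim R C. Z i \<subset> Z (Suc i)"
    using irreducible_chain_exists[OF C order_refl] by blast
  then have "enat (generic_dim R C) \<in> {enat n | n. \<exists>Z. (\<forall>i\<le>n. closedin (subtopology T C) (Z i) \<and>
      irreducible_in (subtopology T C) (Z i)) \<and> (\<forall>i<n. Z i \<subset> Z (Suc i))}"
    unfolding chain_iff by blast
  then have "enat (generic_dim R C) \<le> krull_dim (subtopology T C)"
    unfolding krull_dim_def by (rule Sup_upper)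
  moreover have "krull_dim (subtopology T C) \<le> enat (generic_dim R C)"
    unfolding krull_dim_def chain_iff by (rule Sup_least) (use le in auto)
  ultimately show ?thesis by (rule antisym[rotated])
qed

lemma generic_point:
  assumes X: "X \<subseteq> pts (V k)" "prime_on R X" and f: "f \<in> R" "\<not> vanishes_on X f"
  obtains x where "x \<in> X" "f x \<noteq> 0" "functional.dim (point_derivs R X x) = generic_dim R X"
proof -
  obtain a J where J: "finite J" "generators R X a J" by (rule generators_bounded[OF X(1)])
  obtain w where w: "w \<in> R" "\<not> vanishes_on X w"
    "\<And>x. x \<in> X \<Longrightarrow> w x \<noteq> 0 \<Longrightarrow> functional.dim (point_derivs R X x) = generic_dim R X"
    using generic_dim_point[OF function_ring_R J(2,1) X(2)] by metis
  have "\<not> vanishes_on X (f * w)" by (rule prime_on_prod[OF X(2) f(2) w(2) f(1) w(1)])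
  then obtain x where "x \<in> X" "f x \<noteq> 0" "w x \<noteq> 0" by (auto simp: vanishes_on_def)
  then show thesis using that w(3) by blast
qed

end

lemma tangent_space_eq_point_derivs:
  assumes R: "function_ring (reg Y)" and x: "x \<in> pts Y"
    and sat: "\<And>f g. f \<in> reg Y \<Longrightarrow> (\<And>y. y \<in> pts Y \<Longrightarrow> f y = g y) \<Longrightarrow> g \<in> reg Y"
  shows "tangent_space Y x = point_derivs (reg Y) (pts Y) x"
proof -
  have van: "A f = 0" if A: "A \<in> tangent_space Y x" and f: "f \<in> reg Y" "vanishes_on (pts Y) f" for A f
  proof -
    \<comment> \<open>a function that vanishes on \<open>Y\<close> is a product of two such functions\<close>
    define e where "e = (\<lambda>y. if y \<in> pts Y then 0 else 1 :: 'b)"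
    have e: "e \<in> reg Y"
      by (rule sat[OF function_ring_const[OF R, of 0]]) (simp add: e_def)
    have eq: "(\<lambda>y. f y * e y) = f" using f(2) by (auto simp: fun_eq_iff e_def vanishes_on_def)
    have "A (\<lambda>y. f y * e y) = f x * A e + e x * A f"
      using A f(1) e unfolding tangent_space_def by blast
    moreover have "f x = 0" "e x = 0" using f(2) x by (simp_all add: e_def vanishes_on_def)
    ultimately show ?thesis unfolding eq by simp
  qed
  show ?thesis
  proof (intro equalityI subsetI)
    fix A assume A: "A \<in> tangent_space Y x"
    then show "A \<in> point_derivs (reg Y) (pts Y) x"
      using van[OF A] unfolding tangent_space_def point_derivs_def plus_fun_def times_fun_def by simp
  next
    fix A assume "A \<in> point_derivs (reg Y) (pts Y) x"
    then show "A \<in> tangent_space Y x"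
      unfolding tangent_space_def point_derivs_def plus_fun_def times_fun_def by simp
  qed
qed

context ind_variety_space
begin

section \<open>Tangent spaces and smooth points of bounded subsets\<close>

lemma closure_of_bounded: "X \<subseteq> pts (V k) \<Longrightarrow> T closure_of X \<subseteq> pts (V k)"
  by (rule closure_of_minimal[OF _ closedin_pts])

lemma vanishes_on_closure:
  assumes "X \<subseteq> ind_pts V" "f \<in> R" "vanishes_on X f" shows "vanishes_on (T closure_of X) f"
proof -
  have "X \<subseteq> zeros (ind_pts V) {f}" using assms by (auto simp: zeros_def vanishes_on_def)
  then have "T closure_of X \<subseteq> zeros (ind_pts V) {f}"
    using assms(2) by (intro closure_of_minimal closedin_zeros) auto
  then show ?thesis unfolding zeros_def vanishes_on_def by blast
qed

lemma closure_of_superset: "X \<subseteq> pts (V k) \<Longrightarrow> X \<subseteq> T closure_of X"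
  using pts_subset[of k] by (intro closure_of_subset) (simp add: topspace_T)

lemma point_derivs_closure:
  assumes "X \<subseteq> pts (V k)"
  shows "point_derivs R (T closure_of X) x = point_derivs R X x"
proof
  show "point_derivs R X x \<subseteq> point_derivs R (T closure_of X) x"
    by (rule point_derivs_mono[OF closure_of_superset[OF assms]])
  have "X \<subseteq> ind_pts V" using assms pts_subset by blast
  then show "point_derivs R (T closure_of X) x \<subseteq> point_derivs R X x"
    unfolding point_derivs_def using vanishes_on_closure[of X] by (intro Collect_mono) simp
qed

lemma tangent_space_subvariety:
  assumes C: "C \<subseteq> pts (V k)" and x: "x \<in> C"
  shows "differential R id ` tangent_space (subvariety (V k) C) x = point_derivs R C x"
proof -
  let ?S = "subvariety (V k) C"
  have regS: "reg ?S = {f. \<exists>g\<in>reg (V k). \<forall>x\<in>C. f x = g x}" and ptsS: "pts ?S = C"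
    by (simp_all add: subvariety_def)
  have R': "function_ring (reg ?S)"
    unfolding function_ring_def
  proof (intro conjI allI ballI)
    show "(\<lambda>_. c) \<in> reg ?S" for c
      unfolding regS using function_ring_const[OF function_ring_reg, of c k]
      by (intro CollectI bexI[of _ "\<lambda>_. c"]) auto
    fix f g assume "f \<in> reg ?S" "g \<in> reg ?S"
    then obtain f' g' where "f' \<in> reg (V k)" "\<forall>x\<in>C. f x = f' x" "g' \<in> reg (V k)" "\<forall>x\<in>C. g x = g' x"
      unfolding regS by blast
    then show "f + g \<in> reg ?S" "f * g \<in> reg ?S"
      unfolding regS mem_Collect_eq
      using function_ring_add[OF function_ring_reg, of f' k g'] function_ring_mult[OF function_ring_reg, of f' k g']
      by (intro bexI[of _ "f' + g'"], simp_all) (intro bexI[of _ "f' * g'"], simp_all)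
  qed
  have "tangent_space ?S x = point_derivs (reg ?S) C x"
    using tangent_space_eq_point_derivs[OF R'] x unfolding ptsS by (simp add: regS)
  moreover have "bij_betw (differential R id) (point_derivs (reg ?S) C x) (point_derivs R C x)"
  proof (rule point_derivs_change_ring[OF function_ring_R R' _ _ x])
    show "R \<subseteq> reg ?S" using R_subset_reg[of k] unfolding regS by blast
    fix f assume "f \<in> reg ?S"
    then obtain g where g: "g \<in> reg (V k)" "\<forall>x\<in>C. f x = g x" unfolding regS by blast
    obtain h where "h \<in> R" "\<And>x. x \<in> pts (V k) \<Longrightarrow> h x = g x" using ind_reg_extend[OF ind_var g(1)] by blast
    then show "\<exists>h\<in>R. \<forall>y\<in>C. f y = h y" using g(2) C by (intro bexI[of _ h]) auto
  qed
  ultimately show ?thesis unfolding bij_betw_def by simp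
qed

text \<open>Regular functions on the closure of \<open>X\<close> extend to the whole ind-variety, and a function
  that vanishes on \<open>X\<close> vanishes on its closure.  So neither the closure nor the member of the
  filtration matters.\<close>

lemma subset_tangent_space_eq:
  assumes X: "X \<subseteq> pts (V k)" and x: "x \<in> X"
  shows "subset_tangent_space V X x = point_derivs R X x"
proof -
  have "differential R id ` tangent_space (subvariety (V l) (T closure_of X)) x = point_derivs R X x"
    if "X \<subseteq> pts (V l)" for l
    using tangent_space_subvariety[OF closure_of_bounded[OF that]] closure_of_superset[OF that] x
      point_derivs_closure[OF that] by blast
  then show ?thesis unfolding subset_tangent_space_def using X by blast
qed

lemma ind_tangent_space_eq:
  "ind_tangent_space V x = (\<Union>k\<in>{k. x \<in> pts (V k)}. point_derivs R (pts (V k)) x)"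
proof -
  have "differential R id ` tangent_space (V k) x = point_derivs R (pts (V k)) x" if x: "x \<in> pts (V k)" for k
  proof -
    have "V k = subvariety (V k) (pts (V k))"
    proof (rule variety.equality)
      show "reg (V k) = reg (subvariety (V k) (pts (V k)))"
        using affine_variety_reg_cong[OF affine, of _ k] by (auto simp: subvariety_def)
    qed (simp_all add: subvariety_def)
    then show ?thesis using tangent_space_subvariety[OF order_refl x] by simp
  qed
  then show ?thesis unfolding ind_tangent_space_def by blast
qed

lemma smooth_points_iff:
  assumes X: "X \<subseteq> pts (V k)"
  shows "x \<in> smooth_points V X \<longleftrightarrow> x \<in> X \<and>
    enat (functional.dim (point_derivs R X x)) = local_dim (subtopology T X) x"
  unfolding smooth_points_def using subset_tangent_space_eq[OF X] by auto

text \<open>An irreducible subset of \<open>X\<close> that contains \<open>x\<close> is not contained in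
  \<open>Z\<close>, hence is contained in \<open>Y\<close>.\<close>

lemma irreducible_component_union:
  assumes X: "X = Y \<union> Z" "closedin (subtopology S X) Y" "closedin (subtopology S X) Z" and x: "x \<notin> Z"
  shows "irreducible_component (subtopology S X) W \<and> x \<in> W \<longleftrightarrow>
    irreducible_component (subtopology S Y) W \<and> x \<in> W"
proof -
  have irr: "irreducible_in (subtopology S X) W' \<longleftrightarrow> irreducible_in (subtopology S Y) W'" if "x \<in> W'" for W'
  proof
    assume W': "irreducible_in (subtopology S X) W'"
    then have "W' \<subseteq> Y \<union> Z" using X(1) unfolding irreducible_in_subtopology by blast
    then have "W' \<subseteq> Y" using irreducible_in_cases[OF W' X(2,3)] x that by blast
    then show "irreducible_in (subtopology S Y) W'" using W' unfolding irreducible_in_subtopology by blast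
  next
    assume "irreducible_in (subtopology S Y) W'"
    then show "irreducible_in (subtopology S X) W'" using X(1) unfolding irreducible_in_subtopology by blast
  qed
  show ?thesis unfolding irreducible_component_def using irr by blast
qed

lemma local_dim_union:
  assumes X: "X = Y \<union> Z" "closedin (subtopology S X) Y" "closedin (subtopology S X) Z" and x: "x \<notin> Z"
  shows "local_dim (subtopology S X) x = local_dim (subtopology S Y) x"
proof -
  have "subtopology (subtopology S X) W = subtopology (subtopology S Y) W"
    if "irreducible_component (subtopology S Y) W" for W
  proof -
    have "W \<subseteq> Y" using that unfolding irreducible_component_def irreducible_in_subtopology by blast
    then have "X \<inter> W = W" "Y \<inter> W = W" using X(1) by blast+
    then show ?thesis unfolding subtopology_subtopology by simp
  qed
  then have "{krull_dim (subtopology (subtopology S X) W) | W. irreducible_component (subtopology S X) W \<and> x \<in> W} =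
     {krull_dim (subtopology (subtopology S Y) W) | W. irreducible_component (subtopology S Y) W \<and> x \<in> W}"
    unfolding irreducible_component_union[OF X x] by metis
  then show ?thesis unfolding local_dim_def by simp
qed

text \<open>As \<open>Z\<close> is closed and avoids \<open>x\<close>, some function vanishes on \<open>Z\<close> but
  not at \<open>x\<close>.\<close>

lemma point_derivs_union:
  assumes X: "X = Y \<union> Z" and Z: "rel_closed X Z" and x: "x \<in> Y" "x \<notin> Z"
  shows "point_derivs R X x = point_derivs R Y x"
proof -
  obtain F where F: "F \<subseteq> R" "Z = zeros X F" using Z unfolding rel_closed_def by blast
  obtain f where f: "f \<in> F" "f x \<noteq> 0" using x X unfolding F(2) zeros_def by blast
  have van: "vanishes_on Z f" using f(1) unfolding F(2) zeros_def vanishes_on_def by blast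
  show ?thesis
    by (rule point_derivs_local[OF _ f(2) van _ function_ring_R _ x(1)]) (use X f F in auto)
qed

lemma smooth_points_union:
  assumes X: "X = Y \<union> Z" "X \<subseteq> pts (V k)" and Y: "rel_closed X Y" and Z: "rel_closed X Z"
    and x: "x \<in> Y" "x \<notin> Z"
  shows "x \<in> smooth_points V X \<longleftrightarrow> x \<in> smooth_points V Y"
proof -
  have "Y \<subseteq> pts (V k)" using X by blast
  moreover have "local_dim (subtopology T X) x = local_dim (subtopology T Y) x"
    using Y Z by (intro local_dim_union[OF X(1)] x) (simp_all add: closedin_subtopology_iff[OF X(2)])
  ultimately show ?thesis
    using smooth_points_iff[OF X(2), of x] smooth_points_iff[of Y k x]
      point_derivs_union[OF X(1) Z x] x X(1) by auto
qed

lemma local_dim_irreducible: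
  assumes X: "rel_closed (pts (V k)) X" "prime_on R X" and x: "x \<in> X"
  shows "local_dim (subtopology T X) x = enat (generic_dim R X)"
proof -
  have XV: "X \<subseteq> pts (V k)" by (rule rel_closed_subset[OF X(1)])
  have irr: "irreducible_in T X" using irreducible_iff_prime[OF XV] X(2) by blast
  have "irreducible_component (subtopology T X) Z \<and> x \<in> Z \<longleftrightarrow> Z = X" for Z
    unfolding irreducible_component_def irreducible_in_subtopology using irr x by blast
  then have "{krull_dim (subtopology (subtopology T X) Z) | Z. irreducible_component (subtopology T X) Z \<and> x \<in> Z} =
      {krull_dim (subtopology T X)}"
    by (simp add: subtopology_subtopology)
  then show ?thesis unfolding local_dim_def by (simp add: krull_dim_eq_generic_dim[OF X])
qed

lemma smooth_point_irreducible:
  assumes X: "rel_closed (pts (V k)) X" "prime_on R X" and f: "f \<in> R" "\<not> vanishes_on X f"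
  obtains x where "x \<in> smooth_points V X" "f x \<noteq> 0"
    "functional.dim (point_derivs R X x) = generic_dim R X"
proof -
  have XV: "X \<subseteq> pts (V k)" by (rule rel_closed_subset[OF X(1)])
  obtain x where x: "x \<in> X" "f x \<noteq> 0" "functional.dim (point_derivs R X x) = generic_dim R X"
    using generic_point[OF XV X(2) f] .
  then have "x \<in> smooth_points V X"
    using smooth_points_iff[OF XV] local_dim_irreducible[OF X x(1)] by simp
  then show thesis using that x by blast
qed

text \<open>The union of the irreducible pieces that are not contained in a maximal one, \<open>D\<close>, does not
  contain \<open>D\<close>.  At a general point of \<open>D\<close> outside this union \<open>X\<close> coincides
  with \<open>D\<close>, and the tangent space has the generic dimension, which is the Krull dimension of
  \<open>D\<close>.\<close>

lemma smooth_point_exists: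
  assumes X: "rel_closed (pts (V k)) X" and ne: "X \<noteq> {}"
  obtains x where "x \<in> smooth_points V X"
proof -
  have XV: "X \<subseteq> pts (V k)" by (rule rel_closed_subset[OF X])
  obtain \<D> where \<D>: "finite \<D>" "X = \<Union>\<D>" "\<And>D. D \<in> \<D> \<Longrightarrow> rel_closed X D \<and> prime_on R D"
    using irreducible_decomposition[OF XV rel_closed_self] by metis
  have "\<D> \<noteq> {}" using ne \<D>(2) by blast
  then obtain D where D: "D \<in> \<D>" and max: "\<And>E. E \<in> \<D> \<Longrightarrow> D \<subseteq> E \<Longrightarrow> D = E"
    using finite_has_maximal[OF \<D>(1)] by metis
  let ?\<E> = "{E \<in> \<D>. \<not> E \<subseteq> D}"
  have prime: "prime_on R D" and Dcl: "rel_closed X D" using \<D>(3) D by blast+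
  have "\<forall>E\<in>?\<E>. \<exists>f. f \<in> R \<and> vanishes_on E f \<and> \<not> vanishes_on D f"
  proof
    fix E assume E: "E \<in> ?\<E>"
    then obtain F where F: "F \<subseteq> R" "E = zeros X F" using \<D>(3) unfolding rel_closed_def by blast
    have "\<not> D \<subseteq> E" using max E by blast
    then obtain y where y: "y \<in> D" "y \<notin> E" by blast
    moreover have "y \<in> X" using y(1) D \<D>(2) by blast
    ultimately obtain f where f: "f \<in> F" "f y \<noteq> 0" unfolding F(2) zeros_def by blast
    have "vanishes_on E f" using f(1) unfolding F(2) zeros_def vanishes_on_def by blast
    moreover have "\<not> vanishes_on D f" using y f(2) unfolding vanishes_on_def by blast
    ultimately show "\<exists>f. f \<in> R \<and> vanishes_on E f \<and> \<not> vanishes_on D f" using f(1) F(1) by blast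
  qed
  from bchoice[OF this] obtain f where
    f: "\<forall>E\<in>?\<E>. f E \<in> R \<and> vanishes_on E (f E) \<and> \<not> vanishes_on D (f E)" ..
  have prod: "prod f \<E> \<in> R \<and> (\<forall>E\<in>\<E>. vanishes_on E (prod f \<E>)) \<and> \<not> vanishes_on D (prod f \<E>)"
    if "finite \<E>" "\<E> \<subseteq> ?\<E>" for \<E>
    using that
  proof (induction \<E> rule: finite_induct)
    case empty
    have "D \<noteq> {}" using prime unfolding prime_on_def by blast
    then show ?case
      using function_ring_const[OF function_ring_R, of 1] by (auto simp: vanishes_on_def one_fun_def)
  next
    case (insert E \<E>)
    then have IH: "prod f \<E> \<in> R" "\<forall>E\<in>\<E>. vanishes_on E (prod f \<E>)" "\<not> vanishes_on D (prod f \<E>)"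
      by blast+
    have fE: "f E \<in> R" "vanishes_on E (f E)" "\<not> vanishes_on D (f E)" using f insert.prems by blast+
    have eq: "prod f (insert E \<E>) = f E * prod f \<E>" using insert.hyps by (rule prod.insert)
    have "f E * prod f \<E> \<in> R" by (rule function_ring_mult[OF function_ring_R fE(1) IH(1)])
    moreover have "\<not> vanishes_on D (f E * prod f \<E>)"
      by (rule prime_on_prod[OF prime fE(3) IH(3) fE(1) IH(1)])
    moreover have "vanishes_on E' (f E * prod f \<E>)" if "E' \<in> insert E \<E>" for E'
      using that fE(2) IH(2) by (auto simp: vanishes_on_def)
    ultimately show ?case unfolding eq by blast
  qed
  define g where "g = prod f ?\<E>"
  have g: "g \<in> R" "\<not> vanishes_on D g" and gE: "\<And>E. E \<in> ?\<E> \<Longrightarrow> vanishes_on E g"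
    using prod[of ?\<E>] \<D>(1) unfolding g_def by auto
  have Dk: "rel_closed (pts (V k)) D" by (rule rel_closed_trans[OF X Dcl])
  obtain x where x: "x \<in> smooth_points V D" "g x \<noteq> 0"
    using smooth_point_irreducible[OF Dk prime g] by metis
  have xD: "x \<in> D" using x(1) unfolding smooth_points_def by blast
  let ?Y = "\<Union>?\<E>"
  have XDY: "X = D \<union> ?Y" using \<D>(2) D by blast
  have Y: "rel_closed X ?Y" by (rule rel_closed_Union[OF XV]) (use \<D>(1,3) in simp_all)
  have "x \<notin> ?Y" using gE x(2) unfolding vanishes_on_def by blast
  then have "x \<in> smooth_points V X"
    using smooth_points_union[OF XDY XV Dcl Y xD] x(1) by blast
  then show thesis by (rule that)
qed

section \<open>Automorphisms\<close>

text \<open>An automorphism \<open>\<phi>\<close> of the ind-variety together with its inverse \<open>\<psi>\<close>.\<close>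

definition automorphism :: "('a \<Rightarrow> 'a) \<Rightarrow> ('a \<Rightarrow> 'a) \<Rightarrow> bool" where
  "automorphism \<phi> \<psi> \<longleftrightarrow>
     (\<forall>x\<in>ind_pts V. \<phi> x \<in> ind_pts V \<and> \<psi> x \<in> ind_pts V \<and> \<psi> (\<phi> x) = x \<and> \<phi> (\<psi> x) = x) \<and>
     (\<forall>f\<in>R. f \<circ> \<phi> \<in> R \<and> f \<circ> \<psi> \<in> R) \<and>
     (\<forall>k. \<exists>l. \<phi> ` pts (V k) \<subseteq> pts (V l) \<and> \<psi> ` pts (V k) \<subseteq> pts (V l))"

lemma automorphism_sym: "automorphism \<phi> \<psi> \<Longrightarrow> automorphism \<psi> \<phi>"
  unfolding automorphism_def by blast

lemma automorphismD:
  assumes "automorphism \<phi> \<psi>"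
  shows "x \<in> ind_pts V \<Longrightarrow> \<phi> x \<in> ind_pts V" "x \<in> ind_pts V \<Longrightarrow> \<psi> x \<in> ind_pts V"
    "x \<in> ind_pts V \<Longrightarrow> \<psi> (\<phi> x) = x" "x \<in> ind_pts V \<Longrightarrow> \<phi> (\<psi> x) = x"
    "f \<in> R \<Longrightarrow> f \<circ> \<phi> \<in> R" "f \<in> R \<Longrightarrow> f \<circ> \<psi> \<in> R"
  using assms unfolding automorphism_def by blast+

lemma automorphism_bounded:
  assumes "automorphism \<phi> \<psi>" "X \<subseteq> pts (V k)"
  obtains l where "\<phi> ` X \<subseteq> pts (V l)"
proof -
  obtain l where "\<phi> ` pts (V k) \<subseteq> pts (V l)" using assms(1) unfolding automorphism_def by blast
  then show thesis using that assms(2) by blast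
qed

lemma automorphism_inj: "automorphism \<phi> \<psi> \<Longrightarrow> X \<subseteq> ind_pts V \<Longrightarrow> inj_on \<phi> X"
  by (rule inj_on_inverseI[of _ \<psi>]) (use automorphismD(3) in blast)

lemma automorphism_image_image:
  assumes "automorphism \<phi> \<psi>" "X \<subseteq> ind_pts V" shows "\<psi> ` \<phi> ` X = X"
proof -
  have "\<psi> (\<phi> x) = x" if "x \<in> X" for x using automorphismD(3)[OF assms(1)] assms(2) that by blast
  then show ?thesis unfolding image_image by simp
qed

lemma automorphism_image_Int:
  assumes "automorphism \<phi> \<psi>" "X \<subseteq> ind_pts V" "Y \<subseteq> ind_pts V"
  shows "\<phi> ` (X \<inter> Y) = \<phi> ` X \<inter> \<phi> ` Y"
  by (rule inj_on_image_Int[OF automorphism_inj[OF assms(1) order_refl] assms(2,3)])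

lemma automorphism_closedin:
  assumes a: "automorphism \<phi> \<psi>" and C: "closedin T C" shows "closedin T (\<phi> ` C)"
proof -
  have CP: "C \<subseteq> ind_pts V" using closedin_subset[OF C] topspace_T by simp
  have img: "\<phi> ` C = {y \<in> ind_pts V. \<psi> y \<in> C}"
  proof (intro equalityI subsetI)
    fix y assume "y \<in> \<phi> ` C"
    then obtain c where c: "y = \<phi> c" "c \<in> C" by (rule imageE)
    then have "c \<in> ind_pts V" using CP by blast
    then show "y \<in> {y \<in> ind_pts V. \<psi> y \<in> C}" using automorphismD(1,3)[OF a, of c] c by simp
  next
    fix y assume y: "y \<in> {y \<in> ind_pts V. \<psi> y \<in> C}"
    then have "y = \<phi> (\<psi> y)" using automorphismD(4)[OF a, of y] by simp
    then show "y \<in> \<phi> ` C" using y by blast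
  qed
  show ?thesis
    unfolding closedin_iff
  proof (intro conjI allI)
    show "\<phi> ` C \<subseteq> ind_pts V" unfolding img by blast
    fix k
    obtain l where l: "\<psi> ` pts (V k) \<subseteq> pts (V l)" using a unfolding automorphism_def by blast
    obtain F where F: "F \<subseteq> R" "pts (V l) \<inter> C = zeros (pts (V l)) F"
      using C unfolding closedin_iff rel_closed_def by blast
    have "pts (V k) \<inter> \<phi> ` C = zeros (pts (V k)) ((\<lambda>f. f \<circ> \<psi>) ` F)"
    proof (intro equalityI subsetI)
      fix y assume y: "y \<in> pts (V k) \<inter> \<phi> ` C"
      then have "\<psi> y \<in> pts (V l) \<inter> C" using l img by blast
      then have "\<psi> y \<in> zeros (pts (V l)) F" using F(2) by simp
      then show "y \<in> zeros (pts (V k)) ((\<lambda>f. f \<circ> \<psi>) ` F)" using y by (simp add: zeros_def)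
    next
      fix y assume y: "y \<in> zeros (pts (V k)) ((\<lambda>f. f \<circ> \<psi>) ` F)"
      then have yk: "y \<in> pts (V k)" by (simp add: zeros_def)
      then have "\<psi> y \<in> zeros (pts (V l)) F" using y l by (auto simp: zeros_def)
      then have "\<psi> y \<in> C" using F(2) by blast
      then show "y \<in> pts (V k) \<inter> \<phi> ` C" using yk pts_subset[of k] unfolding img by blast
    qed
    moreover have "(\<lambda>f. f \<circ> \<psi>) ` F \<subseteq> R" using F(1) automorphismD(6)[OF a] by blast
    ultimately show "rel_closed (pts (V k)) (pts (V k) \<inter> \<phi> ` C)" unfolding rel_closed_def by blast
  qed
qed

lemma automorphism_irreducible:
  assumes a: "automorphism \<phi> \<psi>" and Z: "irreducible_in T Z"
  shows "irreducible_in T (\<phi> ` Z)"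
proof (rule irreducible_inI)
  have ZP: "Z \<subseteq> ind_pts V" using irreducible_in_subset[OF Z] topspace_T by simp
  show "\<phi> ` Z \<subseteq> topspace T" using ZP automorphismD(1)[OF a] unfolding topspace_T by blast
  show "\<phi> ` Z \<noteq> {}" using irreducible_in_nonempty[OF Z] by simp
  fix C D assume CD: "closedin T C" "closedin T D" "\<phi> ` Z \<subseteq> C \<union> D"
  have CP: "C \<subseteq> ind_pts V" "D \<subseteq> ind_pts V" using closedin_subset CD(1,2) topspace_T by blast+
  have "\<psi> ` \<phi> ` Z \<subseteq> \<psi> ` C \<union> \<psi> ` D" using CD(3) by blast
  then have "Z \<subseteq> \<psi> ` C \<union> \<psi> ` D" unfolding automorphism_image_image[OF a ZP] .
  then have "Z \<subseteq> \<psi> ` C \<or> Z \<subseteq> \<psi> ` D"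
    using automorphism_closedin[OF automorphism_sym[OF a]] CD by (intro irreducible_in_cases[OF Z]) auto
  then have "\<phi> ` Z \<subseteq> \<phi> ` \<psi> ` C \<or> \<phi> ` Z \<subseteq> \<phi> ` \<psi> ` D" by blast
  then show "\<phi> ` Z \<subseteq> C \<or> \<phi> ` Z \<subseteq> D"
    unfolding automorphism_image_image[OF automorphism_sym[OF a] CP(1)]
      automorphism_image_image[OF automorphism_sym[OF a] CP(2)] .
qed

lemma automorphism_closedin_subtopology:
  assumes a: "automorphism \<phi> \<psi>" and X: "X \<subseteq> ind_pts V" and C: "closedin (subtopology T X) C"
  shows "closedin (subtopology T (\<phi> ` X)) (\<phi> ` C)"
proof -
  obtain D where D: "closedin T D" "C = D \<inter> X" using C unfolding closedin_subtopology by (elim exE conjE)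
  have "D \<subseteq> ind_pts V" using closedin_subset[OF D(1)] topspace_T by simp
  then have "\<phi> ` C = \<phi> ` D \<inter> \<phi> ` X" unfolding D(2) by (rule automorphism_image_Int[OF a _ X])
  then show ?thesis
    unfolding closedin_subtopology using automorphism_closedin[OF a D(1)] by (intro exI[of _ "\<phi> ` D"] conjI)
qed

lemma automorphism_krull_dim_le:
  assumes a: "automorphism \<phi> \<psi>" and X: "X \<subseteq> ind_pts V"
  shows "krull_dim (subtopology T X) \<le> krull_dim (subtopology T (\<phi> ` X))"
  unfolding krull_dim_def
proof (rule Sup_subset_mono, clarify)
  fix n and Z :: "nat \<Rightarrow> 'a set"
  assume Z: "\<forall>i\<le>n. closedin (subtopology T X) (Z i) \<and> irreducible_in (subtopology T X) (Z i)"
    and strict: "\<forall>i<n. Z i \<subset> Z (Suc i)"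
  have ZX: "Z i \<subseteq> X" if "i \<le> n" for i
    using Z that unfolding irreducible_in_subtopology by blast
  have "closedin (subtopology T (\<phi> ` X)) (\<phi> ` Z i) \<and> irreducible_in (subtopology T (\<phi> ` X)) (\<phi> ` Z i)"
    if i: "i \<le> n" for i
  proof
    show "closedin (subtopology T (\<phi> ` X)) (\<phi> ` Z i)"
      using Z i by (intro automorphism_closedin_subtopology[OF a X]) blast
    show "irreducible_in (subtopology T (\<phi> ` X)) (\<phi> ` Z i)"
      using Z i automorphism_irreducible[OF a, of "Z i"] unfolding irreducible_in_subtopology by blast
  qed
  moreover have "\<phi> ` Z i \<subset> \<phi> ` Z (Suc i)" if i: "i < n" for i
  proof -
    have "inj_on \<phi> (Z (Suc i))" using ZX[of "Suc i"] X i by (intro automorphism_inj[OF a]) auto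
    moreover have "Z i \<subset> Z (Suc i)" using strict i by blast
    ultimately show ?thesis using inj_on_image_eq_iff[of \<phi> "Z (Suc i)" "Z i" "Z (Suc i)"] by blast
  qed
  ultimately show "\<exists>n'. enat n = enat n' \<and> (\<exists>Z. (\<forall>i\<le>n'. closedin (subtopology T (\<phi> ` X)) (Z i) \<and>
      irreducible_in (subtopology T (\<phi> ` X)) (Z i)) \<and> (\<forall>i<n'. Z i \<subset> Z (Suc i)))"
    by (intro exI[of _ n] exI[of _ "\<lambda>i. \<phi> ` Z i"] conjI) auto
qed

lemma automorphism_irreducible_component:
  assumes a: "automorphism \<phi> \<psi>" and X: "X \<subseteq> ind_pts V"
    and W: "irreducible_component (subtopology T X) W"
  shows "irreducible_component (subtopology T (\<phi> ` X)) (\<phi> ` W)"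
proof -
  have irr: "W \<subseteq> X" "irreducible_in T W"
    using W unfolding irreducible_component_def irreducible_in_subtopology by blast+
  have "W' = \<phi> ` W" if W': "W' \<subseteq> \<phi> ` X" "irreducible_in T W'" "\<phi> ` W \<subseteq> W'" for W'
  proof -
    have P: "W' \<subseteq> ind_pts V" "W \<subseteq> ind_pts V" using irreducible_in_subset[OF W'(2)] irr(1) X topspace_T by auto
    have "\<psi> ` W' \<subseteq> \<psi> ` \<phi> ` X" "\<psi> ` \<phi> ` W \<subseteq> \<psi> ` W'" using W'(1,3) by blast+
    then have "\<psi> ` W' \<subseteq> X" "W \<subseteq> \<psi> ` W'"
      unfolding automorphism_image_image[OF a X] automorphism_image_image[OF a P(2)] .
    moreover have "irreducible_in T (\<psi> ` W')"
      by (rule automorphism_irreducible[OF automorphism_sym[OF a] W'(2)])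
    ultimately have "\<psi> ` W' = W"
      using W unfolding irreducible_component_def irreducible_in_subtopology by blast
    then show ?thesis using automorphism_image_image[OF automorphism_sym[OF a] P(1)] by simp
  qed
  then show ?thesis
    using irr automorphism_irreducible[OF a irr(2)]
    unfolding irreducible_component_def irreducible_in_subtopology by blast
qed

lemma automorphism_local_dim_le:
  assumes a: "automorphism \<phi> \<psi>" and X: "X \<subseteq> ind_pts V"
  shows "local_dim (subtopology T X) x \<le> local_dim (subtopology T (\<phi> ` X)) (\<phi> x)"
  unfolding local_dim_def
proof (rule Sup_mono, clarify)
  fix W assume W: "irreducible_component (subtopology T X) W" "x \<in> W"
  have WX: "W \<subseteq> X" using W(1) unfolding irreducible_component_def irreducible_in_subtopology by blast
  have "krull_dim (subtopology (subtopology T X) W) = krull_dim (subtopology T W)"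
    using WX by (simp add: subtopology_subtopology Int_absorb1)
  also have "\<dots> \<le> krull_dim (subtopology T (\<phi> ` W))"
    by (rule automorphism_krull_dim_le[OF a]) (use WX X in blast)
  also have "\<dots> = krull_dim (subtopology (subtopology T (\<phi> ` X)) (\<phi> ` W))"
    using image_mono[OF WX, of \<phi>] by (simp add: subtopology_subtopology Int_absorb1)
  finally show "\<exists>d\<in>{krull_dim (subtopology (subtopology T (\<phi> ` X)) W) |W.
      irreducible_component (subtopology T (\<phi> ` X)) W \<and> \<phi> x \<in> W}.
      krull_dim (subtopology (subtopology T X) W) \<le> d"
    using automorphism_irreducible_component[OF a X W(1)] W(2) by blast
qed

lemma automorphism_local_dim:
  assumes a: "automorphism \<phi> \<psi>" and X: "X \<subseteq> ind_pts V" and x: "x \<in> ind_pts V"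
  shows "local_dim (subtopology T (\<phi> ` X)) (\<phi> x) = local_dim (subtopology T X) x"
proof (rule antisym)
  have "\<phi> ` X \<subseteq> ind_pts V" using X automorphismD(1)[OF a] by blast
  from automorphism_local_dim_le[OF automorphism_sym[OF a] this, of "\<phi> x"]
  show "local_dim (subtopology T (\<phi> ` X)) (\<phi> x) \<le> local_dim (subtopology T X) x"
    unfolding automorphism_image_image[OF a X] automorphismD(3)[OF a x] .
qed (rule automorphism_local_dim_le[OF a X])

lemma differential_point_derivs:
  assumes \<phi>: "\<And>f. f \<in> R \<Longrightarrow> f \<circ> \<phi> \<in> R" and A: "A \<in> point_derivs R X x"
  shows "differential R \<phi> A \<in> point_derivs R (\<phi> ` X) (\<phi> x)"
  unfolding point_derivs_def
proof (intro CollectI conjI allI ballI impI)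
  fix f g assume f: "f \<in> R" and g: "g \<in> R"
  have "(f + g) \<circ> \<phi> = (f \<circ> \<phi>) + (g \<circ> \<phi>)" "(f * g) \<circ> \<phi> = (f \<circ> \<phi>) * (g \<circ> \<phi>)"
    by (simp_all add: fun_eq_iff)
  then show "differential R \<phi> A (f + g) = differential R \<phi> A f + differential R \<phi> A g"
    and "differential R \<phi> A (f * g) = f (\<phi> x) * differential R \<phi> A g + g (\<phi> x) * differential R \<phi> A f"
    using f g \<phi> function_ringD[OF function_ring_R] point_derivs_add[OF A \<phi>[OF f] \<phi>[OF g]]
      point_derivs_mult[OF A \<phi>[OF f] \<phi>[OF g]] by (simp_all add: differential_def)
next
  fix c f assume f: "f \<in> R"
  have "(\<lambda>y. c * f y) \<circ> \<phi> = (\<lambda>y. c * (f \<circ> \<phi>) y)" by (simp add: fun_eq_iff)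
  then show "differential R \<phi> A (\<lambda>y. c * f y) = c * differential R \<phi> A f"
    using f function_ring_scale[OF function_ring_R f, of c] point_derivs_scale[OF A \<phi>[OF f], of c]
    by (simp add: differential_def)
next
  fix f assume f: "f \<in> R" "vanishes_on (\<phi> ` X) f"
  then have "A (f \<circ> \<phi>) = 0" by (intro point_derivs_vanish[OF A \<phi>]) (auto simp: vanishes_on_def)
  then show "differential R \<phi> A f = 0" by (simp add: differential_def)
qed (simp add: differential_def)

lemma differential_inverse:
  assumes a: "automorphism \<phi> \<psi>" and X: "X \<subseteq> ind_pts V" and A: "A \<in> point_derivs R X x"
  shows "differential R \<psi> (differential R \<phi> A) = A"
proof
  fix f show "differential R \<psi> (differential R \<phi> A) f = A f"
  proof (cases "f \<in> R")
    case True
    have "A ((f \<circ> \<psi>) \<circ> \<phi>) = A f"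
      using True X automorphismD[OF a] by (intro point_derivs_cong[OF function_ring_R A]) auto
    then show ?thesis using True automorphismD(6)[OF a] by (simp add: differential_def)
  qed (simp add: differential_def point_derivs_outside[OF A])
qed

lemma automorphism_point_derivs:
  assumes a: "automorphism \<phi> \<psi>" and X: "X \<subseteq> ind_pts V" and x: "x \<in> ind_pts V"
  shows "differential R \<phi> ` point_derivs R X x = point_derivs R (\<phi> ` X) (\<phi> x)"
    and "inj_on (differential R \<phi>) (point_derivs R X x)"
proof -
  show "inj_on (differential R \<phi>) (point_derivs R X x)"
    by (rule inj_on_inverseI[of _ "differential R \<psi>"]) (rule differential_inverse[OF a X])
  show "differential R \<phi> ` point_derivs R X x = point_derivs R (\<phi> ` X) (\<phi> x)"
  proof (intro equalityI subsetI)
    fix B assume B: "B \<in> point_derivs R (\<phi> ` X) (\<phi> x)"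
    have "differential R \<psi> B \<in> point_derivs R (\<psi> ` \<phi> ` X) (\<psi> (\<phi> x))"
      by (rule differential_point_derivs[OF automorphismD(6)[OF a] B])
    then have "differential R \<psi> B \<in> point_derivs R X x"
      unfolding automorphism_image_image[OF a X] automorphismD(3)[OF a x] .
    moreover have "differential R \<phi> (differential R \<psi> B) = B"
      by (rule differential_inverse[OF automorphism_sym[OF a] _ B])
        (use X automorphismD(1)[OF a] in blast)
    ultimately show "B \<in> differential R \<phi> ` point_derivs R X x" by (metis imageI)
  qed (use differential_point_derivs[OF automorphismD(5)[OF a]] in blast)
qed

lemma automorphism_smooth:
  assumes a: "automorphism \<phi> \<psi>" and X: "X \<subseteq> pts (V k)" and x: "x \<in> smooth_points V X"
  shows "\<phi> x \<in> smooth_points V (\<phi> ` X)"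
proof -
  obtain l where l: "\<phi> ` X \<subseteq> pts (V l)" using automorphism_bounded[OF a X] .
  have xX: "x \<in> X" using x unfolding smooth_points_def by blast
  have P: "X \<subseteq> ind_pts V" "x \<in> ind_pts V" using X xX pts_subset by blast+
  have "functional.dim (point_derivs R (\<phi> ` X) (\<phi> x)) = functional.dim (point_derivs R X x)"
    using dim_differential[OF subspace_point_derivs[OF function_ring_R] automorphism_point_derivs(2)[OF a P]]
    unfolding automorphism_point_derivs(1)[OF a P] .
  then show ?thesis
    using x xX unfolding smooth_points_iff[OF X] smooth_points_iff[OF l] automorphism_local_dim[OF a P]
    by simp
qed

lemma automorphism_algebraic_subset:
  assumes a: "automorphism \<phi> \<psi>" and X: "algebraic_subset V X"
  shows "algebraic_subset V (\<phi> ` X)"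
proof -
  obtain k where k: "X \<subseteq> pts (V k)" using X unfolding algebraic_subset_def bounded_subset_def by blast
  obtain l where l: "\<phi> ` X \<subseteq> pts (V l)" using automorphism_bounded[OF a k] .
  obtain U C where U: "openin T U" and C: "closedin T C" and eq: "X = U \<inter> C"
    using X unfolding algebraic_subset_def locally_closed_in_def by blast
  have P: "U \<subseteq> ind_pts V" "C \<subseteq> ind_pts V"
    using openin_subset[OF U] closedin_subset[OF C] topspace_T by auto
  have cl: "closedin T (\<phi> ` (ind_pts V - U))"
    using U by (intro automorphism_closedin[OF a]) (simp add: openin_closedin_eq topspace_T)
  have surj: "\<phi> ` ind_pts V = ind_pts V"
  proof
    show "\<phi> ` ind_pts V \<subseteq> ind_pts V" using automorphismD(1)[OF a] by blast
    show "ind_pts V \<subseteq> \<phi> ` ind_pts V"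
      using automorphismD(2,4)[OF a] by (metis image_eqI subsetI)
  qed
  have "\<phi> ` U = ind_pts V - \<phi> ` (ind_pts V - U)"
    using inj_on_image_set_diff[OF automorphism_inj[OF a order_refl], of "ind_pts V" "ind_pts V - U"] P(1)
    by (simp add: surj double_diff)
  then have "openin T (\<phi> ` U)" using openin_diff[OF openin_topspace cl] topspace_T by simp
  moreover have "\<phi> ` X = \<phi> ` U \<inter> \<phi> ` C" unfolding eq by (rule automorphism_image_Int[OF a P])
  ultimately show ?thesis
    using l automorphism_closedin[OF a C]
    unfolding algebraic_subset_def bounded_subset_def locally_closed_in_def by blast
qed

end

section \<open>Translations in an ind-group\<close>

lemma (in ind_variety_space) automorphism_comp:
  assumes a: "automorphism \<phi> \<psi>" and b: "automorphism \<phi>' \<psi>'"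
  shows "automorphism (\<phi> \<circ> \<phi>') (\<psi>' \<circ> \<psi>)"
  unfolding automorphism_def
proof (intro conjI ballI allI)
  fix x assume x: "x \<in> ind_pts V"
  show "(\<phi> \<circ> \<phi>') x \<in> ind_pts V" "(\<psi>' \<circ> \<psi>) x \<in> ind_pts V" "(\<psi>' \<circ> \<psi>) ((\<phi> \<circ> \<phi>') x) = x" "(\<phi> \<circ> \<phi>') ((\<psi>' \<circ> \<psi>) x) = x"
    using x automorphismD(1-4)[OF a] automorphismD(1-4)[OF b] by simp_all
next
  fix f assume f: "f \<in> R"
  show "f \<circ> (\<phi> \<circ> \<phi>') \<in> R" "f \<circ> (\<psi>' \<circ> \<psi>) \<in> R"
    unfolding o_assoc by (intro automorphismD(5)[OF b] automorphismD(5)[OF a] f)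
      (intro automorphismD(6)[OF b] automorphismD(6)[OF a] f)
next
  fix k
  obtain l where l: "\<phi>' ` pts (V k) \<subseteq> pts (V l)" "\<psi> ` pts (V k) \<subseteq> pts (V l)"
  proof -
    obtain l1 where "\<phi>' ` pts (V k) \<subseteq> pts (V l1)" using automorphism_bounded[OF b order_refl] .
    moreover obtain l2 where "\<psi> ` pts (V k) \<subseteq> pts (V l2)"
      using automorphism_bounded[OF automorphism_sym[OF a] order_refl] .
    ultimately show thesis
      using that[of "max l1 l2"] pts_mono[of l1 "max l1 l2"] pts_mono[of l2 "max l1 l2"] by auto
  qed
  obtain m1 where m1: "\<phi> ` pts (V l) \<subseteq> pts (V m1)" using automorphism_bounded[OF a order_refl] .
  obtain m2 where m2: "\<psi>' ` pts (V l) \<subseteq> pts (V m2)"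
    using automorphism_bounded[OF automorphism_sym[OF b] order_refl] .
  show "\<exists>m. (\<phi> \<circ> \<phi>') ` pts (V k) \<subseteq> pts (V m) \<and> (\<psi>' \<circ> \<psi>) ` pts (V k) \<subseteq> pts (V m)"
    using l m1 m2 pts_mono[of m1 "max m1 m2"] pts_mono[of m2 "max m1 m2"]
    by (intro exI[of _ "max m1 m2"]) (force simp: image_subset_iff)
qed

lemma (in ind_variety_space) R_memI:
  assumes "\<And>k. \<exists>K\<ge>k. \<exists>g\<in>R. \<forall>x\<in>pts (V K). h x = g x"
  shows "h \<in> R"
  unfolding ind_reg_def
proof
  fix k
  obtain K g where "k \<le> K" "g \<in> R" "\<forall>x\<in>pts (V K). h x = g x" using assms[of k] by blast
  then show "h \<in> reg (V k)"
    using pts_mono[of k K] R_subset_reg[of k]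
    by (intro affine_variety_reg_cong[OF affine, of g k h]) auto
qed

sublocale ind_group \<subseteq> ind_variety_space V
  by unfold_locales (rule ind_variety)

context ind_group
begin

lemma in_carrier: "x \<in> pts (V k) \<Longrightarrow> x \<in> carrier G"
  unfolding carrier_eq ind_pts_def by blast

lemma in_pts:
  assumes "x \<in> carrier G" obtains k where "x \<in> pts (V k)"
  using assms unfolding carrier_eq ind_pts_def by blast

lemma mult_bounded:
  obtains l where "\<And>x y. x \<in> pts (V k) \<Longrightarrow> y \<in> pts (V k) \<Longrightarrow> x \<otimes> y \<in> pts (V l)"
proof -
  obtain l where "variety_morphism (prod_variety (V k) (V k)) (V l) (\<lambda>(x, y). x \<otimes> y)"
    using mult_morphism unfolding ind_morphism_def ind_prod_def by blast
  then have "(\<lambda>(x, y). x \<otimes> y) ` (pts (V k) \<times> pts (V k)) \<subseteq> pts (V l)"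
    unfolding variety_morphism_def prod_variety_def by simp
  then show thesis using that[of l] by blast
qed

lemma inv_bounded: obtains l where "\<And>x. x \<in> pts (V k) \<Longrightarrow> inv x \<in> pts (V l)"
proof -
  obtain l where "variety_morphism (V k) (V l) (\<lambda>x. inv x)"
    using inv_morphism unfolding ind_morphism_def by blast
  then show thesis using that[of l] unfolding variety_morphism_def by blast
qed

lemma mult_decompose:
  assumes f: "f \<in> R"
  obtains n a b where "\<And>i::nat. i < n \<Longrightarrow> a i \<in> R" "\<And>i. i < n \<Longrightarrow> b i \<in> R"
    "\<And>x y. x \<in> pts (V k) \<Longrightarrow> y \<in> pts (V k) \<Longrightarrow> f (x \<otimes> y) = (\<Sum>i<n. a i x * b i y)"
proof -
  obtain l where "variety_morphism (prod_variety (V k) (V k)) (V l) (\<lambda>(x, y). x \<otimes> y)"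
    using mult_morphism unfolding ind_morphism_def ind_prod_def by blast
  moreover have "f \<in> reg (V l)" using f R_subset_reg by blast
  ultimately have "f \<circ> (\<lambda>(x, y). x \<otimes> y) \<in> reg (prod_variety (V k) (V k))"
    unfolding variety_morphism_def by blast
  then obtain n a b where ab: "\<forall>i<n. a i \<in> reg (V k) \<and> b i \<in> reg (V k)"
    and eq: "\<forall>x\<in>pts (V k). \<forall>y\<in>pts (V k). (f \<circ> (\<lambda>(x, y). x \<otimes> y)) (x, y) = (\<Sum>i<(n::nat). a i x * b i y)"
    unfolding prod_variety_def by auto
  have ext: "\<exists>h. h \<in> R \<and> (\<forall>x\<in>pts (V k). h x = g x)" if g: "g \<in> reg (V k)" for g
    using ind_reg_extend[OF ind_var g] by metis
  have "\<forall>i\<in>{..<n}. \<exists>h. h \<in> R \<and> (\<forall>x\<in>pts (V k). h x = a i x)"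
    "\<forall>i\<in>{..<n}. \<exists>h. h \<in> R \<and> (\<forall>x\<in>pts (V k). h x = b i x)"
    using ab ext by blast+
  then obtain a' b' where a': "\<forall>i\<in>{..<n}. a' i \<in> R \<and> (\<forall>x\<in>pts (V k). a' i x = a i x)"
    and b': "\<forall>i\<in>{..<n}. b' i \<in> R \<and> (\<forall>x\<in>pts (V k). b' i x = b i x)"
    unfolding bchoice_iff by blast
  show thesis
  proof (rule that[of n a' b'])
    show "a' i \<in> R" "b' i \<in> R" if "i < n" for i using a' b' that by simp_all
    show "f (x \<otimes> y) = (\<Sum>i<n. a' i x * b' i y)" if "x \<in> pts (V k)" "y \<in> pts (V k)" for x y
    proof -
      have "f (x \<otimes> y) = (\<Sum>i<n. a i x * b i y)" using eq that by simp
      also have "\<dots> = (\<Sum>i<n. a' i x * b' i y)" using a' b' that by (intro sum.cong) simp_all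
      finally show ?thesis .
    qed
  qed
qed

lemma inv_in_R: "f \<in> R \<Longrightarrow> f \<circ> (\<lambda>x. inv x) \<in> R"
  unfolding ind_reg_def
proof
  fix k assume f: "f \<in> (\<Inter>k. reg (V k))"
  obtain l where "variety_morphism (V k) (V l) (\<lambda>x. inv x)"
    using inv_morphism unfolding ind_morphism_def by blast
  then show "f \<circ> (\<lambda>x. inv x) \<in> reg (V k)" using f unfolding variety_morphism_def by blast
qed

lemma common_pts:
  assumes "x \<in> carrier G" obtains K where "k \<le> K" "x \<in> pts (V K)"
proof -
  obtain m where "x \<in> pts (V m)" using in_pts[OF assms] .
  then show thesis using that[of "max k m"] pts_mono[of m "max k m"] by auto
qed

lemma sum_scale_in_R: "(\<And>i. i < n \<Longrightarrow> b i \<in> R) \<Longrightarrow> (\<lambda>x. \<Sum>i<(n::nat). c i * b i x) \<in> R"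
proof (induction n)
  case 0
  show ?case using function_ring_const[OF function_ring_R, of 0] by simp
next
  case (Suc n)
  then have "(\<lambda>x. \<Sum>i<n. c i * b i x) + (\<lambda>x. c n * b n x) \<in> R"
    by (intro function_ring_add[OF function_ring_R] function_ring_scale[OF function_ring_R]) auto
  then show ?case by (simp add: plus_fun_def)
qed

lemma left_translate_in_R:
  assumes g: "g \<in> carrier G" and f: "f \<in> R" shows "f \<circ> (\<lambda>x. g \<otimes> x) \<in> R"
proof (rule R_memI)
  fix k
  obtain K where K: "k \<le> K" "g \<in> pts (V K)" using common_pts[OF g] .
  obtain n a b where ab: "\<And>i::nat. i < n \<Longrightarrow> a i \<in> R" "\<And>i. i < n \<Longrightarrow> b i \<in> R"
    "\<And>x y. x \<in> pts (V K) \<Longrightarrow> y \<in> pts (V K) \<Longrightarrow> f (x \<otimes> y) = (\<Sum>i<n. a i x * b i y)"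
    using mult_decompose[OF f, of K] by blast
  show "\<exists>K\<ge>k. \<exists>h\<in>R. \<forall>x\<in>pts (V K). (f \<circ> (\<lambda>x. g \<otimes> x)) x = h x"
    using K ab by (intro exI[of _ K] conjI bexI[of _ "\<lambda>x. \<Sum>i<n. a i g * b i x"] sum_scale_in_R) auto
qed

lemma right_translate_in_R:
  assumes g: "g \<in> carrier G" and f: "f \<in> R" shows "f \<circ> (\<lambda>x. x \<otimes> g) \<in> R"
proof (rule R_memI)
  fix k
  obtain K where K: "k \<le> K" "g \<in> pts (V K)" using common_pts[OF g] .
  obtain n a b where ab: "\<And>i::nat. i < n \<Longrightarrow> a i \<in> R" "\<And>i. i < n \<Longrightarrow> b i \<in> R"
    "\<And>x y. x \<in> pts (V K) \<Longrightarrow> y \<in> pts (V K) \<Longrightarrow> f (x \<otimes> y) = (\<Sum>i<n. a i x * b i y)"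
    using mult_decompose[OF f, of K] by blast
  show "\<exists>K\<ge>k. \<exists>h\<in>R. \<forall>x\<in>pts (V K). (f \<circ> (\<lambda>x. x \<otimes> g)) x = h x"
    using K ab
    by (intro exI[of _ K] conjI bexI[of _ "\<lambda>x. \<Sum>i<n. b i g * a i x"] sum_scale_in_R)
      (auto simp: mult.commute)
qed

lemma mult_bounded_sets:
  assumes "X \<subseteq> pts (V k)" "Y \<subseteq> pts (V m)"
  obtains l where "\<And>x y. x \<in> X \<Longrightarrow> y \<in> Y \<Longrightarrow> x \<otimes> y \<in> pts (V l)"
proof -
  obtain l where l: "\<And>x y. x \<in> pts (V (max k m)) \<Longrightarrow> y \<in> pts (V (max k m)) \<Longrightarrow> x \<otimes> y \<in> pts (V l)"
    using mult_bounded by blast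
  have "X \<subseteq> pts (V (max k m))" "Y \<subseteq> pts (V (max k m))"
    using assms pts_mono[of k "max k m"] pts_mono[of m "max k m"] by auto
  then show thesis using that[of l] l by blast
qed

lemma left_translation: 
  assumes g: "g \<in> carrier G" shows "automorphism (\<lambda>x. g \<otimes> x) (\<lambda>x. inv g \<otimes> x)"
  unfolding automorphism_def
proof (intro conjI ballI allI)
  fix x assume x: "x \<in> ind_pts V"
  then have "x \<in> carrier G" by (simp add: carrier_eq)
  then show "g \<otimes> x \<in> ind_pts V" "inv g \<otimes> x \<in> ind_pts V" "inv g \<otimes> (g \<otimes> x) = x" "g \<otimes> (inv g \<otimes> x) = x"
    using g by (simp_all add: carrier_eq[symmetric] inv_solve_left inv_solve_left' flip: m_assoc)
next
  fix k
  obtain l m where gl: "g \<in> pts (V l)" and gm: "inv g \<in> pts (V m)"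
    using in_pts[OF g] in_pts[OF inv_closed[OF g]] by metis
  obtain a where a: "\<And>x y. x \<in> {g} \<Longrightarrow> y \<in> pts (V k) \<Longrightarrow> x \<otimes> y \<in> pts (V a)"
    using mult_bounded_sets[of "{g}" l "pts (V k)" k] gl by blast
  obtain b where b: "\<And>x y. x \<in> {inv g} \<Longrightarrow> y \<in> pts (V k) \<Longrightarrow> x \<otimes> y \<in> pts (V b)"
    using mult_bounded_sets[of "{inv g}" m "pts (V k)" k] gm by blast
  show "\<exists>l. (\<lambda>x. g \<otimes> x) ` pts (V k) \<subseteq> pts (V l) \<and> (\<lambda>x. inv g \<otimes> x) ` pts (V k) \<subseteq> pts (V l)"
    using a b pts_mono[of a "max a b"] pts_mono[of b "max a b"] by (intro exI[of _ "max a b"]) auto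
qed (use left_translate_in_R g in auto)

lemma right_translation:
  assumes g: "g \<in> carrier G" shows "automorphism (\<lambda>x. x \<otimes> g) (\<lambda>x. x \<otimes> inv g)"
  unfolding automorphism_def
proof (intro conjI ballI allI)
  fix x assume x: "x \<in> ind_pts V"
  then have "x \<in> carrier G" by (simp add: carrier_eq)
  then show "x \<otimes> g \<in> ind_pts V" "x \<otimes> inv g \<in> ind_pts V" "x \<otimes> g \<otimes> inv g = x" "x \<otimes> inv g \<otimes> g = x"
    using g by (simp_all add: carrier_eq[symmetric] m_assoc)
next
  fix k
  obtain l m where gl: "g \<in> pts (V l)" and gm: "inv g \<in> pts (V m)"
    using in_pts[OF g] in_pts[OF inv_closed[OF g]] by metis
  obtain a where a: "\<And>x y. x \<in> pts (V k) \<Longrightarrow> y \<in> {g} \<Longrightarrow> x \<otimes> y \<in> pts (V a)"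
    using mult_bounded_sets[of "pts (V k)" k "{g}" l] gl by blast
  obtain b where b: "\<And>x y. x \<in> pts (V k) \<Longrightarrow> y \<in> {inv g} \<Longrightarrow> x \<otimes> y \<in> pts (V b)"
    using mult_bounded_sets[of "pts (V k)" k "{inv g}" m] gm by blast
  show "\<exists>l. (\<lambda>x. x \<otimes> g) ` pts (V k) \<subseteq> pts (V l) \<and> (\<lambda>x. x \<otimes> inv g) ` pts (V k) \<subseteq> pts (V l)"
    using a b pts_mono[of a "max a b"] pts_mono[of b "max a b"] by (intro exI[of _ "max a b"]) auto
qed (use right_translate_in_R g in auto)

lemma inversion: "automorphism (\<lambda>x. inv x) (\<lambda>x. inv x)"
  unfolding automorphism_def
proof (intro conjI ballI allI)
  fix k
  show "\<exists>l. (\<lambda>x. inv x) ` pts (V k) \<subseteq> pts (V l) \<and> (\<lambda>x. inv x) ` pts (V k) \<subseteq> pts (V l)"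
  proof -
    obtain l where "\<And>x. x \<in> pts (V k) \<Longrightarrow> inv x \<in> pts (V l)" using inv_bounded[of k] by metis
    then show ?thesis by (intro exI[of _ l]) auto
  qed
qed (use inv_in_R in \<open>auto simp flip: carrier_eq\<close>)

lemma conjugation:
  assumes g: "g \<in> carrier G"
  shows "automorphism (\<lambda>x. g \<otimes> x \<otimes> inv g) ((\<lambda>x. inv g \<otimes> x) \<circ> (\<lambda>x. x \<otimes> inv (inv g)))"
  using automorphism_comp[OF right_translation[OF inv_closed[OF g]] left_translation[OF g]]
  by (simp add: o_def)

section \<open>The span of the tangent spaces\<close>

abbreviation "L \<equiv> L_space G V"

definition smooth_at_identity :: "'a set set" where
  "smooth_at_identity = {X. algebraic_subset V X \<and> \<one> \<in> smooth_points V X}"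

lemma smooth_at_identityD:
  assumes "X \<in> smooth_at_identity"
  obtains k where "X \<subseteq> pts (V k)" "\<one> \<in> X"
  using assms unfolding smooth_at_identity_def algebraic_subset_def bounded_subset_def smooth_points_def by blast

text \<open>The generating sets are bounded, so their tangent spaces consist of derivations of the ring
  \<open>R\<close>.\<close>

lemma L_eq: "L = functional.span (\<Union>X\<in>smooth_at_identity. point_derivs R X \<one>)"
proof -
  have "subset_tangent_space V X \<one> = point_derivs R X \<one>" if X: "X \<in> smooth_at_identity" for X
  proof -
    obtain k where "X \<subseteq> pts (V k)" "\<one> \<in> X" using smooth_at_identityD[OF X] .
    then show ?thesis by (rule subset_tangent_space_eq)
  qed
  then show ?thesis unfolding L_space_def smooth_at_identity_def[symmetric] by simp
qed

lemma point_derivs_subset_L: "X \<in> smooth_at_identity \<Longrightarrow> point_derivs R X \<one> \<subseteq> L"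
  unfolding L_eq by (intro subsetI functional.span_base UN_I)

lemma subspace_L: "functional.subspace L"
  unfolding L_eq by (rule functional.subspace_span)

lemma Lie_eq: "Lie G V = (\<Union>k\<in>{k. \<one> \<in> pts (V k)}. point_derivs R (pts (V k)) \<one>)"
  unfolding Lie_def by (rule ind_tangent_space_eq)

lemma LieE:
  assumes "A \<in> Lie G V" obtains k where "k \<ge> m" "\<one> \<in> pts (V k)" "A \<in> point_derivs R (pts (V k)) \<one>"
proof -
  obtain k where k: "\<one> \<in> pts (V k)" "A \<in> point_derivs R (pts (V k)) \<one>" using assms by (auto simp: Lie_eq)
  show thesis
  proof (rule that[of "max k m"])
    show "\<one> \<in> pts (V (max k m))" using k(1) pts_mono[of k "max k m"] by auto
    show "A \<in> point_derivs R (pts (V (max k m))) \<one>"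
      using k(2) point_derivs_mono[OF pts_mono[of k "max k m"]] by auto
  qed simp
qed

lemma LieI: "A \<in> point_derivs R X \<one> \<Longrightarrow> X \<subseteq> pts (V k) \<Longrightarrow> \<one> \<in> pts (V k) \<Longrightarrow> A \<in> Lie G V"
  unfolding Lie_eq using subsetD[OF point_derivs_mono] by (intro UN_I[of k]) simp_all

lemma one_pts: obtains k where "\<one> \<in> pts (V k)"
  using in_pts[OF one_closed] .

lemma subspace_Lie: "functional.subspace (Lie G V)"
proof (rule functional.subspaceI)
  obtain k where k: "\<one> \<in> pts (V k)" by (rule one_pts)
  show "0 \<in> Lie G V"
    by (rule LieI[OF functional.subspace_0[OF subspace_point_derivs[OF function_ring_R]] order_refl k])
next
  fix A B assume "A \<in> Lie G V" "B \<in> Lie G V"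
  then obtain k where k: "\<one> \<in> pts (V k)" "A \<in> point_derivs R (pts (V k)) \<one>" by (elim LieE[of _ 0])
  obtain l where l: "l \<ge> k" "\<one> \<in> pts (V l)" "B \<in> point_derivs R (pts (V l)) \<one>"
    using \<open>B \<in> Lie G V\<close> by (rule LieE)
  have "A \<in> point_derivs R (pts (V l)) \<one>" using k(2) point_derivs_mono[OF pts_mono[OF l(1)]] by blast
  then show "A + B \<in> Lie G V"
    using l by (intro LieI[OF functional.subspace_add[OF subspace_point_derivs[OF function_ring_R]] order_refl])
next
  fix c A assume "A \<in> Lie G V"
  then obtain k where k: "\<one> \<in> pts (V k)" "A \<in> point_derivs R (pts (V k)) \<one>" by (rule LieE[of _ 0])
  then show "scale_functional c A \<in> Lie G V"
    by (intro LieI[OF functional.subspace_scale[OF subspace_point_derivs[OF function_ring_R]] order_refl])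
qed

lemma L_subset_Lie: "L \<subseteq> Lie G V"
  unfolding L_eq
proof (rule functional.span_minimal[OF _ subspace_Lie])
  show "(\<Union>X\<in>smooth_at_identity. point_derivs R X \<one>) \<subseteq> Lie G V"
  proof (rule UN_least, rule subsetI)
    fix X A assume X: "X \<in> smooth_at_identity" and A: "A \<in> point_derivs R X \<one>"
    obtain k where k: "X \<subseteq> pts (V k)" "\<one> \<in> X" using smooth_at_identityD[OF X] .
    show "A \<in> Lie G V" by (rule LieI[OF A k(1) subsetD[OF k]])
  qed
qed

text \<open>Conjugation is an automorphism that fixes the identity, so it permutes the generating sets.\<close>

lemma Ad_stable:
  assumes g: "g \<in> carrier G" shows "Ad G V g ` L \<subseteq> L"
proof -
  let ?\<phi> = "\<lambda>x. g \<otimes> x \<otimes> inv g"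
  note a = conjugation[OF g]
  interpret l: Vector_Spaces.linear scale_functional scale_functional "differential R ?\<phi>"
    by (rule linear_differential)
  have one: "?\<phi> \<one> = \<one>" using g by simp
  have gen: "differential R ?\<phi> A \<in> L" if X: "X \<in> smooth_at_identity" and A: "A \<in> point_derivs R X \<one>" for X A
  proof -
    obtain k where k: "X \<subseteq> pts (V k)" "\<one> \<in> X" using smooth_at_identityD[OF X] .
    have "algebraic_subset V (?\<phi> ` X)" "?\<phi> \<one> \<in> smooth_points V (?\<phi> ` X)"
      using X automorphism_algebraic_subset[OF a] automorphism_smooth[OF a k(1)]
      unfolding smooth_at_identity_def by blast+
    then have "?\<phi> ` X \<in> smooth_at_identity" unfolding smooth_at_identity_def one by blast
    moreover have "differential R ?\<phi> A \<in> point_derivs R (?\<phi> ` X) (?\<phi> \<one>)"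
      by (rule differential_point_derivs[OF automorphismD(5)[OF a] A])
    ultimately show ?thesis using point_derivs_subset_L unfolding one by blast
  qed
  have "differential R ?\<phi> ` L \<subseteq> L"
    unfolding L_eq l.span_image[symmetric]
    by (rule functional.span_minimal[OF _ functional.subspace_span]) (use gen in \<open>auto simp: L_eq\<close>)
  then show ?thesis unfolding Ad_def .
qed

end

section \<open>The span is an ideal\<close>

definition linear_on :: "('a \<Rightarrow> 'k::field) set \<Rightarrow> (('a \<Rightarrow> 'k) \<Rightarrow> 'k) \<Rightarrow> bool" where
  "linear_on R A \<longleftrightarrow> (\<forall>f. f \<notin> R \<longrightarrow> A f = 0) \<and> (\<forall>f\<in>R. \<forall>g\<in>R. A (f + g) = A f + A g) \<and>
     (\<forall>c. \<forall>f\<in>R. A (\<lambda>y. c * f y) = c * A f)"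

text \<open>By induction on \<open>E\<close>: if some \<open>h\<close> is killed by \<open>E\<close> but not by
  \<open>m\<close>, then subtracting from \<open>C\<close> the multiple of \<open>m\<close> with the same value
  at \<open>h\<close> leaves a functional that vanishes wherever \<open>E\<close> does.\<close>

lemma in_span_if_vanishes:
  fixes R :: "('a \<Rightarrow> 'k::field) set"
  assumes R: "function_ring R" and E: "finite E" "\<And>m. m \<in> E \<Longrightarrow> linear_on R m" and C: "linear_on R C"
    and van: "\<And>f. f \<in> R \<Longrightarrow> (\<And>m. m \<in> E \<Longrightarrow> m f = 0) \<Longrightarrow> C f = 0"
  shows "C \<in> functional.span E"
  using E C van
proof (induction E arbitrary: C rule: finite_induct)
  case empty
  have "C f = 0" for f using empty(2,3) unfolding linear_on_def by (cases "f \<in> R") auto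
  then have "C = 0" by (simp add: fun_eq_iff)
  then show ?case by (simp only: functional.span_zero)
next
  case (insert m E)
  have m: "linear_on R m" and E: "\<And>m'. m' \<in> E \<Longrightarrow> linear_on R m'" using insert.prems(1) by blast+
  have mono: "functional.span E \<subseteq> functional.span (insert m E)" by (rule functional.span_mono) blast
  show ?case
  proof (cases "\<exists>h\<in>R. (\<forall>m'\<in>E. m' h = 0) \<and> m h \<noteq> 0")
    case True
    then obtain h where h: "h \<in> R" "\<forall>m'\<in>E. m' h = 0" "m h \<noteq> 0" by blast
    define t where "t = C h / m h"
    define C' where "C' = C - scale_functional t m"
    have C'_apply: "C' f = C f - t * m f" for f by (simp add: C'_def scale_functional_def)
    have C': "linear_on R C'"
      using insert.prems(2) m unfolding linear_on_def C'_apply by (simp add: algebra_simps)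
    have van': "C' f = 0" if f: "f \<in> R" "\<And>m'. m' \<in> E \<Longrightarrow> m' f = 0" for f
    proof -
      \<comment> \<open>correct \<open>f\<close> by a multiple of \<open>h\<close> so that \<open>m\<close> kills it as well\<close>
      define r where "r = - (m f / m h)"
      have rh: "(\<lambda>y. r * h y) \<in> R" by (rule function_ring_scale[OF R h(1)])
      have ev: "B (f + (\<lambda>y. r * h y)) = B f + r * B h" if "linear_on R B" for B
        using that f(1) h(1) rh unfolding linear_on_def by simp
      have "C (f + (\<lambda>y. r * h y)) = 0"
      proof (rule insert.prems(3)[OF function_ring_add[OF R f(1) rh]])
        fix m' assume m': "m' \<in> insert m E"
        have "m' (f + (\<lambda>y. r * h y)) = m' f + r * m' h" using m' by (intro ev insert.prems(1))
        then show "m' (f + (\<lambda>y. r * h y)) = 0"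
          using m' f(2) h(2,3) by (cases "m' = m") (auto simp: r_def)
      qed
      then have "C f + r * C h = 0" using ev[OF insert.prems(2)] by simp
      then show ?thesis using h(3) by (simp add: C'_apply t_def r_def field_simps)
    qed
    have "C' \<in> functional.span E" by (rule insert.IH[OF E C' van'])
    then have "C' \<in> functional.span (insert m E)" using mono by blast
    moreover have "scale_functional t m \<in> functional.span (insert m E)"
      by (intro functional.span_scale functional.span_base) simp
    ultimately have "C' + scale_functional t m \<in> functional.span (insert m E)"
      by (rule functional.span_add)
    then show ?thesis by (simp add: C'_def)
  next
    case False
    have van': "C f = 0" if f: "f \<in> R" "\<And>m'. m' \<in> E \<Longrightarrow> m' f = 0" for f
      by (rule insert.prems(3)[OF f(1)]) (use False f in auto)
    have "C \<in> functional.span E" by (rule insert.IH[OF E insert.prems(2) van'])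
    then show ?thesis using mono by blast
  qed
qed

lemma point_derivs_linear_on: "A \<in> point_derivs R X x \<Longrightarrow> linear_on R A"
  unfolding point_derivs_def linear_on_def by simp

lemma sum_fun_apply: "(sum f S) x = (\<Sum>i\<in>S. f i x)"
  by (induction S rule: infinite_finite_induct) auto

context ind_group
begin

lemma point_derivs_lincomb:
  assumes A: "A \<in> point_derivs R X x" and b: "\<And>i. i < n \<Longrightarrow> b i \<in> R"
    and h: "h \<in> R" "\<And>y. y \<in> X \<Longrightarrow> h y = (\<Sum>i<(n::nat). c i * b i y)"
  shows "A h = (\<Sum>i<n. c i * A (b i))"
proof -
  have cb: "(\<lambda>y. c i * b i y) \<in> R" if "i \<in> {..<n}" for i
    using function_ring_scale[OF function_ring_R b] that by simp
  have "A h = A (\<Sum>i<n. (\<lambda>y. c i * b i y))"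
    by (rule point_derivs_cong[OF function_ring_R A h(1) function_ring_sum[OF function_ring_R cb]])
      (simp_all add: sum_fun_apply h(2))
  also have "\<dots> = (\<Sum>i<n. A (\<lambda>y. c i * b i y))" by (rule point_derivs_sum[OF function_ring_R A cb])
  also have "\<dots> = (\<Sum>i<n. c i * A (b i))" using point_derivs_scale[OF A b] by simp
  finally show ?thesis .
qed

lemma point_derivs_sum_mult:
  assumes A: "A \<in> point_derivs R X x" and u: "\<And>i. i < n \<Longrightarrow> u i \<in> R" and v: "\<And>i. i < n \<Longrightarrow> v i \<in> R"
    and h: "h \<in> R" "\<And>y. y \<in> X \<Longrightarrow> h y = (\<Sum>i<(n::nat). u i y * v i y)"
  shows "A h = (\<Sum>i<n. u i x * A (v i) + v i x * A (u i))"
proof -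
  have uv: "u i * v i \<in> R" if "i \<in> {..<n}" for i
    using function_ring_mult[OF function_ring_R u v] that by simp
  have "A h = A (\<Sum>i<n. u i * v i)"
    by (rule point_derivs_cong[OF function_ring_R A h(1) function_ring_sum[OF function_ring_R uv]])
      (simp_all add: sum_fun_apply h(2))
  also have "\<dots> = (\<Sum>i<n. A (u i * v i))" by (rule point_derivs_sum[OF function_ring_R A uv])
  also have "\<dots> = (\<Sum>i<n. u i x * A (v i) + v i x * A (u i))"
    by (rule sum.cong) (use point_derivs_mult[OF A] u v in auto)
  finally show ?thesis .
qed

text \<open>Differentiate the constant \<open>c (g \<otimes> inv g)\<close> with the Leibniz rule.\<close>

lemma derivation_inverse:
  assumes A: "A \<in> point_derivs R (pts (V k)) \<one>" and c: "c \<in> R" and one: "\<one> \<in> pts (V k)"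
  shows "A (c \<circ> (\<lambda>x. inv x)) = - A c"
proof -
  obtain l where l: "\<And>x. x \<in> pts (V k) \<Longrightarrow> inv x \<in> pts (V l)" using inv_bounded[of k] by metis
  define K where "K = max k l"
  have K: "x \<in> pts (V K)" "inv x \<in> pts (V K)" if "x \<in> pts (V k)" for x
    using that l[OF that] pts_mono[of k K] pts_mono[of l K] by (auto simp: K_def)
  obtain n u v where uv: "\<And>i::nat. i < n \<Longrightarrow> u i \<in> R" "\<And>i. i < n \<Longrightarrow> v i \<in> R"
    and eq: "\<And>x y. x \<in> pts (V K) \<Longrightarrow> y \<in> pts (V K) \<Longrightarrow> c (x \<otimes> y) = (\<Sum>i<n. u i x * v i y)"
    using mult_decompose[OF c, of K] by blast
  define v' where "v' i = v i \<circ> (\<lambda>x. inv x)" for i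
  have v': "v' i \<in> R" if "i < n" for i unfolding v'_def by (rule inv_in_R[OF uv(2)[OF that]])
  have "A (\<lambda>_. c \<one>) = (\<Sum>i<n. u i \<one> * A (v' i) + v' i \<one> * A (u i))"
  proof (rule point_derivs_sum_mult[OF A uv(1) v' function_ring_const[OF function_ring_R]])
    fix y assume y: "y \<in> pts (V k)"
    have "c (y \<otimes> inv y) = (\<Sum>i<n. u i y * v' i y)" using eq[OF K(1)[OF y] K(2)[OF y]] by (simp add: v'_def)
    then show "c \<one> = (\<Sum>i<n. u i y * v' i y)" using in_carrier[OF y] by simp
  qed
  then have 0: "(\<Sum>i<n. u i \<one> * A (v' i)) + (\<Sum>i<n. v i \<one> * A (u i)) = 0"
    using point_derivs_const[OF function_ring_R A, of "c \<one>"] by (simp add: sum.distrib v'_def)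
  have "A (c \<circ> (\<lambda>x. inv x)) = (\<Sum>i<n. u i \<one> * A (v' i))"
  proof (rule point_derivs_lincomb[OF A v' inv_in_R[OF c]])
    fix y assume y: "y \<in> pts (V k)"
    have "c (\<one> \<otimes> inv y) = (\<Sum>i<n. u i \<one> * v' i y)" using eq[OF K(1)[OF one] K(2)[OF y]] by (simp add: v'_def)
    then show "(c \<circ> (\<lambda>x. inv x)) y = (\<Sum>i<n. u i \<one> * v' i y)" using in_carrier[OF y] by simp
  qed
  moreover have "A c = (\<Sum>i<n. v i \<one> * A (u i))"
  proof (rule point_derivs_lincomb[OF A uv(1) c])
    fix y assume y: "y \<in> pts (V k)"
    have "c (y \<otimes> \<one>) = (\<Sum>i<n. v i \<one> * u i y)" using eq[OF K(1)[OF y] K(1)[OF one]] by (simp add: mult.commute)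
    then show "c y = (\<Sum>i<n. v i \<one> * u i y)" using in_carrier[OF y] by simp
  qed
  ultimately show ?thesis using 0 by (simp add: eq_neg_iff_add_eq_0)
qed

lemma left_invariant_field_apply:
  "f \<in> R \<Longrightarrow> left_invariant_field G V B f = (\<lambda>g. B (f \<circ> (\<lambda>x. g \<otimes> x)))"
  unfolding left_invariant_field_def differential_def by simp

lemma left_invariant_field_in_R:
  assumes B: "B \<in> point_derivs R (pts (V k)) \<one>" and f: "f \<in> R"
  shows "left_invariant_field G V B f \<in> R"
proof (rule R_memI)
  fix k0
  define K where "K = max k k0"
  obtain n a b where ab: "\<And>i::nat. i < n \<Longrightarrow> a i \<in> R" "\<And>i. i < n \<Longrightarrow> b i \<in> R"
    and eq: "\<And>x y. x \<in> pts (V K) \<Longrightarrow> y \<in> pts (V K) \<Longrightarrow> f (x \<otimes> y) = (\<Sum>i<n. a i x * b i y)"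
    using mult_decompose[OF f, of K] by blast
  have "left_invariant_field G V B f g = (\<Sum>i<n. B (b i) * a i g)" if g: "g \<in> pts (V K)" for g
  proof -
    have "B (f \<circ> (\<lambda>x. g \<otimes> x)) = (\<Sum>i<n. a i g * B (b i))"
    proof (rule point_derivs_lincomb[OF B ab(2) left_translate_in_R[OF in_carrier[OF g] f]])
      fix y assume "y \<in> pts (V k)"
      then have "y \<in> pts (V K)" using pts_mono[of k K] by (auto simp: K_def)
      then show "(f \<circ> (\<lambda>x. g \<otimes> x)) y = (\<Sum>i<n. a i g * b i y)" using eq[OF g] by simp
    qed
    then show ?thesis by (simp add: left_invariant_field_apply[OF f] mult.commute)
  qed
  moreover have "(\<lambda>g. \<Sum>i<n. B (b i) * a i g) \<in> R" by (rule sum_scale_in_R[OF ab(1)])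
  ultimately show "\<exists>K\<ge>k0. \<exists>h\<in>R. \<forall>x\<in>pts (V K). left_invariant_field G V B f x = h x"
    by (intro exI[of _ K] conjI bexI[of _ "\<lambda>g. \<Sum>i<n. B (b i) * a i g"]) (auto simp: K_def)
qed

text \<open>The bracket \<open>[A, B]\<close> is the derivative in the direction \<open>A\<close> of the map
  \<open>g \<mapsto> Ad g B\<close>: writing \<open>f (w \<otimes> z)\<close> as a sum of products separates the
  two occurrences of \<open>g\<close> in \<open>g \<otimes> x \<otimes> inv g\<close>, and the derivatives of the two
  factors are the two terms of the commutator, the second one with the sign from the inversion.\<close>

lemma Lie_bracket_vanishes:
  assumes A: "A \<in> point_derivs R (pts (V k)) \<one>" and B: "B \<in> point_derivs R (pts (V k)) \<one>"
    and one: "\<one> \<in> pts (V k)" and f: "f \<in> R"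
    and van: "\<And>g. g \<in> pts (V k) \<Longrightarrow> Ad G V g B f = 0"
  shows "Lie_bracket G V A B f = 0"
proof -
  obtain l0 where l0: "\<And>x. x \<in> pts (V k) \<Longrightarrow> inv x \<in> pts (V l0)" using inv_bounded[of k] by metis
  obtain l1 where l1: "\<And>x y. x \<in> pts (V k) \<Longrightarrow> y \<in> pts (V k) \<Longrightarrow> x \<otimes> y \<in> pts (V l1)"
    using mult_bounded[of k] by metis
  define K where "K = max k (max l0 l1)"
  have "k \<le> K" "l0 \<le> K" "l1 \<le> K" by (simp_all add: K_def le_max_iff_disj)
  note le = pts_mono[OF this(1)] pts_mono[OF this(2)] pts_mono[OF this(3)]
  have K: "x \<in> pts (V K)" "inv x \<in> pts (V K)" if "x \<in> pts (V k)" for x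
    using that l0[OF that] le by blast+
  have Km: "x \<otimes> y \<in> pts (V K)" if "x \<in> pts (V k)" "y \<in> pts (V k)" for x y
    using l1[OF that] le by blast
  obtain n a c where a: "\<And>i::nat. i < n \<Longrightarrow> a i \<in> R" and c: "\<And>i. i < n \<Longrightarrow> c i \<in> R"
    and eq: "\<And>x y. x \<in> pts (V K) \<Longrightarrow> y \<in> pts (V K) \<Longrightarrow> f (x \<otimes> y) = (\<Sum>i<n. a i x * c i y)"
    using mult_decompose[OF f, of K] by blast
  define \<beta> where "\<beta> i = left_invariant_field G V B (a i)" for i
  define c' where "c' i = c i \<circ> (\<lambda>x. inv x)" for i
  have \<beta>: "\<beta> i \<in> R" if "i < n" for i unfolding \<beta>_def by (rule left_invariant_field_in_R[OF B a[OF that]])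
  have c': "c' i \<in> R" if "i < n" for i unfolding c'_def by (rule inv_in_R[OF c[OF that]])
  have \<beta>_apply: "\<beta> i g = B (a i \<circ> (\<lambda>x. g \<otimes> x))" if "i < n" for i g
    unfolding \<beta>_def left_invariant_field_apply[OF a[OF that]] ..
  have \<beta>_one: "\<beta> i \<one> = B (a i)" if i: "i < n" for i
  proof -
    have "B (a i \<circ> (\<lambda>x. \<one> \<otimes> x)) = B (a i)"
      by (rule point_derivs_cong[OF function_ring_R B left_translate_in_R[OF one_closed a[OF i]] a[OF i]])
        (simp add: in_carrier)
    then show ?thesis using \<beta>_apply[OF i] by simp
  qed
  have zero: "(\<Sum>i<n. c' i g * \<beta> i g) = 0" if g: "g \<in> pts (V k)" for g
  proof -
    have gc: "g \<in> carrier G" by (rule in_carrier[OF g])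
    have "B (f \<circ> (\<lambda>x. g \<otimes> x \<otimes> inv g)) = (\<Sum>i<n. c' i g * B (a i \<circ> (\<lambda>x. g \<otimes> x)))"
    proof (rule point_derivs_lincomb[OF B left_translate_in_R[OF gc a] automorphismD(5)[OF conjugation[OF gc] f]])
      fix y assume y: "y \<in> pts (V k)"
      show "(f \<circ> (\<lambda>x. g \<otimes> x \<otimes> inv g)) y = (\<Sum>i<n. c' i g * (a i \<circ> (\<lambda>x. g \<otimes> x)) y)"
        using eq[OF Km[OF g y] K(2)[OF g]] by (simp add: c'_def mult.commute)
    qed
    then show ?thesis using van[OF g] f \<beta>_apply by (simp add: Ad_def differential_def)
  qed
  have "A (\<lambda>_. 0) = (\<Sum>i<n. c' i \<one> * A (\<beta> i) + \<beta> i \<one> * A (c' i))"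
    by (rule point_derivs_sum_mult[OF A c' \<beta> function_ring_const[OF function_ring_R]]) (simp_all add: zero)
  moreover have "A (c' i) = - A (c i)" if "i < n" for i
    unfolding c'_def by (rule derivation_inverse[OF A c[OF that] one])
  ultimately have "(\<Sum>i<n. c i \<one> * A (\<beta> i) - B (a i) * A (c i)) = 0"
    using point_derivs_const[OF function_ring_R A, of 0] \<beta>_one by (simp add: c'_def)
  then have main: "(\<Sum>i<n. c i \<one> * A (\<beta> i)) = (\<Sum>i<n. A (c i) * B (a i))"
    by (simp add: sum_subtractf mult.commute)
  have "A (left_invariant_field G V B f) = (\<Sum>i<n. c i \<one> * A (\<beta> i))"
  proof (rule point_derivs_lincomb[OF A \<beta> left_invariant_field_in_R[OF B f]])
    fix g assume g: "g \<in> pts (V k)"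
    have gc: "g \<in> carrier G" by (rule in_carrier[OF g])
    have "B (f \<circ> (\<lambda>x. g \<otimes> x)) = (\<Sum>i<n. c i \<one> * B (a i \<circ> (\<lambda>x. g \<otimes> x)))"
    proof (rule point_derivs_lincomb[OF B left_translate_in_R[OF gc a] left_translate_in_R[OF gc f]])
      fix y assume y: "y \<in> pts (V k)"
      show "(f \<circ> (\<lambda>x. g \<otimes> x)) y = (\<Sum>i<n. c i \<one> * (a i \<circ> (\<lambda>x. g \<otimes> x)) y)"
        using eq[OF Km[OF g y] K(1)[OF one]] gc in_carrier[OF y] by (simp add: mult.commute)
    qed
    then show "left_invariant_field G V B f g = (\<Sum>i<n. c i \<one> * \<beta> i g)"
      using \<beta>_apply by (simp add: left_invariant_field_apply[OF f])
  qed
  moreover have "B (left_invariant_field G V A f) = (\<Sum>i<n. A (c i) * B (a i))"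
  proof (rule point_derivs_lincomb[OF B a left_invariant_field_in_R[OF A f]])
    fix x assume x: "x \<in> pts (V k)"
    have "A (f \<circ> (\<lambda>y. x \<otimes> y)) = (\<Sum>i<n. a i x * A (c i))"
      by (rule point_derivs_lincomb[OF A c left_translate_in_R[OF in_carrier[OF x] f]])
        (simp_all add: eq[OF K(1)[OF x] K(1)])
    then show "left_invariant_field G V A f x = (\<Sum>i<n. A (c i) * a i x)"
      by (simp add: left_invariant_field_apply[OF f] mult.commute)
  qed
  ultimately show ?thesis using main f by (simp add: Lie_bracket_def)
qed

lemma Lie_bracket_linear_on:
  assumes A: "A \<in> point_derivs R (pts (V k)) \<one>" and B: "B \<in> point_derivs R (pts (V k)) \<one>"
  shows "linear_on R (Lie_bracket G V A B)"
proof -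
  have add: "C (left_invariant_field G V D (f + g)) =
      C (left_invariant_field G V D f) + C (left_invariant_field G V D g)"
    if C: "C \<in> point_derivs R (pts (V k)) \<one>" and D: "D \<in> point_derivs R (pts (V k)) \<one>"
      and f: "f \<in> R" and g: "g \<in> R" for C D f g
  proof -
    have fg: "f + g \<in> R" by (rule function_ring_add[OF function_ring_R f g])
    note fields = left_invariant_field_in_R[OF D f] left_invariant_field_in_R[OF D g]
    have "C (left_invariant_field G V D (f + g)) =
        C (left_invariant_field G V D f + left_invariant_field G V D g)"
    proof (rule point_derivs_cong[OF function_ring_R C left_invariant_field_in_R[OF D fg]
          function_ring_add[OF function_ring_R fields]])
      fix y assume "y \<in> pts (V k)"
      then have y: "y \<in> carrier G" by (rule in_carrier)
      have "(f + g) \<circ> (\<lambda>x. y \<otimes> x) = (f \<circ> (\<lambda>x. y \<otimes> x)) + (g \<circ> (\<lambda>x. y \<otimes> x))" by (simp add: fun_eq_iff)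
      then show "left_invariant_field G V D (f + g) y =
          (left_invariant_field G V D f + left_invariant_field G V D g) y"
        using point_derivs_add[OF D left_translate_in_R[OF y f] left_translate_in_R[OF y g]]
        by (simp add: left_invariant_field_apply f g fg)
    qed
    then show ?thesis using point_derivs_add[OF C fields] by simp
  qed
  have scale: "C (left_invariant_field G V D (\<lambda>y. c * f y)) = c * C (left_invariant_field G V D f)"
    if C: "C \<in> point_derivs R (pts (V k)) \<one>" and D: "D \<in> point_derivs R (pts (V k)) \<one>"
      and f: "f \<in> R" for C D c f
  proof -
    have cf: "(\<lambda>y. c * f y) \<in> R" by (rule function_ring_scale[OF function_ring_R f])
    note field = left_invariant_field_in_R[OF D f]
    have "C (left_invariant_field G V D (\<lambda>y. c * f y)) = C (\<lambda>y. c * left_invariant_field G V D f y)"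
    proof (rule point_derivs_cong[OF function_ring_R C left_invariant_field_in_R[OF D cf]
          function_ring_scale[OF function_ring_R field]])
      fix y assume "y \<in> pts (V k)"
      then have y: "y \<in> carrier G" by (rule in_carrier)
      have "(\<lambda>y. c * f y) \<circ> (\<lambda>x. y \<otimes> x) = (\<lambda>z. c * (f \<circ> (\<lambda>x. y \<otimes> x)) z)" by (simp add: fun_eq_iff)
      then show "left_invariant_field G V D (\<lambda>y. c * f y) y = c * left_invariant_field G V D f y"
        using point_derivs_scale[OF D left_translate_in_R[OF y f], of c]
        by (simp add: left_invariant_field_apply f cf)
    qed
    then show ?thesis using point_derivs_scale[OF C field] by simp
  qed
  show ?thesis
    unfolding linear_on_def
  proof (intro conjI allI ballI impI)
    show "Lie_bracket G V A B f = 0" if "f \<notin> R" for f using that by (simp add: Lie_bracket_def)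
    show "Lie_bracket G V A B (f + g) = Lie_bracket G V A B f + Lie_bracket G V A B g"
      if "f \<in> R" "g \<in> R" for f g
      using that function_ring_add[OF function_ring_R that] add[OF A B that] add[OF B A that]
      by (simp add: Lie_bracket_def)
    show "Lie_bracket G V A B (\<lambda>y. c * f y) = c * Lie_bracket G V A B f" if "f \<in> R" for c f
      using that function_ring_scale[OF function_ring_R that, of c] scale[OF A B that] scale[OF B A that]
      by (simp add: Lie_bracket_def right_diff_distrib)
  qed
qed

text \<open>For \<open>g\<close> in a bounded set the vectors \<open>Ad g B\<close> span a finite dimensional
  subspace of \<open>L\<close>.  If \<open>[A, B]\<close> were not in it, some function would separate it from
  this subspace, but \<open>[A, B]\<close> is a derivative of \<open>Ad g B\<close>.\<close>

lemma Lie_ideal_L: "Lie_ideal G V L"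
  unfolding Lie_ideal_def
proof (intro conjI ballI L_subset_Lie subspace_L)
  fix A B assume A: "A \<in> Lie G V" and B: "B \<in> L"
  obtain k0 where k0: "B \<in> point_derivs R (pts (V k0)) \<one>"
    using B L_subset_Lie by (meson LieE subsetD)
  obtain k where k: "k \<ge> k0" "\<one> \<in> pts (V k)" "A \<in> point_derivs R (pts (V k)) \<one>" using A by (rule LieE)
  have Bk: "B \<in> point_derivs R (pts (V k)) \<one>" using k0 point_derivs_mono[OF pts_mono[OF k(1)]] by blast
  define S where "S = (\<lambda>g. Ad G V g B) ` pts (V k)"
  obtain l0 where l0: "\<And>x. x \<in> pts (V k) \<Longrightarrow> inv x \<in> pts (V l0)" using inv_bounded[of k] by metis
  obtain l1 where l1: "\<And>x y. x \<in> pts (V k) \<Longrightarrow> y \<in> pts (V k) \<Longrightarrow> x \<otimes> y \<in> pts (V l1)"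
    using mult_bounded[of k] by metis
  obtain l where l: "\<And>x y. x \<in> pts (V l1) \<Longrightarrow> y \<in> pts (V l0) \<Longrightarrow> x \<otimes> y \<in> pts (V l)"
    using mult_bounded_sets[of "pts (V l1)" l1 "pts (V l0)" l0] by blast
  have "S \<subseteq> point_derivs R (pts (V l)) \<one>"
  proof
    fix C assume "C \<in> S"
    then obtain g where g: "g \<in> pts (V k)" "C = Ad G V g B" unfolding S_def by blast
    let ?\<phi> = "\<lambda>x. g \<otimes> x \<otimes> inv g"
    have gc: "g \<in> carrier G" by (rule in_carrier[OF g(1)])
    have "C \<in> point_derivs R (?\<phi> ` pts (V k)) (?\<phi> \<one>)"
      unfolding g(2) Ad_def by (rule differential_point_derivs[OF automorphismD(5)[OF conjugation[OF gc]] Bk])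
    moreover have "?\<phi> ` pts (V k) \<subseteq> pts (V l)" using l l1 l0 g(1) by blast
    moreover have "?\<phi> \<one> = \<one>" using gc by simp
    ultimately show "C \<in> point_derivs R (pts (V l)) \<one>"
      using point_derivs_mono[of "?\<phi> ` pts (V k)" "pts (V l)" R \<one>] by auto
  qed
  then have span_l: "functional.span S \<subseteq> point_derivs R (pts (V l)) \<one>"
    by (rule functional.span_minimal[OF _ subspace_point_derivs[OF function_ring_R]])
  obtain a J where "finite J" "generators R (pts (V l)) a J" by (rule generators_bounded[OF order_refl])
  then have "finite_dimensional (functional.span S)"
    by (intro finite_dimensional_point_derivs[OF function_ring_R _ _ functional.subspace_span span_l])
  then obtain E where E: "finite E" "functional.span E = functional.span S"
    unfolding finite_dimensional_def by blast
  have Elin: "linear_on R m" if "m \<in> E" for m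
  proof (rule point_derivs_linear_on)
    show "m \<in> point_derivs R (pts (V l)) \<one>" using that functional.span_base[of m E] E(2) span_l by blast
  qed
  have "Lie_bracket G V A B \<in> functional.span E"
  proof (rule in_span_if_vanishes[OF function_ring_R E(1) Elin Lie_bracket_linear_on[OF k(3) Bk]])
    fix f assume f: "f \<in> R" and m: "\<And>m. m \<in> E \<Longrightarrow> m f = 0"
    have "functional.subspace {C. C f = 0}"
      by (rule functional.subspaceI) (auto simp: scale_functional_def)
    then have "functional.span E \<subseteq> {C. C f = 0}"
      by (intro functional.span_minimal) (use m in auto)
    then have "C f = 0" if "C \<in> S" for C using that functional.span_base[of C S] E(2) by blast
    then show "Lie_bracket G V A B f = 0"
      by (intro Lie_bracket_vanishes[OF k(3) Bk k(2) f]) (auto simp: S_def)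
  qed
  moreover have "functional.span S \<subseteq> L"
  proof (rule functional.span_minimal[OF _ subspace_L])
    show "S \<subseteq> L" using Ad_stable B in_carrier unfolding S_def by blast
  qed
  ultimately show "Lie_bracket G V A B \<in> L" using E(2) by blast
qed

section \<open>Algebraic subgroups\<close>

text \<open>The preimage of the closure under \<open>\<phi>\<close> is a closed set that contains
  \<open>H\<close>.\<close>

lemma closure_automorphism:
  assumes a: "automorphism \<phi> \<psi>" and H: "H \<subseteq> ind_pts V" "\<phi> ` H = H"
  shows "\<phi> ` (T closure_of H) \<subseteq> T closure_of H"
proof -
  have P: "T closure_of H \<subseteq> ind_pts V" using closure_of_subset_topspace[of T H] by (simp add: topspace_T)
  have HC: "H \<subseteq> T closure_of H" using H(1) by (intro closure_of_subset) (simp add: topspace_T)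
  have "H = \<psi> ` H" using automorphism_image_image[OF a H(1)] H(2) by simp
  then have "H \<subseteq> \<psi> ` (T closure_of H)" using HC by blast
  moreover have "closedin T (\<psi> ` (T closure_of H))"
    by (rule automorphism_closedin[OF automorphism_sym[OF a] closedin_closure_of])
  ultimately have "T closure_of H \<subseteq> \<psi> ` (T closure_of H)" by (rule closure_of_minimal)
  then have "\<phi> ` (T closure_of H) \<subseteq> \<phi> ` \<psi> ` (T closure_of H)" by blast
  then show ?thesis unfolding automorphism_image_image[OF automorphism_sym[OF a] P] .
qed

lemma subgroup_left_translate:
  assumes "subgroup H G" "h \<in> H" shows "(\<lambda>x. h \<otimes> x) ` H = H"
proof -
  have "h \<otimes> x \<in> H" if "x \<in> H" for x using subgroup.m_closed[OF assms that] .
  moreover have "x \<in> (\<lambda>x. h \<otimes> x) ` H" if "x \<in> H" for x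
  proof (rule image_eqI)
    show "inv h \<otimes> x \<in> H" using assms that by (simp add: subgroup.m_closed subgroup.m_inv_closed)
    show "x = h \<otimes> (inv h \<otimes> x)"
      using assms that subgroup.mem_carrier[OF assms(1)] by (simp flip: m_assoc)
  qed
  ultimately show ?thesis by blast
qed

lemma subgroup_right_translate:
  assumes "subgroup H G" "h \<in> H" shows "(\<lambda>x. x \<otimes> h) ` H = H"
proof -
  have "x \<otimes> h \<in> H" if "x \<in> H" for x using subgroup.m_closed[OF assms(1) that assms(2)] .
  moreover have "x \<in> (\<lambda>x. x \<otimes> h) ` H" if "x \<in> H" for x
  proof (rule image_eqI)
    show "x \<otimes> inv h \<in> H" using assms that by (simp add: subgroup.m_closed subgroup.m_inv_closed)
    show "x = x \<otimes> inv h \<otimes> h"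
      using assms that subgroup.mem_carrier[OF assms(1)] by (simp add: m_assoc)
  qed
  ultimately show ?thesis by blast
qed

lemma subgroup_inverse_image:
  assumes "subgroup H G" shows "(\<lambda>x. inv x) ` H = H"
proof -
  have inv: "inv x \<in> H" if "x \<in> H" for x using subgroup.m_inv_closed[OF assms that] .
  moreover have "x \<in> (\<lambda>x. inv x) ` H" if "x \<in> H" for x
    by (rule image_eqI[OF _ inv[OF that]]) (use subgroup.mem_carrier[OF assms that] in simp)
  ultimately show ?thesis by blast
qed

text \<open>If \<open>h\<close> is a point of the closure outside \<open>H\<close>, then the coset \<open>h H\<close> lies
  in the closed complement of \<open>H\<close> in its closure, hence so does its closure; but this contains
  the identity.\<close>

lemma algebraic_subgroup_closed:
  assumes H: "subgroup H G" and lc: "locally_closed_in T H"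
  shows "closedin T H"
proof -
  let ?C = "T closure_of H"
  have HP: "H \<subseteq> ind_pts V" using subgroup.subset[OF H] by (simp add: carrier_eq)
  have HC: "H \<subseteq> ?C" using HP by (intro closure_of_subset) (simp add: topspace_T)
  have CP: "?C \<subseteq> ind_pts V" using closure_of_subset_topspace[of T H] by (simp add: topspace_T)
  obtain U D where U: "openin T U" "closedin T D" "H = U \<inter> D"
    using lc unfolding locally_closed_in_def by blast
  have "?C \<subseteq> D" using U by (intro closure_of_minimal) auto
  then have H_eq: "H = U \<inter> ?C" using U(3) HC by blast
  have "closedin T (?C - U)" by (rule closedin_diff[OF closedin_closure_of U(1)])
  moreover have "?C - U = ?C - H" using H_eq by blast
  ultimately have compl: "closedin T (?C - H)" by simp
  have "?C \<subseteq> H"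
  proof
    fix h assume h: "h \<in> ?C"
    have hc: "h \<in> carrier G" using h CP by (simp add: carrier_eq subset_iff)
    show "h \<in> H"
    proof (rule ccontr)
      assume nh: "h \<notin> H"
      have coset: "h \<otimes> x \<in> ?C - H" if x: "x \<in> H" for x
      proof -
        have xc: "x \<in> carrier G" by (rule subgroup.mem_carrier[OF H x])
        have "h \<otimes> x \<in> ?C"
          using closure_automorphism[OF right_translation[OF xc] HP subgroup_right_translate[OF H x]] h by blast
        moreover have "h \<otimes> x \<notin> H"
        proof
          assume "h \<otimes> x \<in> H"
          then have "h \<otimes> x \<otimes> inv x \<in> H" using H x by (simp add: subgroup.m_closed subgroup.m_inv_closed)
          then show False using nh hc xc by (simp add: m_assoc)
        qed
        ultimately show ?thesis by blast
      qed
      have "closedin T ((\<lambda>x. inv h \<otimes> x) ` (?C - H))"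
        by (rule automorphism_closedin[OF left_translation[OF inv_closed[OF hc]] compl])
      moreover have "H \<subseteq> (\<lambda>x. inv h \<otimes> x) ` (?C - H)"
      proof
        fix x assume x: "x \<in> H"
        have "x = inv h \<otimes> (h \<otimes> x)" using subgroup.mem_carrier[OF H x] hc by (simp flip: m_assoc)
        then show "x \<in> (\<lambda>x. inv h \<otimes> x) ` (?C - H)" using coset[OF x] by blast
      qed
      ultimately have "?C \<subseteq> (\<lambda>x. inv h \<otimes> x) ` (?C - H)" by (intro closure_of_minimal)
      moreover have "inv h \<in> ?C"
        using closure_automorphism[OF inversion HP subgroup_inverse_image[OF H]] h by blast
      ultimately obtain y where y: "inv h = inv h \<otimes> y" "y \<in> ?C - H" by blast
      have "y \<in> carrier G" using y(2) CP by (auto simp: carrier_eq)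
      then have "y = h \<otimes> (inv h \<otimes> y)" using hc by (simp flip: m_assoc)
      also have "\<dots> = \<one>" using hc by (simp flip: y(1))
      finally have "y = \<one>" .
      then show False using y(2) subgroup.one_closed[OF H] by blast
    qed
  qed
  then have "?C = H" using HC by blast
  then show ?thesis using closedin_closure_of[of T H] by simp
qed

text \<open>Some point of \<open>H\<close> is smooth, and left translations by members of \<open>H\<close> move it to
  the identity.\<close>

lemma algebraic_subgroup_smooth:
  assumes H: "algebraic_subgroup G V H" shows "H \<in> smooth_at_identity"
proof -
  have sub: "subgroup H G" and alg: "algebraic_subset V H" using H unfolding algebraic_subgroup_def by blast+
  obtain k where k: "H \<subseteq> pts (V k)" using alg unfolding algebraic_subset_def bounded_subset_def by blast
  have "closedin T H"
    using algebraic_subgroup_closed[OF sub] alg unfolding algebraic_subset_def by blast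
  then have "rel_closed (pts (V k)) H" using k by (rule rel_closed_if_closedin)
  moreover have "H \<noteq> {}" using subgroup.one_closed[OF sub] by blast
  ultimately obtain h where h: "h \<in> smooth_points V H" by (rule smooth_point_exists)
  have hH: "h \<in> H" using h unfolding smooth_points_def by blast
  then have hc: "h \<in> carrier G" by (rule subgroup.mem_carrier[OF sub])
  have "inv h \<otimes> h \<in> smooth_points V ((\<lambda>x. inv h \<otimes> x) ` H)"
    by (rule automorphism_smooth[OF left_translation[OF inv_closed[OF hc]] k h])
  then have "\<one> \<in> smooth_points V H"
    using subgroup_left_translate[OF sub subgroup.m_inv_closed[OF sub hH]] hc by simp
  then show ?thesis using alg unfolding smooth_at_identity_def by blast
qed

lemma algebraic_subgroup_tangent_space:
  assumes "algebraic_subgroup G V H"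
  shows "subset_tangent_space V H \<one> \<subseteq> L"
proof -
  have smooth: "H \<in> smooth_at_identity" by (rule algebraic_subgroup_smooth[OF assms])
  obtain k where "H \<subseteq> pts (V k)" "\<one> \<in> H" using smooth_at_identityD[OF smooth] .
  then have "subset_tangent_space V H \<one> = point_derivs R H \<one>" by (rule subset_tangent_space_eq)
  then show ?thesis using point_derivs_subset_L[OF smooth] by simp
qed

end

section \<open>The identity component\<close>

lemma irreducible_connected:
  assumes "irreducible_in S Z" shows "connectedin S Z"
  unfolding connectedin_closedin
proof (intro conjI notI)
  show "Z \<subseteq> topspace S" by (rule irreducible_in_subset[OF assms])
  assume "\<exists>C D. closedin S C \<and> closedin S D \<and> Z \<subseteq> C \<union> D \<and> C \<inter> D \<inter> Z = {} \<and> C \<inter> Z \<noteq> {} \<and> D \<inter> Z \<noteq> {}"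
  then obtain C D where CD: "closedin S C" "closedin S D" "Z \<subseteq> C \<union> D" "C \<inter> D \<inter> Z = {}"
    "C \<inter> Z \<noteq> {}" "D \<inter> Z \<noteq> {}" by (elim exE conjE)
  from irreducible_in_cases[OF assms CD(1-3)] show False using CD(4-6) by blast
qed

lemma irreducible_closure:
  assumes Z: "irreducible_in S Z" shows "irreducible_in S (S closure_of Z)"
proof (rule irreducible_inI)
  have sub: "Z \<subseteq> S closure_of Z" by (rule closure_of_subset[OF irreducible_in_subset[OF Z]])
  show "S closure_of Z \<subseteq> topspace S" by (rule closure_of_subset_topspace)
  show "S closure_of Z \<noteq> {}" using sub irreducible_in_nonempty[OF Z] by blast
  fix C D assume CD: "closedin S C" "closedin S D" "S closure_of Z \<subseteq> C \<union> D"
  then have "Z \<subseteq> C \<or> Z \<subseteq> D" using sub by (intro irreducible_in_cases[OF Z]) auto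
  then show "S closure_of Z \<subseteq> C \<or> S closure_of Z \<subseteq> D" using closure_of_minimal CD(1,2) by metis
qed

lemma (in ind_variety_space) algebraic_subset_closed:
  assumes "rel_closed (pts (V k)) Z" shows "algebraic_subset V Z"
proof -
  have Z: "closedin T Z" "Z \<subseteq> pts (V k)" using closedin_if_rel_closed[OF assms] rel_closed_subset[OF assms] .
  have "Z = topspace T \<inter> Z" using closedin_subset[OF Z(1)] by blast
  then show ?thesis
    using Z openin_topspace unfolding algebraic_subset_def bounded_subset_def locally_closed_in_def by blast
qed

context ind_group
begin

abbreviation "G0 \<equiv> identity_component G V"

lemma closedin_G0: "closedin T G0"
  unfolding identity_component_def by (rule closedin_connected_component_of)

lemma irreducible_subset_G0: "irreducible_in T Z \<Longrightarrow> \<one> \<in> Z \<Longrightarrow> Z \<subseteq> G0"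
  unfolding identity_component_def by (intro connected_component_of_maximal irreducible_connected)

text \<open>Irreducible pieces through the identity are connected, hence lie in the identity component, and the
  other pieces form a closed set that avoids the identity.\<close>

lemma part_in_identity_component:
  assumes X: "X \<subseteq> pts (V k)" and one: "\<one> \<in> X"
  obtains Y Z where "X = Y \<union> Z" "rel_closed X Y" "rel_closed X Z" "\<one> \<in> Y" "\<one> \<notin> Z" "Y \<subseteq> G0"
proof -
  obtain \<D> where \<D>: "finite \<D>" "X = \<Union>\<D>" "\<And>D. D \<in> \<D> \<Longrightarrow> rel_closed X D \<and> prime_on R D"
    using irreducible_decomposition[OF X rel_closed_self] by metis
  have union: "rel_closed X (\<Union>\<E>)" if "\<E> \<subseteq> \<D>" for \<E>
    by (rule rel_closed_Union[OF X finite_subset[OF that \<D>(1)]]) (use that \<D>(3) in blast)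
  show thesis
  proof (rule that[of "\<Union>{D \<in> \<D>. \<one> \<in> D}" "\<Union>{D \<in> \<D>. \<one> \<notin> D}"])
    show "X = \<Union>{D \<in> \<D>. \<one> \<in> D} \<union> \<Union>{D \<in> \<D>. \<one> \<notin> D}" using \<D>(2) by blast
    show "\<one> \<in> \<Union>{D \<in> \<D>. \<one> \<in> D}" using one \<D>(2) by blast
    show "\<Union>{D \<in> \<D>. \<one> \<in> D} \<subseteq> G0"
    proof (rule Union_least)
      fix D assume D: "D \<in> {D \<in> \<D>. \<one> \<in> D}"
      then have "D \<subseteq> pts (V k)" using \<D>(3) rel_closed_subset X by blast
      then have "irreducible_in T D" using irreducible_iff_prime \<D>(3) D by blast
      then show "D \<subseteq> G0" using D by (intro irreducible_subset_G0) auto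
    qed
  qed (auto intro: union)
qed

lemma smooth_part_in_identity_component:
  assumes X: "X \<in> smooth_at_identity"
  obtains Y where "Y \<in> smooth_at_identity" "Y \<subseteq> G0" "point_derivs R Y \<one> = point_derivs R X \<one>"
proof -
  obtain k where k: "X \<subseteq> pts (V k)" "\<one> \<in> X" using smooth_at_identityD[OF X] .
  obtain Y Z where YZ: "X = Y \<union> Z" "rel_closed X Y" "rel_closed X Z" "\<one> \<in> Y" "\<one> \<notin> Z" "Y \<subseteq> G0"
    using part_in_identity_component[OF k] .
  have smooth: "\<one> \<in> smooth_points V Y"
    using smooth_points_union[OF YZ(1) k(1) YZ(2-5)] X unfolding smooth_at_identity_def by blast
  have "closedin (subtopology T X) Y" using YZ(2) closedin_subtopology_iff[OF k(1)] by blast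
  then obtain D where D: "closedin T D" "Y = D \<inter> X" unfolding closedin_subtopology by (elim exE conjE)
  obtain U C where UC: "openin T U" "closedin T C" "X = U \<inter> C"
    using X unfolding smooth_at_identity_def algebraic_subset_def locally_closed_in_def by blast
  have "Y = U \<inter> (C \<inter> D)" using D(2) UC(3) by blast
  moreover have "closedin T (C \<inter> D)" by (rule closedin_Int[OF UC(2) D(1)])
  moreover have "Y \<subseteq> pts (V k)" using YZ(1) k(1) by blast
  ultimately have "algebraic_subset V Y"
    using UC(1) unfolding algebraic_subset_def bounded_subset_def locally_closed_in_def by blast
  then have "Y \<in> smooth_at_identity" using smooth unfolding smooth_at_identity_def by blast
  moreover have "point_derivs R Y \<one> = point_derivs R X \<one>"
    using point_derivs_union[OF YZ(1,3-5)] by simp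
  ultimately show thesis using that YZ(6) by blast
qed

lemma L_eq_identity_component:
  "L = functional.span (\<Union>X\<in>{X \<in> smooth_at_identity. X \<subseteq> G0}. point_derivs R X \<one>)"
proof -
  have "(\<Union>X\<in>smooth_at_identity. point_derivs R X \<one>) = (\<Union>X\<in>{X \<in> smooth_at_identity. X \<subseteq> G0}. point_derivs R X \<one>)"
  proof (intro equalityI subsetI)
    fix A assume "A \<in> (\<Union>X\<in>smooth_at_identity. point_derivs R X \<one>)"
    then obtain X where X: "X \<in> smooth_at_identity" "A \<in> point_derivs R X \<one>" by (rule UN_E)
    obtain Y where "Y \<in> smooth_at_identity" "Y \<subseteq> G0" "point_derivs R Y \<one> = point_derivs R X \<one>"
      using smooth_part_in_identity_component[OF X(1)] .
    then show "A \<in> (\<Union>X\<in>{X \<in> smooth_at_identity. X \<subseteq> G0}. point_derivs R X \<one>)"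
      using X(2) by (intro UN_I[of Y]) auto
  qed auto
  then show ?thesis unfolding L_eq by simp
qed

end

section \<open>Closed ind-subvarieties\<close>

lemma affine_variety_subvariety:
  assumes X: "affine_variety X" and C: "zariski_closed_in X C"
  shows "affine_variety (subvariety X C)"
proof -
  obtain n S \<phi> where S: "S \<subseteq> poly_fun n" and bij: "bij_betw \<phi> (pts X) (zero_locus n S)"
    and regX: "reg X = {f. \<exists>p\<in>poly_fun n. \<forall>x\<in>pts X. f x = p (\<phi> x)}"
    using X unfolding affine_variety_def by blast
  obtain F where F: "F \<subseteq> reg X" "C = {x \<in> pts X. \<forall>f\<in>F. f x = 0}"
    using C unfolding zariski_closed_in_def by blast
  have CX: "C \<subseteq> pts X" using F(2) by blast
  define S' where "S' = S \<union> {p \<in> poly_fun n. \<forall>x\<in>C. p (\<phi> x) = 0}"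
  have "\<phi> ` C = zero_locus n S'"
  proof (intro equalityI subsetI)
    fix v assume "v \<in> \<phi> ` C"
    then obtain x where x: "v = \<phi> x" "x \<in> C" by (rule imageE)
    have "\<phi> x \<in> zero_locus n S" using x(2) CX bij unfolding bij_betw_def by blast
    then show "v \<in> zero_locus n S'" using x unfolding zero_locus_def S'_def by auto
  next
    fix v assume v: "v \<in> zero_locus n S'"
    then have "v \<in> zero_locus n S" unfolding zero_locus_def S'_def by auto
    then have "v \<in> \<phi> ` pts X" using bij by (simp add: bij_betw_def)
    then obtain x where x: "v = \<phi> x" "x \<in> pts X" by (rule imageE)
    have "f x = 0" if f: "f \<in> F" for f
    proof -
      obtain p where p: "p \<in> poly_fun n" "\<forall>x\<in>pts X. f x = p (\<phi> x)" using f F(1) unfolding regX by blast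
      have "p (\<phi> y) = 0" if "y \<in> C" for y
      proof -
        have "f y = 0" "y \<in> pts X" using that f unfolding F(2) by blast+
        then show ?thesis using p(2) by simp
      qed
      then have "p \<in> S'" using p(1) unfolding S'_def by blast
      then have "p v = 0" using v unfolding zero_locus_def by blast
      then show ?thesis using p(2) x by simp
    qed
    then have "x \<in> C" using x(2) unfolding F(2) by blast
    then show "v \<in> \<phi> ` C" using x(1) by blast
  qed
  moreover have "inj_on \<phi> C" using bij CX inj_on_subset unfolding bij_betw_def by blast
  ultimately have "bij_betw \<phi> (pts (subvariety X C)) (zero_locus n S')"
    by (simp add: bij_betw_def subvariety_def)
  moreover have "S' \<subseteq> poly_fun n" using S unfolding S'_def by blast
  moreover have "reg (subvariety X C) = {f. \<exists>p\<in>poly_fun n. \<forall>x\<in>pts (subvariety X C). f x = p (\<phi> x)}"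
  proof (intro equalityI subsetI)
    fix f assume "f \<in> reg (subvariety X C)"
    then obtain g where g: "g \<in> reg X" "\<forall>x\<in>C. f x = g x" by (auto simp: subvariety_def)
    then obtain p where "p \<in> poly_fun n" "\<forall>x\<in>pts X. g x = p (\<phi> x)" unfolding regX by blast
    then show "f \<in> {f. \<exists>p\<in>poly_fun n. \<forall>x\<in>pts (subvariety X C). f x = p (\<phi> x)}"
      using g(2) CX by (auto simp: subvariety_def intro!: bexI[of _ p])
  next
    fix f assume "f \<in> {f. \<exists>p\<in>poly_fun n. \<forall>x\<in>pts (subvariety X C). f x = p (\<phi> x)}"
    then obtain p where p: "p \<in> poly_fun n" "\<forall>x\<in>C. f x = p (\<phi> x)" by (auto simp: subvariety_def)
    then have "(\<lambda>x. p (\<phi> x)) \<in> reg X" unfolding regX by blast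
    then show "f \<in> reg (subvariety X C)" using p(2) by (auto simp: subvariety_def)
  qed
  ultimately show ?thesis unfolding affine_variety_def by blast
qed

context ind_variety_space
begin

context
  fixes Z :: "'a set"
  assumes Z: "closedin T Z"
begin

lemma pts_ind_sub: "pts (ind_sub V Z k) = pts (V k) \<inter> Z"
  and reg_ind_sub: "reg (ind_sub V Z k) = {f. \<exists>g\<in>reg (V k). \<forall>x\<in>pts (V k) \<inter> Z. f x = g x}"
  by (simp_all add: ind_sub_def subvariety_def)

lemma rel_closed_Int: "rel_closed (pts (V k)) (pts (V k) \<inter> Z)"
  using Z unfolding closedin_iff by blast

lemma ind_variety_ind_sub: "ind_variety (ind_sub V Z)"
  unfolding ind_variety_def
proof (intro allI conjI)
  fix k
  show "affine_variety (ind_sub V Z k)"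
    unfolding ind_sub_def
    by (rule affine_variety_subvariety[OF affine]) (simp add: zariski_closed_iff rel_closed_Int)
  have mono: "pts (V k) \<subseteq> pts (V (Suc k))" by (rule pts_mono) simp
  obtain F where F: "F \<subseteq> R" "pts (V k) = zeros (pts (V (Suc k))) F"
    using rel_closed_pts[of k "Suc k"] unfolding rel_closed_def by auto
  have "F \<subseteq> reg (ind_sub V Z (Suc k))"
    using F(1) R_subset_reg[of "Suc k"] unfolding reg_ind_sub by blast
  moreover have "pts (V k) \<inter> Z = {x \<in> pts (ind_sub V Z (Suc k)). \<forall>f\<in>F. f x = 0}"
    unfolding pts_ind_sub F(2) zeros_def by blast
  ultimately have cl: "zariski_closed_in (ind_sub V Z (Suc k)) (pts (ind_sub V Z k))"
    unfolding zariski_closed_in_def pts_ind_sub by blast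
  have "reg (ind_sub V Z k) = reg (subvariety (ind_sub V Z (Suc k)) (pts (ind_sub V Z k)))"
  proof (intro equalityI subsetI)
    fix f assume "f \<in> reg (ind_sub V Z k)"
    then obtain g where g: "g \<in> reg (V k)" "\<forall>x\<in>pts (V k) \<inter> Z. f x = g x" unfolding reg_ind_sub by blast
    obtain h where h: "h \<in> R" "\<And>x. x \<in> pts (V k) \<Longrightarrow> h x = g x" using ind_reg_extend[OF ind_var g(1)] by blast
    have "h \<in> reg (ind_sub V Z (Suc k))" using h(1) R_subset_reg[of "Suc k"] unfolding reg_ind_sub by blast
    then show "f \<in> reg (subvariety (ind_sub V Z (Suc k)) (pts (ind_sub V Z k)))"
      using g(2) h(2) by (auto simp: subvariety_def pts_ind_sub intro!: bexI[of _ h])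
  next
    fix f assume "f \<in> reg (subvariety (ind_sub V Z (Suc k)) (pts (ind_sub V Z k)))"
    then obtain g where g: "g \<in> reg (ind_sub V Z (Suc k))" "\<forall>x\<in>pts (V k) \<inter> Z. f x = g x"
      by (auto simp: subvariety_def pts_ind_sub)
    then obtain g' where g': "g' \<in> reg (V (Suc k))" "\<forall>x\<in>pts (V (Suc k)) \<inter> Z. g x = g' x"
      unfolding reg_ind_sub by blast
    have "g' \<in> reg (V k)" using g'(1) ind_variety_mono(2)[OF ind_var, of k "Suc k"] by auto
    then show "f \<in> reg (ind_sub V Z k)"
      unfolding reg_ind_sub using g(2) g'(2) mono by (intro CollectI bexI[of _ g']) auto
  qed
  then have "ind_sub V Z k = subvariety (ind_sub V Z (Suc k)) (pts (ind_sub V Z k))"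
    by (intro variety.equality) (simp_all add: subvariety_def)
  with cl show "is_closed_subvariety (ind_sub V Z k) (ind_sub V Z (Suc k))"
    unfolding is_closed_subvariety_def by blast
qed

interpretation sub: ind_variety_space "ind_sub V Z"
  by unfold_locales (rule ind_variety_ind_sub)

lemma R_subset_sub: "R \<subseteq> sub.R"
proof
  fix f assume "f \<in> R"
  then have "f \<in> reg (ind_sub V Z k)" for k using R_subset_reg[of k] unfolding reg_ind_sub by blast
  then show "f \<in> sub.R" unfolding ind_reg_def by blast
qed

text \<open>The restriction to a bounded set extends to a member of the filtration, and then along the
  filtration.\<close>

lemma sub_R_extend:
  assumes "X \<subseteq> pts (ind_sub V Z k)" "f \<in> sub.R" shows "\<exists>g\<in>R. \<forall>y\<in>X. f y = g y"
proof -
  obtain g where g: "g \<in> reg (V k)" "\<forall>x\<in>pts (V k) \<inter> Z. f x = g x"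
    using subsetD[OF sub.R_subset_reg assms(2), of k] unfolding reg_ind_sub by blast
  obtain h where h: "h \<in> R" "\<And>x. x \<in> pts (V k) \<Longrightarrow> h x = g x" using ind_reg_extend[OF ind_var g(1)] by blast
  have "f y = h y" if "y \<in> X" for y
  proof -
    have "y \<in> pts (V k)" "y \<in> Z" using that assms(1) unfolding pts_ind_sub by blast+
    then show ?thesis using g(2) h(2)[of y] by simp
  qed
  then show ?thesis using h(1) by blast
qed

lemma sub_rel_closed:
  assumes X: "X \<subseteq> pts (ind_sub V Z k)" shows "sub.rel_closed X C \<longleftrightarrow> rel_closed X C"
proof
  assume "rel_closed X C"
  then show "sub.rel_closed X C"
    unfolding rel_closed_def sub.rel_closed_def zeros_def sub.zeros_def using R_subset_sub by blast
next
  assume "sub.rel_closed X C"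
  then obtain F where F: "F \<subseteq> sub.R" "C = sub.zeros X F" unfolding sub.rel_closed_def by blast
  let ?H = "{h \<in> R. \<exists>f\<in>F. \<forall>y\<in>X. f y = h y}"
  have "C = zeros X ?H"
  proof (intro equalityI subsetI)
    fix x assume "x \<in> C" then show "x \<in> zeros X ?H" unfolding F(2) zeros_def sub.zeros_def by auto
  next
    fix x assume x: "x \<in> zeros X ?H"
    have "f x = 0" if f: "f \<in> F" for f
    proof -
      obtain h where h: "h \<in> R" "\<forall>y\<in>X. f y = h y" using sub_R_extend[OF X] F(1) f by blast
      then have "h x = 0" using x f unfolding zeros_def by blast
      then show ?thesis using h(2) x unfolding zeros_def by simp
    qed
    then show "x \<in> C" using x unfolding F(2) zeros_def sub.zeros_def by blast
  qed
  then show "rel_closed X C" unfolding rel_closed_def by (intro exI[of _ ?H]) blast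
qed

lemma ind_pts_ind_sub: "ind_pts (ind_sub V Z) = Z"
proof -
  have "Z \<subseteq> ind_pts V" using closedin_subset[OF Z] topspace_T by simp
  then show ?thesis unfolding ind_pts_def pts_ind_sub by blast
qed

lemma ind_zariski_ind_sub: "sub.T = subtopology T Z"
proof -
  have cl: "closedin sub.T C \<longleftrightarrow> closedin (subtopology T Z) C" for C
  proof -
    have eq: "sub.rel_closed (pts (ind_sub V Z k)) (pts (ind_sub V Z k) \<inter> C) \<longleftrightarrow>
        rel_closed (pts (V k)) (pts (V k) \<inter> C)" if C: "C \<subseteq> Z" for k
    proof -
      have Int: "pts (V k) \<inter> Z \<inter> C = pts (V k) \<inter> C" using C by blast
      have "rel_closed (pts (V k) \<inter> Z) (pts (V k) \<inter> C)" if "rel_closed (pts (V k)) (pts (V k) \<inter> C)"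
      proof -
        have "pts (V k) \<inter> Z \<inter> (pts (V k) \<inter> C) = pts (V k) \<inter> C" using C by blast
        then show ?thesis using rel_closed_restrict[OF that Int_lower1, of Z] by simp
      qed
      moreover have "rel_closed (pts (V k)) (pts (V k) \<inter> C)" if "rel_closed (pts (V k) \<inter> Z) (pts (V k) \<inter> C)"
        by (rule rel_closed_trans[OF rel_closed_Int that])
      ultimately show ?thesis
        unfolding sub_rel_closed[OF order_refl] unfolding pts_ind_sub Int by blast
    qed
    show ?thesis
      unfolding sub.closedin_iff ind_pts_ind_sub closedin_closed_subtopology[OF Z] closedin_iff
      using eq closedin_subset[OF Z] topspace_T by auto
  qed
  have "topspace sub.T = topspace (subtopology T Z)"
    using closedin_subset[OF Z] by (simp add: sub.topspace_T ind_pts_ind_sub Int_absorb1)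
  then show ?thesis unfolding topology_eq openin_closedin_eq cl by simp
qed

lemma subtopology_ind_sub: "X \<subseteq> Z \<Longrightarrow> subtopology sub.T X = subtopology T X"
  unfolding ind_zariski_ind_sub subtopology_subtopology by (simp add: Int_absorb1)

lemma point_derivs_ind_sub:
  assumes X: "X \<subseteq> pts (ind_sub V Z k)" and x: "x \<in> X"
  shows "bij_betw (differential R id) (point_derivs sub.R X x) (point_derivs R X x)"
  by (rule point_derivs_change_ring[OF function_ring_R sub.function_ring_R R_subset_sub sub_R_extend[OF X] x])

lemma smooth_points_ind_sub:
  assumes X: "X \<subseteq> pts (ind_sub V Z k)"
  shows "smooth_points (ind_sub V Z) X = smooth_points V X"
proof -
  have XV: "X \<subseteq> pts (V k)" "X \<subseteq> Z" using X unfolding pts_ind_sub by blast+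
  have "functional.dim (point_derivs sub.R X x) = functional.dim (point_derivs R X x)" if "x \<in> X" for x
    using dim_differential[OF subspace_point_derivs[OF sub.function_ring_R]]
      point_derivs_ind_sub[OF X that] unfolding bij_betw_def by metis
  then show ?thesis
    using sub.smooth_points_iff[OF X] smooth_points_iff[OF XV(1)] subtopology_ind_sub[OF XV(2)] by auto
qed

lemma algebraic_subset_ind_sub:
  "algebraic_subset (ind_sub V Z) X \<longleftrightarrow> algebraic_subset V X \<and> X \<subseteq> Z"
proof -
  have "locally_closed_in (subtopology T Z) X \<longleftrightarrow> locally_closed_in T X" if XZ: "X \<subseteq> Z"
  proof
    assume "locally_closed_in (subtopology T Z) X"
    then obtain U C where UC: "openin (subtopology T Z) U" "closedin (subtopology T Z) C" "X = U \<inter> C"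
      unfolding locally_closed_in_def by blast
    then obtain U' where U': "openin T U'" "U = U' \<inter> Z" unfolding openin_subtopology by blast
    have C: "closedin T C" "C \<subseteq> Z" using UC(2) closedin_closed_subtopology[OF Z] by blast+
    then have "X = U' \<inter> C" using UC(3) U'(2) by blast
    then show "locally_closed_in T X" using U'(1) C(1) unfolding locally_closed_in_def by blast
  next
    assume "locally_closed_in T X"
    then obtain U C where UC: "openin T U" "closedin T C" "X = U \<inter> C"
      unfolding locally_closed_in_def by blast
    have "openin (subtopology T Z) (U \<inter> Z)" "closedin (subtopology T Z) (C \<inter> Z)"
      unfolding openin_subtopology closedin_subtopology using UC by blast+
    moreover have "X = (U \<inter> Z) \<inter> (C \<inter> Z)" using UC(3) XZ by blast
    ultimately show "locally_closed_in (subtopology T Z) X" unfolding locally_closed_in_def by blast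
  qed
  then show ?thesis
    unfolding algebraic_subset_def bounded_subset_def ind_zariski_ind_sub pts_ind_sub by blast
qed

lemma subset_tangent_space_ind_sub:
  assumes X: "X \<subseteq> pts (ind_sub V Z k)" and x: "x \<in> X"
  shows "differential R id ` subset_tangent_space (ind_sub V Z) X x = point_derivs R X x"
  unfolding sub.subset_tangent_space_eq[OF X x] using point_derivs_ind_sub[OF X x] by (simp add: bij_betw_def)

end

end

context ind_group
begin

lemma L_identity_component:
  "differential R id ` L_space (G\<lparr>carrier := G0\<rparr>) (ind_sub V G0) = L"
proof -
  interpret l: Vector_Spaces.linear scale_functional scale_functional "differential R id"
    by (rule linear_differential)
  note Z = closedin_G0
  let ?V = "ind_sub V G0"
  have fam: "{X. algebraic_subset ?V X \<and> \<one> \<in> smooth_points ?V X} = {X \<in> smooth_at_identity. X \<subseteq> G0}"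
  proof -
    have "\<one> \<in> smooth_points ?V X \<longleftrightarrow> \<one> \<in> smooth_points V X" if X: "algebraic_subset ?V X" for X
    proof -
      obtain k where "X \<subseteq> pts (?V k)" using X unfolding algebraic_subset_def bounded_subset_def by blast
      then show ?thesis using smooth_points_ind_sub[OF Z] by blast
    qed
    then show ?thesis unfolding smooth_at_identity_def using algebraic_subset_ind_sub[OF Z] by blast
  qed
  have tangent: "differential R id ` subset_tangent_space ?V X \<one> = point_derivs R X \<one>"
    if X: "X \<in> {X \<in> smooth_at_identity. X \<subseteq> G0}" for X
  proof -
    obtain k where "X \<subseteq> pts (V k)" "\<one> \<in> X" using X smooth_at_identityD by blast
    then have "X \<subseteq> pts (?V k)" "\<one> \<in> X" using X unfolding pts_ind_sub[OF Z] by blast+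
    then show ?thesis by (rule subset_tangent_space_ind_sub[OF Z])
  qed
  have "L_space (G\<lparr>carrier := G0\<rparr>) ?V = functional.span (\<Union>X\<in>{X \<in> smooth_at_identity. X \<subseteq> G0}. subset_tangent_space ?V X \<one>)"
    unfolding L_space_def by (simp add: fam)
  then have "differential R id ` L_space (G\<lparr>carrier := G0\<rparr>) ?V =
      functional.span (\<Union>X\<in>{X \<in> smooth_at_identity. X \<subseteq> G0}. differential R id ` subset_tangent_space ?V X \<one>)"
    by (simp add: l.span_image[symmetric] image_UN)
  also have "\<dots> = L" unfolding L_eq_identity_component using tangent by simp
  finally show ?thesis .
qed

end

context ind_group
begin

section \<open>The finite dimensional case\<close>

lemma point_derivs_subset_identity_component:
  assumes X: "X \<subseteq> pts (V k)" and one: "\<one> \<in> X"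
  shows "point_derivs R X \<one> \<subseteq> point_derivs R G0 \<one>"
proof -
  obtain Y Z where YZ: "X = Y \<union> Z" "rel_closed X Y" "rel_closed X Z" "\<one> \<in> Y" "\<one> \<notin> Z" "Y \<subseteq> G0"
    using part_in_identity_component[OF X one] .
  show ?thesis unfolding point_derivs_union[OF YZ(1,3-5)] by (rule point_derivs_mono[OF YZ(6)])
qed

text \<open>Near the identity every member of the filtration lies in the identity component.\<close>

lemma Lie_subset_identity_component: "Lie G V \<subseteq> point_derivs R G0 \<one>"
  unfolding Lie_eq
proof (rule UN_least)
  fix k assume "k \<in> {k. \<one> \<in> pts (V k)}"
  then show "point_derivs R (pts (V k)) \<one> \<subseteq> point_derivs R G0 \<one>"
    by (intro point_derivs_subset_identity_component[OF order_refl]) simp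
qed

lemma L_eq_Lie_if_algebraic:
  assumes "algebraic_subgroup G V G0" shows "L = Lie G V"
  using Lie_subset_identity_component point_derivs_subset_L[OF algebraic_subgroup_smooth[OF assms]]
    L_subset_Lie by blast

lemma finite_dimensional_if_algebraic:
  assumes "algebraic_subgroup G V G0" shows "finite_dimensional L"
proof -
  obtain k where k: "G0 \<subseteq> pts (V k)"
    using assms unfolding algebraic_subgroup_def algebraic_subset_def bounded_subset_def by blast
  obtain a J where "finite J" "generators R G0 a J" by (rule generators_bounded[OF k])
  moreover have "L \<subseteq> point_derivs R G0 \<one>" using L_subset_Lie Lie_subset_identity_component by blast
  ultimately show ?thesis
    by (intro finite_dimensional_point_derivs[OF function_ring_R _ _ subspace_L])
qed

text \<open>Let \<open>C\<close> and \<open>D\<close> be closed and cover the products.  Each \<open>x Y\<close> is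
  irreducible, so it lies in \<open>C\<close> or in \<open>D\<close>, and the \<open>x\<close> for which it lies in
  a given one of them form a closed set.\<close>

lemma irreducible_product:
  assumes X: "irreducible_in T X" and Y: "irreducible_in T Y"
  shows "irreducible_in T {x \<otimes> y | x y. x \<in> X \<and> y \<in> Y}" (is "irreducible_in T ?P")
proof (rule irreducible_inI)
  have XG: "x \<in> carrier G" if "x \<in> X" for x
    using irreducible_in_subset[OF X] that by (auto simp: topspace_T carrier_eq)
  have YG: "y \<in> carrier G" if "y \<in> Y" for y
    using irreducible_in_subset[OF Y] that by (auto simp: topspace_T carrier_eq)
  show "?P \<subseteq> topspace T" using XG YG by (auto simp: topspace_T carrier_eq[symmetric])
  show "?P \<noteq> {}" using irreducible_in_nonempty[OF X] irreducible_in_nonempty[OF Y] by blast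
  fix C D assume CD: "closedin T C" "closedin T D" "?P \<subseteq> C \<union> D"
  define K where "K E = (\<Inter>y\<in>Y. (\<lambda>x. x \<otimes> inv y) ` E)" for E
  have K_closed: "closedin T (K E)" if "closedin T E" for E
    unfolding K_def
  proof (rule closedin_Inter)
    show "(\<lambda>y. (\<lambda>x. x \<otimes> inv y) ` E) ` Y \<noteq> {}" using irreducible_in_nonempty[OF Y] by simp
    fix S assume "S \<in> (\<lambda>y. (\<lambda>x. x \<otimes> inv y) ` E) ` Y"
    then obtain y where "y \<in> Y" "S = (\<lambda>x. x \<otimes> inv y) ` E" by blast
    then show "closedin T S" using automorphism_closedin[OF right_translation[OF inv_closed[OF YG]] that] by simp
  qed
  have K_iff: "x \<in> K E \<longleftrightarrow> (\<forall>y\<in>Y. x \<otimes> y \<in> E)" if x: "x \<in> X" and E: "closedin T E" for x E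
  proof -
    have EG: "e \<in> carrier G" if "e \<in> E" for e
      using closedin_subset[OF E] that by (auto simp: topspace_T carrier_eq)
    have "x \<in> (\<lambda>x. x \<otimes> inv y) ` E \<longleftrightarrow> x \<otimes> y \<in> E" if y: "y \<in> Y" for y
    proof
      assume "x \<in> (\<lambda>x. x \<otimes> inv y) ` E"
      then obtain e where "x = e \<otimes> inv y" "e \<in> E" by (rule imageE)
      then show "x \<otimes> y \<in> E" using EG YG[OF y] by (simp add: m_assoc)
    next
      assume "x \<otimes> y \<in> E"
      moreover have "x = x \<otimes> y \<otimes> inv y" using XG[OF x] YG[OF y] by (simp add: m_assoc)
      ultimately show "x \<in> (\<lambda>x. x \<otimes> inv y) ` E" by (rule image_eqI[rotated])
    qed
    then show ?thesis unfolding K_def by blast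
  qed
  have "X \<subseteq> K C \<union> K D"
  proof
    fix x assume x: "x \<in> X"
    have "(\<lambda>y. x \<otimes> y) ` Y \<subseteq> C \<union> D" using CD(3) x by blast
    then have "(\<lambda>y. x \<otimes> y) ` Y \<subseteq> C \<or> (\<lambda>y. x \<otimes> y) ` Y \<subseteq> D"
      by (rule irreducible_in_cases[OF automorphism_irreducible[OF left_translation[OF XG[OF x]] Y] CD(1,2)])
    then show "x \<in> K C \<union> K D" using K_iff[OF x CD(1)] K_iff[OF x CD(2)] by blast
  qed
  then have "X \<subseteq> K C \<or> X \<subseteq> K D" by (rule irreducible_in_cases[OF X K_closed[OF CD(1)] K_closed[OF CD(2)]])
  then show "?P \<subseteq> C \<or> ?P \<subseteq> D" using K_iff CD(1,2) by blast
qed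

text \<open>A translation moves a smooth point of \<open>Z\<close> to the identity, and then the tangent space, whose
  dimension is that of \<open>Z\<close>, is contained in \<open>L\<close>.\<close>

lemma generic_dim_le:
  assumes B: "finite B" "functional.span B = L" and Z: "rel_closed (pts (V k)) Z" "prime_on R Z"
  shows "generic_dim R Z \<le> card B"
proof -
  have "Z \<noteq> {}" using Z(2) unfolding prime_on_def by blast
  then have "\<not> vanishes_on Z (\<lambda>_. 1 :: 'k)" by (auto simp: vanishes_on_def)
  then obtain x where x: "x \<in> smooth_points V Z" "functional.dim (point_derivs R Z x) = generic_dim R Z"
    using smooth_point_irreducible[OF Z function_ring_const[OF function_ring_R, of 1]] by metis
  have ZV: "Z \<subseteq> pts (V k)" by (rule rel_closed_subset[OF Z(1)])
  have xZ: "x \<in> Z" using x(1) unfolding smooth_points_def by blast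
  have xG: "x \<in> carrier G" using xZ ZV in_carrier by blast
  let ?\<phi> = "\<lambda>y. inv x \<otimes> y"
  note a = left_translation[OF inv_closed[OF xG]]
  have one: "?\<phi> x = \<one>" using xG by simp
  have P: "Z \<subseteq> ind_pts V" "x \<in> ind_pts V" using ZV xG pts_subset carrier_eq by blast+
  have "?\<phi> ` Z \<in> smooth_at_identity"
    using automorphism_algebraic_subset[OF a algebraic_subset_closed[OF Z(1)]] automorphism_smooth[OF a ZV x(1)]
    unfolding smooth_at_identity_def one by blast
  then have "point_derivs R (?\<phi> ` Z) (?\<phi> x) \<subseteq> functional.span B"
    using point_derivs_subset_L B(2) unfolding one by blast
  then have "functional.dim (point_derivs R (?\<phi> ` Z) (?\<phi> x)) \<le> card B" by (rule functional.dim_le_card[OF _ B(1)])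
  moreover have "functional.dim (point_derivs R (?\<phi> ` Z) (?\<phi> x)) = functional.dim (point_derivs R Z x)"
    using dim_differential[OF subspace_point_derivs[OF function_ring_R] automorphism_point_derivs(2)[OF a P]]
    unfolding automorphism_point_derivs(1)[OF a P] .
  ultimately show ?thesis using x(2) by simp
qed

text \<open>The closure of the set of products is irreducible, bounded and contains \<open>Z\<close>, so it equals
  \<open>Z\<close> by maximality of the dimension.\<close>

lemma maximal_irreducible_absorbs:
  assumes Z: "rel_closed (pts (V k)) Z" "prime_on R Z" "\<one> \<in> Z"
    and max: "\<And>l W. rel_closed (pts (V l)) W \<Longrightarrow> prime_on R W \<Longrightarrow> \<one> \<in> W \<Longrightarrow>
      generic_dim R W \<le> generic_dim R Z"
    and Y: "irreducible_in T Y" "Y \<subseteq> pts (V m)" "\<one> \<in> Y"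
    and zy: "z \<in> Z" "y \<in> Y"
  shows "z \<otimes> y \<in> Z"
proof -
  let ?P = "{x \<otimes> y | x y. x \<in> Z \<and> y \<in> Y}"
  have ZV: "Z \<subseteq> pts (V k)" by (rule rel_closed_subset[OF Z(1)])
  have irrZ: "irreducible_in T Z" using irreducible_iff_prime[OF ZV] Z(2) by blast
  obtain l where Pl: "?P \<subseteq> pts (V l)"
  proof (rule mult_bounded_sets[OF ZV Y(2)])
    fix l assume "\<And>x y. x \<in> Z \<Longrightarrow> y \<in> Y \<Longrightarrow> x \<otimes> y \<in> pts (V l)"
    then have "?P \<subseteq> pts (V l)" by auto
    then show thesis by (rule that)
  qed
  let ?C = "T closure_of ?P"
  have PC: "?P \<subseteq> ?C" by (rule closure_of_superset[OF Pl])
  have Cl: "?C \<subseteq> pts (V l)" by (rule closure_of_bounded[OF Pl])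
  have primeC: "prime_on R ?C"
    using irreducible_closure[OF irreducible_product[OF irrZ Y(1)]] irreducible_iff_prime[OF Cl] by blast
  have relC: "rel_closed (pts (V l)) ?C" by (rule rel_closed_if_closedin[OF closedin_closure_of Cl])
  have ZP: "Z \<subseteq> ?P"
  proof
    fix x assume x: "x \<in> Z"
    then have "x = x \<otimes> \<one>" using ZV in_carrier by auto
    then show "x \<in> ?P" using x Y(3) by blast
  qed
  have "?C = Z"
  proof (rule ccontr)
    assume "?C \<noteq> Z"
    then have strict: "Z \<subset> ?C" using ZP PC by blast
    have "rel_closed (pts (V l)) Z"
      by (rule rel_closed_if_closedin[OF closedin_if_rel_closed[OF Z(1)] order_trans[OF ZP Pl]])
    then have "generic_dim R Z < generic_dim R ?C"
      by (rule generic_dim_strict[OF order_refl _ Z(2) primeC Cl strict])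
    moreover have "generic_dim R ?C \<le> generic_dim R Z"
      by (rule max[OF relC primeC]) (use Z(3) ZP PC in blast)
    ultimately show False by simp
  qed
  then show ?thesis using zy PC by blast
qed

text \<open>The dimensions of irreducible closed bounded sets through the identity are at most that of
  \<open>L\<close>, so one of them, \<open>Z\<close>, has maximal dimension.  It absorbs the others, in
  particular itself and its inverse, and so is a subgroup.  A translate of an irreducible piece of a member
  of the filtration that meets \<open>Z\<close> is absorbed as well, hence the pieces that are not contained
  in \<open>Z\<close> are disjoint from \<open>Z\<close>, and \<open>Z\<close> is open.  An open and closed connected
  set is a connected component.\<close>

lemma algebraic_if_finite_dimensional:
  assumes "finite_dimensional L" shows "algebraic_subgroup G V G0"
proof -
  obtain B where B: "finite B" "functional.span B = L" using assms unfolding finite_dimensional_def by blast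
  let ?A = "\<lambda>Z. (\<exists>k. rel_closed (pts (V k)) Z) \<and> prime_on R Z \<and> \<one> \<in> Z"
  have "\<exists>Z. ?A Z"
  proof -
    obtain k where k: "\<one> \<in> pts (V k)" by (rule one_pts)
    obtain \<D> where \<D>: "finite \<D>" "pts (V k) = \<Union>\<D>" "\<And>D. D \<in> \<D> \<Longrightarrow> rel_closed (pts (V k)) D \<and> prime_on R D"
      using irreducible_decomposition[OF order_refl rel_closed_self] by metis
    then show ?thesis using k by blast
  qed
  then obtain Z0 where "?A Z0" by blast
  moreover have "\<forall>Z. ?A Z \<longrightarrow> generic_dim R Z < Suc (card B)" using generic_dim_le[OF B] by (auto simp: less_Suc_eq_le)
  ultimately have "\<exists>Z. ?A Z \<and> (\<forall>W. ?A W \<longrightarrow> generic_dim R W \<le> generic_dim R Z)" by (rule ex_has_greatest_nat)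
  then obtain Z where AZ: "?A Z \<and> (\<forall>W. ?A W \<longrightarrow> generic_dim R W \<le> generic_dim R Z)" ..
  then obtain k where Z: "rel_closed (pts (V k)) Z" "prime_on R Z" "\<one> \<in> Z" by blast
  have max: "\<forall>W. ?A W \<longrightarrow> generic_dim R W \<le> generic_dim R Z" using AZ by (rule conjunct2)
  have ZV: "Z \<subseteq> pts (V k)" by (rule rel_closed_subset[OF Z(1)])
  have irrZ: "irreducible_in T Z" using irreducible_iff_prime[OF ZV] Z(2) by blast
  have closedZ: "closedin T Z" by (rule closedin_if_rel_closed[OF Z(1)])
  have ZG: "x \<in> carrier G" if "x \<in> Z" for x using that ZV in_carrier by blast
  have absorb: "z \<otimes> y \<in> Z"
    if Y: "irreducible_in T Y" "Y \<subseteq> pts (V m)" "\<one> \<in> Y" and zy: "z \<in> Z" "y \<in> Y" for Y m z y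
    by (rule maximal_irreducible_absorbs[OF Z _ Y zy]) (use max in blast)
  have absorb1: "Y \<subseteq> Z" if Y: "irreducible_in T Y" "Y \<subseteq> pts (V m)" "\<one> \<in> Y" for Y m
  proof
    fix y assume y: "y \<in> Y"
    then have "y \<in> carrier G" using Y(2) in_carrier by blast
    then show "y \<in> Z" using absorb[OF Y Z(3) y] by simp
  qed
  have subgroup: "subgroup Z G"
  proof (rule subgroupI)
    show "Z \<subseteq> carrier G" using ZG by blast
    show "Z \<noteq> {}" using Z(3) by blast
    show "x \<otimes> y \<in> Z" if "x \<in> Z" "y \<in> Z" for x y by (rule absorb[OF irrZ ZV Z(3) that])
    have "(\<lambda>x. inv x) ` Z \<subseteq> Z"
    proof -
      obtain l where "(\<lambda>x. inv x) ` Z \<subseteq> pts (V l)" using automorphism_bounded[OF inversion ZV] .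
      moreover have "irreducible_in T ((\<lambda>x. inv x) ` Z)" by (rule automorphism_irreducible[OF inversion irrZ])
      moreover have "\<one> \<in> (\<lambda>x. inv x) ` Z" using Z(3) by (intro image_eqI[of _ _ \<one>]) simp_all
      ultimately show ?thesis using absorb1 by blast
    qed
    then show "inv x \<in> Z" if "x \<in> Z" for x using that by blast
  qed
  have closed_compl: "closedin T (ind_pts V - Z)"
    unfolding closedin_iff
  proof (intro conjI allI)
    fix m
    obtain \<D> where \<D>: "finite \<D>" "pts (V m) = \<Union>\<D>" "\<And>D. D \<in> \<D> \<Longrightarrow> rel_closed (pts (V m)) D \<and> prime_on R D"
      using irreducible_decomposition[OF order_refl rel_closed_self] by metis
    have inZ: "D \<subseteq> Z" if D: "D \<in> \<D>" and z: "z \<in> D" "z \<in> Z" for D z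
    proof -
      have zG: "z \<in> carrier G" by (rule ZG[OF z(2)])
      have Dm: "D \<subseteq> pts (V m)" using \<D>(2) D by blast
      note a = left_translation[OF inv_closed[OF zG]]
      obtain l where l: "(\<lambda>x. inv z \<otimes> x) ` D \<subseteq> pts (V l)" using automorphism_bounded[OF a Dm] .
      have "irreducible_in T D" using irreducible_iff_prime[OF Dm] \<D>(3)[OF D] by blast
      then have irr: "irreducible_in T ((\<lambda>x. inv z \<otimes> x) ` D)" by (rule automorphism_irreducible[OF a])
      have "\<one> \<in> (\<lambda>x. inv z \<otimes> x) ` D" using z(1) zG by (intro image_eqI[of _ _ z]) simp_all
      then have sub: "(\<lambda>x. inv z \<otimes> x) ` D \<subseteq> Z" by (rule absorb1[OF irr l])
      show "D \<subseteq> Z"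
      proof
        fix d assume d: "d \<in> D"
        then have "inv z \<otimes> d \<in> Z" "d \<in> carrier G" using sub Dm in_carrier by blast+
        then have "z \<otimes> (inv z \<otimes> d) \<in> Z" using subgroup.m_closed[OF subgroup z(2)] by blast
        then show "d \<in> Z" using zG \<open>d \<in> carrier G\<close> by (simp flip: m_assoc)
      qed
    qed
    have "pts (V m) \<inter> (ind_pts V - Z) = \<Union>{D \<in> \<D>. D \<inter> Z = {}}"
      using \<D>(2) inZ pts_subset[of m] by blast
    moreover have "rel_closed (pts (V m)) (\<Union>{D \<in> \<D>. D \<inter> Z = {}})"
      by (rule rel_closed_Union[OF order_refl]) (use \<D>(1,3) in simp_all)
    ultimately show "rel_closed (pts (V m)) (pts (V m) \<inter> (ind_pts V - Z))" by (simp only:)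
  qed blast
  have ZG0: "Z \<subseteq> G0" by (rule irreducible_subset_G0[OF irrZ Z(3)])
  have "connectedin T G0" unfolding identity_component_def by (rule connectedin_connected_component_of)
  then have G0: "G0 \<subseteq> ind_pts V"
    and "\<nexists>C D. closedin T C \<and> closedin T D \<and> G0 \<subseteq> C \<union> D \<and> C \<inter> D \<inter> G0 = {} \<and> C \<inter> G0 \<noteq> {} \<and> D \<inter> G0 \<noteq> {}"
    unfolding connectedin_closedin topspace_T by simp_all
  then have "\<not> (G0 \<subseteq> Z \<union> (ind_pts V - Z) \<and> Z \<inter> (ind_pts V - Z) \<inter> G0 = {} \<and> Z \<inter> G0 \<noteq> {} \<and>
      (ind_pts V - Z) \<inter> G0 \<noteq> {})"
    using closedZ closed_compl by metis
  then have "G0 = Z" using G0 ZG0 Z(3) by blast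
  then show ?thesis
    unfolding algebraic_subgroup_def using subgroup algebraic_subset_closed[OF Z(1)] by simp
qed

end

theorem proposition7p1p2:
  fixes G :: "('a, 'm) monoid_scheme"
    and V :: "('a, 'k::{alg_closed_field,field_char_0}) ind_var"
  assumes "ind_group G V"
  shows
    "((\<forall>g\<in>carrier G. Ad G V g ` L_space G V \<subseteq> L_space G V) \<and>
      Lie_ideal G V (L_space G V)) \<and>
     (\<forall>H. algebraic_subgroup G V H \<longrightarrow> subset_tangent_space V H \<one>\<^bsub>G\<^esub> \<subseteq> L_space G V) \<and>
     (let G0 = identity_component G V in
        differential (ind_reg V) id ` L_space (G\<lparr>carrier := G0\<rparr>) (ind_sub V G0) = L_space G V \<and>
        (finite_dimensional (L_space G V) \<longleftrightarrow> algebraic_subgroup G V G0) \<and>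
        (finite_dimensional (L_space G V) \<longrightarrow> L_space G V = Lie G V))"
proof -
  interpret ind_group G V by (rule assms)
  have Ad: "(\<forall>g\<in>carrier G. Ad G V g ` L \<subseteq> L) \<and> Lie_ideal G V L"
    using Ad_stable Lie_ideal_L by blast
  have subgroups: "\<forall>H. algebraic_subgroup G V H \<longrightarrow> subset_tangent_space V H \<one>\<^bsub>G\<^esub> \<subseteq> L"
    using algebraic_subgroup_tangent_space by blast
  have fin: "finite_dimensional L \<longleftrightarrow> algebraic_subgroup G V G0"
    using finite_dimensional_if_algebraic algebraic_if_finite_dimensional by blast
  then have Lie: "finite_dimensional L \<longrightarrow> L = Lie G V" using L_eq_Lie_if_algebraic by blast
  show ?thesis unfolding Let_def using Ad subgroups L_identity_component fin Lie by blast
qed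

end
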